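(* Let $n$, $k$ and $p$ be integers satisfying $n=k+p$ and $2\leq p\leq k-1$. Let $\overrightarrow{\mathrm{ext}}(k,n)$ denote the minimum number of arcs in a $k$-critical digraph of order $n$. Then $$\overrightarrow{\mathrm{ext}}(k,n)=2\left(\binom{n}{2}-(p^2+1)\right).$$
   Context: Digraphs are finite and simple: no loops and no parallel arcs in the same direction, but two opposite arcs between the same pair of vertices (a digon) are allowed. $A(D)$ is the arc set of $D$, and the order $|D|$ is the number of vertices. A digraph is acyclic if it contains no directed cycle as a subdigraph (a digon is a directed cycle of order 2). An acyclic $k$-coloring of a digraph $D$ is a map $\varphi:V(D)\to\{1,\dots,k\}$ such that each color class induces an acyclic subdigraph. The dichromatic number $\vec{\chi}(D)$ is the least integer $k\geq 0$ such that $D$ admits an acyclic $k$-coloring. A digraph $D$ is $k$-critical if $\vec{\chi}(D)=k$ and every proper subdigraph $D'$ of $D$ satisfies $\vec{\chi}(D')<k$. Define $\overrightarrow{\mathrm{CRI}}(k,n)$ as the class of $k$-critical digraphs of order $n$, and $\overrightarrow{\mathrm{ext}}(k,n)=\min\{|A(D)| : D\in\overrightarrow{\mathrm{CRI}}(k,n)\}$. *)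

theory Defs
  imports "Graph_Theory.Graph_Theory"
begin

text \<open>
  Digraphs are the \<^locale>\<open>pair_digraph\<close>s of the library: finite, loopless, and with a set of
  ordered pairs as arcs, so that there are no parallel arcs but digons are allowed.  A digon
  \<open>[(u, v), (v, u)]\<close> is a cycle in the sense of \<^const>\<open>pre_digraph.cycle\<close>.
\<close>

definition acyclic_digraph :: "('a, 'b) pre_digraph \<Rightarrow> bool" where
  "acyclic_digraph G \<longleftrightarrow> \<not> (\<exists>p. pre_digraph.cycle G p)"

definition acyclic_coloring :: "'a pair_pre_digraph \<Rightarrow> nat \<Rightarrow> ('a \<Rightarrow> nat) \<Rightarrow> bool" where
  "acyclic_coloring D k \<phi> \<longleftrightarrow>
     \<phi> \<in> pverts D \<rightarrow> {1..k} \<and>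
     (\<forall>i\<in>{1..k}. acyclic_digraph (with_proj D \<restriction> {v \<in> pverts D. \<phi> v = i}))"

definition dichromatic_number :: "'a pair_pre_digraph \<Rightarrow> nat" where
  "dichromatic_number D = (LEAST k. \<exists>\<phi>. acyclic_coloring D k \<phi>)"

definition critical :: "nat \<Rightarrow> 'a pair_pre_digraph \<Rightarrow> bool" where
  "critical k D \<longleftrightarrow>
     pair_digraph D \<and> dichromatic_number D = k \<and>
     (\<forall>D'. subgraph (with_proj D') (with_proj D) \<and> D' \<noteq> D \<longrightarrow> dichromatic_number D' < k)"

definition CRI :: "nat \<Rightarrow> nat \<Rightarrow> 'a pair_pre_digraph set" where
  "CRI k n = {D. critical k D \<and> card (pverts D) = n}"

text \<open>
  Every finite digraph is isomorphic to one whose vertices are natural numbers, so the minimum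
  may be taken over these.  On \<^typ>\<open>nat\<close>, the infimum of a nonempty set is its minimum.
\<close>

definition ext :: "nat \<Rightarrow> nat \<Rightarrow> nat" where
  "ext k n = (INF D \<in> (CRI k n :: nat pair_pre_digraph set). card (parcs D))"

end

theory Submission
  imports Defs
begin

text \<open>
  Vertex sets inducing acyclic subdigraphs form a simplicial complex, and the dichromatic number is
  the least number \<open>\<rho>\<close> of faces covering the vertices.  Call two vertices adjacent if they span
  a face, i.e. are not joined by a digon.  A critical complex splits into its components for this
  adjacency, over which \<open>\<rho>\<close>, the order and the number of missing arcs are additive.

  As in Gallai's theory of factor-critical graphs, a connected critical complex on \<open>n\<close> vertices has
  \<open>n \<ge> 2\<rho> - 1\<close>, and if equality holds then deleting any vertex leaves a perfect matching of adjacent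
  pairs.  For \<open>n \<ge> 2\<rho>\<close> the minimum semidegree \<open>\<rho> - 1\<close> already bounds the number of missing arcs.
  For \<open>n = 2\<rho> - 1\<close> the bound is propagated along an ear decomposition: a face of order 3 whose
  complement is perfectly matched would give a cover by \<open>\<rho> - 1\<close> faces, and the absence of such
  faces limits the weight added by each ear.  Adding up over the components yields the lower bound;
  the minimum is attained by Gallai's graphs, with every edge replaced by a digon.
\<close>

section \<open>Covers by faces\<close>

text \<open>The obstacle is that acyclic sets are not determined by pairs: three pairwise adjacent
  vertices span either a face or a directed triangle. Covers are therefore not mere clique covers,
  and the deficiency argument of matching theory is carried out for arbitrary complexes, then reused
  for the subcomplex of faces with at most two vertices. The saving in the tight case comes from
  triples that are not faces: such a vertex and adjacent pair share weight at most 2 instead of 4,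
  so inside a factor-critical set with matched complement about one arc is missing per pair of
  vertices. Estimates vertex by vertex do not suffice for an ear consisting of a single matched
  pair, which gets an argument of its own. With p = n - \<rho> the tight case has n = 2p + 1, and
  twice the number of missing arcs is at most (n - 1)^2 + 4 = 4(p^2 + 1). The additive 4 stems from
  the 5-cycle, where degrees 2 and weights 2 give 20 = 16 + 4; it is also the graph of missing edges
  in the extremal example for p = 2. Over several components the constant is harmless, as the cross
  term of the squares exceeds it.\<close>

lemma hall:
  fixes N :: "'b \<Rightarrow> 'c set"
  assumes "finite A" and "\<And>a. a \<in> A \<Longrightarrow> finite (N a)"
    and "\<And>B. B \<subseteq> A \<Longrightarrow> card B \<le> card (\<Union>(N ` B))"
  shows "\<exists>m. inj_on m A \<and> (\<forall>a\<in>A. m a \<in> N a)"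
  using assms
proof (induction "card A" arbitrary: A N rule: less_induct)
  case less
  note fin = less.prems(1) and finN = less.prems(2) and marriage = less.prems(3)
  show ?case
  proof (cases "A = {}")
    case True
    then show ?thesis by simp
  next
    case nonempty: False
    show ?thesis
    \<comment> \<open>Halmos and Vaughan: a tight proper subset \<open>T\<close> is matched first
      and its neighbours are withdrawn from the rest; if there is none, any single choice
      \<open>b\<close> for \<open>a\<close> leaves Hall's condition intact.\<close>
    proof (cases "\<exists>T. T \<subset> A \<and> T \<noteq> {} \<and> card (\<Union>(N ` T)) = card T")
      case True
      then obtain T where T: "T \<subset> A" "T \<noteq> {}" "card (\<Union>(N ` T)) = card T" by blast
      have finT: "finite T" using T fin finite_subset by auto
      have finNT: "finite (\<Union>(N ` T))" using T finT finN by auto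
      define N' where "N' x = N x - \<Union>(N ` T)" for x
      have "\<exists>m. inj_on m T \<and> (\<forall>a\<in>T. m a \<in> N a)"
        using T fin finN marriage finT by (intro less.hyps) (auto intro: psubset_card_mono)
      then obtain m1 where m1: "inj_on m1 T" "\<forall>a\<in>T. m1 a \<in> N a" by blast
      have "card B \<le> card (\<Union>(N' ` B))" if B: "B \<subseteq> A - T" for B
      proof -
        have finB: "finite B" using B fin finite_subset by blast
        have finU: "finite (\<Union>(N' ` B))" using B finN finB by (auto simp: N'_def)
        have "card B + card T = card (B \<union> T)"
          using B finB finT by (subst card_Un_disjoint) auto
        also have "\<dots> \<le> card (\<Union>(N ` (B \<union> T)))" using B T by (intro marriage) auto
        also have "\<Union>(N ` (B \<union> T)) = \<Union>(N' ` B) \<union> \<Union>(N ` T)" by (auto simp: N'_def)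
        also have "card \<dots> = card (\<Union>(N' ` B)) + card (\<Union>(N ` T))"
          using finU finNT by (intro card_Un_disjoint) (auto simp: N'_def)
        finally show ?thesis using T(3) by simp
      qed
      moreover have "card (A - T) < card A" using T fin by (intro psubset_card_mono) auto
      ultimately have "\<exists>m. inj_on m (A - T) \<and> (\<forall>a\<in>A - T. m a \<in> N' a)"
        using fin finN by (intro less.hyps) (auto simp: N'_def)
      then obtain m2 where m2: "inj_on m2 (A - T)" "\<forall>a\<in>A - T. m2 a \<in> N' a" by blast
      define m where "m x = (if x \<in> T then m1 x else m2 x)" for x
      have cross: "m1 x \<noteq> m2 y" if "x \<in> T" "y \<in> A - T" for x y
      proof -
        have "m1 x \<in> \<Union>(N ` T)" "m2 y \<notin> \<Union>(N ` T)" using that m1(2) m2(2) by (auto simp: N'_def)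
        then show ?thesis by metis
      qed
      have "inj_on m A"
      proof (rule inj_onI)
        fix x y assume "x \<in> A" "y \<in> A" "m x = m y"
        then show "x = y"
          using cross[of x y] cross[of y x] inj_onD[OF m1(1), of x y] inj_onD[OF m2(1), of x y]
          by (cases "x \<in> T"; cases "y \<in> T") (auto simp: m_def)
      qed
      moreover have "\<forall>a\<in>A. m a \<in> N a" using m1(2) m2(2) by (auto simp: m_def N'_def)
      ultimately show ?thesis by blast
    next
      case loose: False
      obtain a where a: "a \<in> A" using nonempty by blast
      have "card {a} \<le> card (N a)" using marriage[of "{a}"] a by simp
      then obtain b where b: "b \<in> N a" by fastforce
      define N' where "N' x = N x - {b}" for x
      have "card B \<le> card (\<Union>(N' ` B))" if B: "B \<subseteq> A - {a}" for B
      proof (cases "B = {}")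
        case False
        have finB: "finite B" using B fin finite_subset by blast
        have finU: "finite (\<Union>(N ` B))" using B finN finB by auto
        have "B \<subset> A" using B a by blast
        then have "card (\<Union>(N ` B)) \<noteq> card B" using loose False by auto
        moreover have "card B \<le> card (\<Union>(N ` B))" using \<open>B \<subset> A\<close> by (intro marriage) auto
        ultimately have "card B < card (\<Union>(N ` B))" by simp
        moreover have "\<Union>(N' ` B) = \<Union>(N ` B) - {b}" by (auto simp: N'_def)
        ultimately show ?thesis using finU by (auto simp: card_Diff_singleton_if)
      qed simp
      moreover have "card (A - {a}) < card A" using a fin by (intro psubset_card_mono) auto
      ultimately have "\<exists>m. inj_on m (A - {a}) \<and> (\<forall>x\<in>A - {a}. m x \<in> N' x)"
        using fin finN by (intro less.hyps) (auto simp: N'_def)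
      then obtain m where m: "inj_on m (A - {a})" "\<forall>x\<in>A - {a}. m x \<in> N' x" by blast
      have "b \<notin> m ` (A - {a})" using m(2) by (auto simp: N'_def)
      then have "inj_on (m(a := b)) A"
        using inj_onD[OF m(1)] by (intro inj_onI) (auto simp: fun_upd_def image_iff split: if_splits)
      moreover have "\<forall>x\<in>A. (m(a := b)) x \<in> N x" using m(2) b by (auto simp: N'_def)
      ultimately show ?thesis by blast
    qed
  qed
qed

section \<open>Complexes of faces: covers, adjacency and components\<close>

locale face_complex =
  fixes face :: "'a set \<Rightarrow> bool"
  assumes face_mono: "face X \<Longrightarrow> Y \<subseteq> X \<Longrightarrow> face Y"
    and face_singleton: "face {x}"
begin

text \<open>Faces may overlap and stick out of \<open>X\<close>, which makes monotonicity and unions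
  immediate; since subsets of faces are faces, partitions would give the same minimum.\<close>

definition covered :: "nat \<Rightarrow> 'a set \<Rightarrow> bool" where
  "covered m X \<longleftrightarrow> (\<exists>\<C>. finite \<C> \<and> card \<C> \<le> m \<and> (\<forall>C\<in>\<C>. face C) \<and> X \<subseteq> \<Union>\<C>)"

definition rho :: "'a set \<Rightarrow> nat" where
  "rho X = (LEAST m. covered m X)"

definition adj :: "'a \<Rightarrow> 'a \<Rightarrow> bool" where
  "adj x y \<longleftrightarrow> x \<noteq> y \<and> face {x, y}"

definition apart :: "'a set \<Rightarrow> 'a set \<Rightarrow> bool" where
  "apart X Y \<longleftrightarrow> (\<forall>x\<in>X. \<forall>y\<in>Y. \<not> adj x y)"

definition conn :: "'a set \<Rightarrow> bool" where
  "conn X \<longleftrightarrow> (\<forall>Y\<subseteq>X. Y \<noteq> {} \<longrightarrow> Y \<noteq> X \<longrightarrow> \<not> apart Y (X - Y))"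

text \<open>Criticality under deletion of vertices; deleting arcs would change the complex
  itself.\<close>

definition crit :: "'a set \<Rightarrow> bool" where
  "crit X \<longleftrightarrow> (\<forall>x\<in>X. rho (X - {x}) < rho X)"

definition nbrs :: "'a set \<Rightarrow> 'a set \<Rightarrow> 'a set" where
  "nbrs V S = {y \<in> V - S. \<exists>x\<in>S. adj x y}"

definition separated :: "'a set set \<Rightarrow> bool" where
  "separated \<D> \<longleftrightarrow> finite \<D> \<and> (\<forall>C\<in>\<D>. \<forall>C'\<in>\<D>. C \<noteq> C' \<longrightarrow> C \<inter> C' = {} \<and> apart C C')"

lemma adj_sym: "adj x y \<longleftrightarrow> adj y x"
  by (auto simp: adj_def insert_commute)

lemma apart_sym: "apart X Y \<longleftrightarrow> apart Y X"
  unfolding apart_def using adj_sym by blast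

lemma covered_mono: "covered m X \<Longrightarrow> Y \<subseteq> X \<Longrightarrow> m \<le> l \<Longrightarrow> covered l Y"
  unfolding covered_def by (meson order_trans)

lemma covered_card: "finite X \<Longrightarrow> covered (card X) X"
  unfolding covered_def
  by (rule exI[of _ "(\<lambda>x. {x}) ` X"]) (auto simp: face_singleton card_image_le)

lemma covered_rho: "finite X \<Longrightarrow> covered (rho X) X"
  using LeastI[of "\<lambda>m. covered m X" "card X"] covered_card by (simp add: rho_def)

lemma covered_iff: "finite X \<Longrightarrow> covered m X \<longleftrightarrow> rho X \<le> m"
  using covered_rho[of X] covered_mono[of "rho X" X X m] Least_le[of "\<lambda>m. covered m X" m]
  unfolding rho_def by blast

lemma rho_mono: "finite X \<Longrightarrow> Y \<subseteq> X \<Longrightarrow> rho Y \<le> rho X"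
  using covered_mono[of "rho X" X Y "rho X"] covered_rho[of X] covered_iff[of Y] finite_subset[of Y X]
  by simp

lemma covered_Un: assumes "covered m X" "covered l Y" shows "covered (m + l) (X \<union> Y)"
proof -
  obtain \<C> \<D> where "finite \<C>" "card \<C> \<le> m" "\<forall>C\<in>\<C>. face C" "X \<subseteq> \<Union>\<C>"
    "finite \<D>" "card \<D> \<le> l" "\<forall>C\<in>\<D>. face C" "Y \<subseteq> \<Union>\<D>"
    using assms unfolding covered_def by blast
  moreover have "card (\<C> \<union> \<D>) \<le> card \<C> + card \<D>" by (rule card_Un_le)
  ultimately show ?thesis unfolding covered_def by (intro exI[of _ "\<C> \<union> \<D>"]) auto
qed

lemma rho_Un: "finite X \<Longrightarrow> finite Y \<Longrightarrow> rho (X \<union> Y) \<le> rho X + rho Y"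
  using covered_Un[of "rho X" X "rho Y" Y] by (simp add: covered_iff covered_rho)

lemma covered_face: "face X \<Longrightarrow> covered 1 X"
  unfolding covered_def by (rule exI[of _ "{X}"]) auto

lemma rho_face: "finite X \<Longrightarrow> face X \<Longrightarrow> rho X \<le> 1"
  using covered_face covered_iff by blast

lemma rho_empty [simp]: "rho {} = 0"
  using covered_card[of "{}"] by (simp add: covered_iff)

lemma rho_le_card: "finite X \<Longrightarrow> rho X \<le> card X"
  using covered_card covered_iff by blast

lemma rho_eq_0: "finite X \<Longrightarrow> rho X = 0 \<Longrightarrow> X = {}"
  using covered_rho[of X] unfolding covered_def by force

lemma rho_remove: "finite X \<Longrightarrow> rho X \<le> rho (X - {x}) + 1"
  using rho_Un[of "X - {x}" "{x}"] rho_face[of "{x}"] face_singleton[of x]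
    rho_mono[of "X - {x} \<union> {x}" X] by fastforce

text \<open>A face that meets both \<open>X\<close> and \<open>Y\<close> would contain an adjacent
  pair, so every cover splits into two disjoint parts.\<close>

lemma rho_Un_apart:
  assumes "finite X" "finite Y" "X \<inter> Y = {}" "apart X Y"
  shows "rho (X \<union> Y) = rho X + rho Y"
proof (rule antisym)
  show "rho (X \<union> Y) \<le> rho X + rho Y" using assms(1,2) by (rule rho_Un)
  obtain \<C> where \<C>: "finite \<C>" "card \<C> \<le> rho (X \<union> Y)" "\<forall>C\<in>\<C>. face C" "X \<union> Y \<subseteq> \<Union>\<C>"
    using covered_rho[of "X \<union> Y"] assms(1,2) unfolding covered_def by auto
  define \<X> where "\<X> = {C\<in>\<C>. C \<inter> X \<noteq> {}}"
  define \<Y> where "\<Y> = {C\<in>\<C>. C \<inter> Y \<noteq> {}}"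
  have "\<X> \<inter> \<Y> = {}"
  proof (rule equals0I)
    fix C assume "C \<in> \<X> \<inter> \<Y>"
    then obtain x y where xy: "C \<in> \<C>" "x \<in> C" "x \<in> X" "y \<in> C" "y \<in> Y"
      unfolding \<X>_def \<Y>_def by auto
    then have "face {x, y}" using \<C>(3) face_mono[of C "{x, y}"] by auto
    moreover have "x \<noteq> y" using xy assms(3) by auto
    ultimately have "adj x y" by (simp add: adj_def)
    with xy assms(4) show False by (simp add: apart_def)
  qed
  have "covered (card {C\<in>\<C>. C \<inter> Z \<noteq> {}}) Z" if "Z \<subseteq> \<Union>\<C>" for Z
  proof -
    have "Z \<subseteq> \<Union>{C\<in>\<C>. C \<inter> Z \<noteq> {}}" using that by fast
    then show ?thesis unfolding covered_def
      using \<C>(1,3) by (intro exI[of _ "{C\<in>\<C>. C \<inter> Z \<noteq> {}}"]) simp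
  qed
  then have "covered (card \<X>) X" "covered (card \<Y>) Y" using \<C>(4) by (simp_all add: \<X>_def \<Y>_def)
  then have "rho X + rho Y \<le> card \<X> + card \<Y>"
    using assms(1,2) by (simp add: covered_iff)
  also have "\<dots> = card (\<X> \<union> \<Y>)"
    using \<C>(1) \<open>\<X> \<inter> \<Y> = {}\<close> by (intro card_Un_disjoint[symmetric]) (auto simp: \<X>_def \<Y>_def)
  also have "\<dots> \<le> card \<C>" using \<C>(1) by (intro card_mono) (auto simp: \<X>_def \<Y>_def)
  finally show "rho X + rho Y \<le> rho (X \<union> Y)" using \<C>(2) by simp
qed

lemma separated_subset: "separated \<D> \<Longrightarrow> \<E> \<subseteq> \<D> \<Longrightarrow> separated \<E>"
  unfolding separated_def by (auto intro: finite_subset)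

lemma separated_insertD:
  assumes "separated (insert C \<D>)" "C \<notin> \<D>"
  shows "C \<inter> \<Union>\<D> = {}" "apart C (\<Union>\<D>)"
proof -
  have "C \<inter> C' = {} \<and> apart C C'" if "C' \<in> \<D>" for C'
    using assms that unfolding separated_def by (metis insertCI)
  then show "C \<inter> \<Union>\<D> = {}" "apart C (\<Union>\<D>)" by (auto simp: apart_def)
qed

lemma rho_separated:
  assumes "separated \<D>" "\<And>C. C \<in> \<D> \<Longrightarrow> finite C"
  shows "rho (\<Union>\<D>) = (\<Sum>C\<in>\<D>. rho C)"
proof -
  have "finite \<D>" using assms(1) by (simp add: separated_def)
  then show ?thesis using assms
  proof (induction \<D>)
    case (insert C \<D>)
    have "rho (C \<union> \<Union>\<D>) = rho C + rho (\<Union>\<D>)"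
      using insert separated_insertD[of C \<D>] by (intro rho_Un_apart) auto
    then show ?case using insert separated_subset[of "insert C \<D>" \<D>] by auto
  qed simp
qed

lemma card_separated:
  assumes "separated \<D>" "\<And>C. C \<in> \<D> \<Longrightarrow> finite C"
  shows "card (\<Union>\<D>) = (\<Sum>C\<in>\<D>. card C)"
  using assms unfolding separated_def
  by (intro card_Union_disjoint) (auto simp: pairwise_def disjnt_def)

lemma ex_conn_decomposition:
  "finite S \<Longrightarrow> \<exists>\<D>. \<Union>\<D> = S \<and> separated \<D> \<and> {} \<notin> \<D> \<and> (\<forall>C\<in>\<D>. conn C)"
proof (induction "card S" arbitrary: S rule: less_induct)
  case less
  consider "S = {}" | "S \<noteq> {}" "conn S" | "S \<noteq> {}" "\<not> conn S" by blast
  then show ?case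
  proof cases
    case 1
    then show ?thesis by (intro exI[of _ "{}"]) (auto simp: separated_def)
  next
    case 2
    then show ?thesis by (intro exI[of _ "{S}"]) (auto simp: separated_def)
  next
    case 3
    then obtain Y where Y: "Y \<subseteq> S" "Y \<noteq> {}" "Y \<noteq> S" "apart Y (S - Y)" by (auto simp: conn_def)
    have "card Y < card S" "card (S - Y) < card S"
      using Y less.prems by (auto intro!: psubset_card_mono)
    moreover have "finite Y" "finite (S - Y)" using Y(1) less.prems finite_subset by auto
    ultimately have "\<exists>\<D>. \<Union>\<D> = Y \<and> separated \<D> \<and> {} \<notin> \<D> \<and> (\<forall>C\<in>\<D>. conn C)"
      "\<exists>\<E>. \<Union>\<E> = S - Y \<and> separated \<E> \<and> {} \<notin> \<E> \<and> (\<forall>C\<in>\<E>. conn C)"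
      using less.hyps by blast+
    then obtain \<D> \<E> where D: "\<Union>\<D> = Y" "separated \<D>" "{} \<notin> \<D>" "\<forall>C\<in>\<D>. conn C"
      and E: "\<Union>\<E> = S - Y" "separated \<E>" "{} \<notin> \<E>" "\<forall>C\<in>\<E>. conn C"
      by (elim exE conjE)
    have cross: "C \<inter> C' = {} \<and> apart C C' \<and> apart C' C" if "C \<in> \<D>" "C' \<in> \<E>" for C C'
    proof -
      have "C \<subseteq> Y" "C' \<subseteq> S - Y" using that D E by auto
      then have "C \<inter> C' = {}" "apart C C'" using Y(4) unfolding apart_def by blast+
      then show ?thesis using apart_sym by blast
    qed
    have "separated (\<D> \<union> \<E>)" using D(2) E(2) cross unfolding separated_def
      by (metis Int_commute UnE finite_UnI)
    then show ?thesis using D E Y by (intro exI[of _ "\<D> \<union> \<E>"]) auto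
  qed
qed

lemma rho_UN_le: "finite I \<Longrightarrow> (\<And>i. i \<in> I \<Longrightarrow> finite (X i)) \<Longrightarrow> rho (\<Union>i\<in>I. X i) \<le> (\<Sum>i\<in>I. rho (X i))"
proof (induction I rule: finite_induct)
  case (insert i I)
  have "rho (X i \<union> (\<Union>i\<in>I. X i)) \<le> rho (X i) + rho (\<Union>i\<in>I. X i)"
    using insert by (intro rho_Un) auto
  also have "\<dots> \<le> rho (X i) + (\<Sum>i\<in>I. rho (X i))" using insert by simp
  finally show ?case using insert by simp
qed simp

section \<open>Connected critical complexes\<close>

text \<open>Criticality frees one face when \<open>c\<close> is deleted, and \<open>{c, a}\<close>
  uses it.\<close>

lemma rho_crit_insert:
  assumes "finite C" "crit C" "c \<in> C" "adj c a"
  shows "rho (insert a C) \<le> rho C"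
proof -
  have "insert a C = (C - {c}) \<union> {c, a}" using assms(3) by auto
  then have "rho (insert a C) \<le> rho (C - {c}) + rho {c, a}"
    using rho_Un[of "C - {c}" "{c, a}"] assms(1) by simp
  also have "rho {c, a} \<le> 1" using assms(4) rho_face[of "{c, a}"] by (simp add: adj_def)
  finally have "rho (insert a C) \<le> rho (C - {c}) + 1" by simp
  moreover have "rho (C - {c}) < rho C" using assms(2,3) by (simp add: crit_def)
  ultimately show ?thesis by simp
qed

text \<open>As \<open>m\<close> is injective, each component has to take in at most one vertex of
  \<open>A\<close>, which costs nothing by \<open>rho_crit_insert\<close>.\<close>

lemma rho_absorb:
  assumes sep: "separated \<D>" and fin: "\<And>C. C \<in> \<D> \<Longrightarrow> finite C" and crit: "\<And>C. C \<in> \<D> \<Longrightarrow> crit C"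
    and A: "finite A" "inj_on m A" "\<And>a. a \<in> A \<Longrightarrow> m a \<in> \<D> \<and> (\<exists>c\<in>m a. adj c a)"
  shows "rho (\<Union>\<D> \<union> A) \<le> rho (\<Union>\<D>)"
proof -
  define X where "X C = C \<union> {a\<in>A. m a = C}" for C
  have finX: "finite (X C)" if "C \<in> \<D>" for C using that fin A by (auto simp: X_def)
  have X: "rho (X C) \<le> rho C" if C: "C \<in> \<D>" for C
  proof (cases "\<exists>a\<in>A. m a = C")
    case True
    then obtain a where a: "a \<in> A" "m a = C" by blast
    then have "{a\<in>A. m a = C} = {a}" using A(2) by (auto simp: inj_on_def)
    then have "X C = insert a C" by (auto simp: X_def)
    moreover obtain c where "c \<in> C" "adj c a" using A(3) a by blast
    ultimately show ?thesis using rho_crit_insert C fin crit by metis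
  next
    case False
    then have "X C = C" by (auto simp: X_def)
    then show ?thesis by simp
  qed
  have finD: "finite \<D>" using sep by (simp add: separated_def)
  have "\<Union>\<D> \<union> A = (\<Union>C\<in>\<D>. X C)" using A(3) by (auto simp: X_def)
  then have "rho (\<Union>\<D> \<union> A) \<le> (\<Sum>C\<in>\<D>. rho (X C))"
    using rho_UN_le[of \<D> X] finX finD by simp
  also have "\<dots> \<le> (\<Sum>C\<in>\<D>. rho C)" using X by (intro sum_mono)
  finally show ?thesis using rho_separated[OF sep fin] by simp
qed

text \<open>
  This plays the role of the deficiency in the Tutte-Berge formula: if every component of \<open>S\<close> were
  factor-critical, \<open>gain V S\<close> would be the number of components of \<open>S\<close> minus the number of
  neighbours of \<open>S\<close>.
\<close>

definition gain :: "'a set \<Rightarrow> 'a set \<Rightarrow> int" where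
  "gain V S = 2 * int (rho S) - int (card S) - int (card (nbrs V S))"

text \<open>By \<open>small\<close> each removed component contributes at most 1 to the gain, while
  all of \<open>B\<close> ceases to be adjacent to what remains.\<close>

lemma gain_remove_components:
  assumes V: "finite V" "\<Union>\<D> \<subseteq> V" and sep: "separated \<D>"
    and small: "\<And>C. C \<in> \<D> \<Longrightarrow> 2 * rho C \<le> card C + 1"
    and B: "B \<subseteq> nbrs V (\<Union>\<D>)" and \<T>: "\<T> = {C\<in>\<D>. \<exists>a\<in>B. \<exists>c\<in>C. adj c a}"
  shows "gain V (\<Union>(\<D> - \<T>)) \<ge> gain V (\<Union>\<D>) - int (card \<T>) + int (card B)"
proof -
  have fin: "finite C" if "C \<in> \<D>" for C
    using that V by (meson Union_upper finite_subset order_trans)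
  have finD: "finite \<D>" using sep by (simp add: separated_def)
  have TD: "\<T> \<subseteq> \<D>" using \<T> by auto
  have split: "(\<Sum>C\<in>\<D>. h C) = (\<Sum>C\<in>\<D> - \<T>. h C) + (\<Sum>C\<in>\<T>. h C)" for h :: "'a set \<Rightarrow> nat"
    using sum.subset_diff[OF TD finD] by blast
  have 1: "rho (\<Union>\<D>) = rho (\<Union>(\<D> - \<T>)) + (\<Sum>C\<in>\<T>. rho C)"
    using rho_separated[OF sep fin] rho_separated[of "\<D> - \<T>"] separated_subset[OF sep, of "\<D> - \<T>"]
      split[of rho] fin by simp
  have 2: "card (\<Union>\<D>) = card (\<Union>(\<D> - \<T>)) + (\<Sum>C\<in>\<T>. card C)"
    using card_separated[OF sep fin] card_separated[of "\<D> - \<T>"] separated_subset[OF sep, of "\<D> - \<T>"]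
      split[of card] fin by simp
  have "(\<Sum>C\<in>\<T>. 2 * rho C) \<le> (\<Sum>C\<in>\<T>. card C + 1)" using small TD by (intro sum_mono) auto
  then have 3: "2 * (\<Sum>C\<in>\<T>. rho C) \<le> (\<Sum>C\<in>\<T>. card C) + card \<T>"
    by (simp only: sum_distrib_left sum.distrib) simp
  have finA: "finite (nbrs V (\<Union>\<D>))" using V(1) by (simp add: nbrs_def)
  have "nbrs V (\<Union>(\<D> - \<T>)) \<subseteq> nbrs V (\<Union>\<D>) - B"
  proof
    fix y assume y: "y \<in> nbrs V (\<Union>(\<D> - \<T>))"
    then obtain C c where C: "C \<in> \<D>" "C \<notin> \<T>" "c \<in> C" "adj c y" "y \<in> V" "y \<notin> \<Union>(\<D> - \<T>)"
      by (auto simp: nbrs_def)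
    have "y \<notin> B" using C \<T> by blast
    moreover have "y \<notin> \<Union>\<D>"
    proof
      assume "y \<in> \<Union>\<D>"
      then obtain C' where C': "C' \<in> \<D>" "y \<in> C'" by blast
      have "C' \<noteq> C" using C(1,2,6) C'(2) by blast
      then have "apart C C'" using sep C(1) C' by (simp add: separated_def)
      then show False using C(3,4) C'(2) by (simp add: apart_def)
    qed
    ultimately show "y \<in> nbrs V (\<Union>\<D>) - B" using C by (auto simp: nbrs_def)
  qed
  then have "card (nbrs V (\<Union>(\<D> - \<T>))) \<le> card (nbrs V (\<Union>\<D>) - B)"
    using finA by (intro card_mono) auto
  also have "\<dots> = card (nbrs V (\<Union>\<D>)) - card B" using B finA by (intro card_Diff_subset) (auto intro: finite_subset)
  finally have "card (nbrs V (\<Union>(\<D> - \<T>))) + card B \<le> card (nbrs V (\<Union>\<D>))"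
    using card_mono[OF finA B] by simp
  with 1 2 3 show ?thesis unfolding gain_def by linarith
qed

end

lemma ex_best:
  fixes h :: "'a set \<Rightarrow> int"
  assumes "finite F" "F \<noteq> {}"
  shows "\<exists>S\<in>F. \<forall>T\<in>F. h T < h S \<or> h T = h S \<and> card S \<le> card T"
proof -
  have "Max (h ` F) \<in> h ` F" using assms by (intro Max_in) auto
  then obtain S0 where "S0 \<in> F" "h S0 = Max (h ` F)" by auto
  then obtain S where "S \<in> F \<and> h S = Max (h ` F)"
    "\<And>T. T \<in> F \<and> h T = Max (h ` F) \<Longrightarrow> card S \<le> card T"
    using ex_has_least_nat[of "\<lambda>S. S \<in> F \<and> h S = Max (h ` F)" S0 card] by blast
  moreover have "h T \<le> Max (h ` F)" if "T \<in> F" for T using assms that by simp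
  ultimately show ?thesis by (metis order_le_less)
qed

context face_complex
begin

text \<open>Deleting a vertex that does not lower \<open>rho\<close> of its component reduces the
  order by 1 and adds at most that vertex to the neighbours, so the gain would not drop.\<close>

lemma best_component_crit:
  assumes V: "finite V" "\<Union>\<D> \<subseteq> V" and sep: "separated \<D>" and C: "C \<in> \<D>"
    and best: "\<And>x. x \<in> \<Union>\<D> \<Longrightarrow> \<Union>\<D> - {x} \<noteq> {} \<Longrightarrow> gain V (\<Union>\<D> - {x}) < gain V (\<Union>\<D>)"
  shows "crit C"
proof -
  define R where "R = \<Union>(\<D> - {C})"
  define S where "S = \<Union>\<D>"
  have S: "S = C \<union> R" using C by (auto simp: R_def S_def)
  have finS: "finite S" using V finite_subset unfolding S_def by blast
  then have fin: "finite C" "finite R" using S by auto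
  have "separated (insert C (\<D> - {C}))" using sep C by (simp add: insert_absorb)
  from separated_insertD[OF this] have CR: "C \<inter> R = {}" "apart C R" by (auto simp: R_def)
  have "rho (C - {x}) < rho C" if x: "x \<in> C" for x
  proof (rule ccontr)
    assume "\<not> rho (C - {x}) < rho C"
    then have eq: "rho (C - {x}) = rho C" using rho_mono[of C "C - {x}"] fin by simp
    have xS: "x \<in> S" using x S by simp
    have "S - {x} \<noteq> {}"
    proof
      assume "S - {x} = {}"
      then have "C = {x}" using x S by auto
      then have "rho C = 0" using eq by simp
      then show False using rho_eq_0 fin x by auto
    qed
    then have less: "gain V (S - {x}) < gain V S" using best xS by (simp add: S_def)
    have "S - {x} = (C - {x}) \<union> R" using S CR x by auto
    moreover have "apart (C - {x}) R" using CR(2) by (simp add: apart_def)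
    ultimately have "rho (S - {x}) = rho S"
      using rho_Un_apart[of "C - {x}" R] rho_Un_apart[of C R] CR fin eq S by auto
    moreover have "card (S - {x}) + 1 = card S" using xS finS by (metis Suc_eq_plus1 card_Suc_Diff1)
    moreover have "card (nbrs V (S - {x})) \<le> card (nbrs V S) + 1"
    proof -
      have "nbrs V (S - {x}) \<subseteq> insert x (nbrs V S)" by (auto simp: nbrs_def)
      moreover have "finite (nbrs V S)" using V(1) by (simp add: nbrs_def)
      ultimately have "card (nbrs V (S - {x})) \<le> card (insert x (nbrs V S))" by (intro card_mono) auto
      also have "\<dots> \<le> card (nbrs V S) + 1" by (simp add: card_insert_le_m1 card_insert_if)
      finally show ?thesis .
    qed
    ultimately show False using less unfolding gain_def by linarith
  qed
  then show ?thesis by (simp add: crit_def)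
qed

lemma hall_components:
  assumes "finite \<D>" "finite A"
    and "\<And>B. B \<subseteq> A \<Longrightarrow> card B \<le> card {C\<in>\<D>. \<exists>a\<in>B. \<exists>c\<in>C. adj c a}"
  obtains m where "inj_on m A" "\<And>a. a \<in> A \<Longrightarrow> m a \<in> \<D> \<and> (\<exists>c\<in>m a. adj c a)"
proof -
  define N where "N a = {C\<in>\<D>. \<exists>c\<in>C. adj c a}" for a
  have "(\<Union>(N ` B)) = {C\<in>\<D>. \<exists>a\<in>B. \<exists>c\<in>C. adj c a}" for B by (auto simp: N_def)
  then have "\<exists>m. inj_on m A \<and> (\<forall>a\<in>A. m a \<in> N a)"
    using assms by (intro hall) (auto simp: N_def)
  then show ?thesis using that by (auto simp: N_def)
qed

lemma apart_outside_nbrs: "apart S (V - S - nbrs V S)"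
  by (auto simp: apart_def nbrs_def)

lemma nbrs_nonempty:
  assumes "conn V" "S \<subseteq> V" "S \<noteq> {}" "S \<noteq> V"
  shows "nbrs V S \<noteq> {}"
  using assms unfolding conn_def apart_def nbrs_def by blast

lemma rho_crit_subset:
  assumes "crit V" "finite V" "A \<subseteq> V" "A \<noteq> {}"
  shows "rho (V - A) < rho V"
proof -
  obtain a where "a \<in> A" using assms by blast
  then have "rho (V - A) \<le> rho (V - {a})" using assms by (intro rho_mono) auto
  also have "\<dots> < rho V" using assms \<open>a \<in> A\<close> by (auto simp: crit_def)
  finally show ?thesis .
qed

text \<open>
  If \<open>S \<union> nbrs V S\<close> could be covered by \<open>rho S\<close> faces, then deleting the neighbours of \<open>S\<close>, which
  separates \<open>S\<close> from the rest, would not decrease \<open>rho V\<close>.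
\<close>

lemma not_absorbed:
  assumes V: "finite V" "conn V" "crit V" and S: "S \<subseteq> V" "S \<noteq> {}" "S \<noteq> V"
  shows "rho S < rho (S \<union> nbrs V S)"
proof -
  define A where "A = nbrs V S"
  define R where "R = V - S - A"
  have A: "A \<noteq> {}" "A \<subseteq> V" "A \<inter> S = {}"
    using nbrs_nonempty[OF V(2) S] by (auto simp: A_def nbrs_def)
  have fin: "finite S" "finite A" "finite R"
    using finite_subset[OF S(1) V(1)] finite_subset[OF A(2) V(1)] V(1) by (auto simp: R_def)
  have "rho (V - A) = rho S + rho R"
  proof -
    have "V - A = S \<union> R" using S A by (auto simp: R_def)
    moreover have "rho (S \<union> R) = rho S + rho R"
      using fin apart_outside_nbrs[of S V] by (intro rho_Un_apart) (auto simp: R_def A_def)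
    ultimately show ?thesis by simp
  qed
  moreover have "rho V \<le> rho (S \<union> A) + rho R"
  proof -
    have "V = (S \<union> A) \<union> R" using S A by (auto simp: R_def)
    then show ?thesis using rho_Un[of "S \<union> A" R] fin by simp
  qed
  moreover have "rho (V - A) < rho V" using V A by (intro rho_crit_subset)
  ultimately show ?thesis by (simp add: A_def)
qed

theorem crit_conn_bound:
  assumes "finite V" "conn V" "crit V"
  shows "2 * rho V \<le> card V + 1"
  using assms
proof (induction "card V" arbitrary: V rule: less_induct)
  case less
  note V = less.prems
  show ?case
  proof (rule ccontr)
    assume neg: "\<not> 2 * rho V \<le> card V + 1"
    have "rho V \<le> card V" using V by (simp add: rho_le_card)
    with neg have card2: "2 \<le> card V" by simp
    then obtain v where v: "v \<in> V" by fastforce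
    \<comment> \<open>A smallest \<open>S\<close> of maximal gain has critical components, into which its neighbours can be
      matched, since a violator of Hall's condition could be split off with profit.\<close>
    define F where "F = {S. S \<subseteq> V \<and> S \<noteq> {} \<and> S \<noteq> V}"
    have "finite F" using V(1) unfolding F_def by (auto intro: finite_subset[of _ "Pow V"])
    have vF: "V - {v} \<in> F"
    proof -
      have "V \<noteq> {v}" using card2 by auto
      then have "V - {v} \<noteq> {}" using v by auto
      then show ?thesis using v by (auto simp: F_def)
    qed
    then obtain S where S: "S \<in> F"
      and best: "\<And>T. T \<in> F \<Longrightarrow> gain V T < gain V S \<or> gain V T = gain V S \<and> card S \<le> card T"
      using ex_best[of F "gain V"] \<open>finite F\<close> by auto
    have S': "S \<subseteq> V" "S \<noteq> {}" "S \<noteq> V" using S by (auto simp: F_def)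
    \<comment> \<open>Deleting \<open>v\<close> lowers \<open>rho\<close> by at most 1 and the order
      by 1, and only \<open>v\<close> can be a neighbour: the gain is at least
      \<open>2 * rho V - card V - 2\<close>.\<close>
    have "gain V (V - {v}) \<ge> 0"
    proof -
      have "nbrs V (V - {v}) \<subseteq> {v}" by (auto simp: nbrs_def)
      then have "card (nbrs V (V - {v})) \<le> card {v}" by (intro card_mono) auto
      moreover have "rho V \<le> rho (V - {v}) + 1" using V by (intro rho_remove)
      moreover have "card (V - {v}) + 1 = card V" using v V by (metis Suc_eq_plus1 card_Suc_Diff1)
      ultimately show ?thesis using neg unfolding gain_def by simp
    qed
    with best[OF vF] have gain0: "gain V S \<ge> 0" by linarith
    have finS: "finite S" using S' V finite_subset by auto
    then obtain \<D> where D: "\<Union>\<D> = S" "separated \<D>" "{} \<notin> \<D>" "\<forall>C\<in>\<D>. conn C"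
      using ex_conn_decomposition by blast
    have finC: "finite C" if "C \<in> \<D>" for C using that D(1) finS by (meson Union_upper finite_subset)
    have critC: "crit C" if "C \<in> \<D>" for C
    proof (rule best_component_crit[of V \<D>])
      fix x assume x: "x \<in> \<Union>\<D>" "\<Union>\<D> - {x} \<noteq> {}"
      then have "S - {x} \<in> F" using S' D(1) by (auto simp: F_def)
      moreover have "card (S - {x}) < card S" using x(1) D(1) finS by (metis card_Diff1_less)
      ultimately show "gain V (\<Union>\<D> - {x}) < gain V (\<Union>\<D>)" using best[of "S - {x}"] D(1) by auto
    qed (use that D S' V in auto)
    have small: "2 * rho C \<le> card C + 1" if "C \<in> \<D>" for C
    proof (rule less.hyps)
      have "C \<subset> V" using that D(1) S' by blast
      then show "card C < card V" using V(1) by (intro psubset_card_mono)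
    qed (use that D finC critC in auto)
    define A where "A = nbrs V S"
    have finA: "finite A" using V(1) by (simp add: A_def nbrs_def)
    have finD: "finite \<D>" using D(2) by (simp add: separated_def)
    have "card B \<le> card {C\<in>\<D>. \<exists>a\<in>B. \<exists>c\<in>C. adj c a}" if B: "B \<subseteq> A" for B
    proof (rule ccontr)
      define \<T> where "\<T> = {C\<in>\<D>. \<exists>a\<in>B. \<exists>c\<in>C. adj c a}"
      assume "\<not> card B \<le> card {C\<in>\<D>. \<exists>a\<in>B. \<exists>c\<in>C. adj c a}"
      then have BT: "card \<T> < card B" by (simp add: \<T>_def)
      have "gain V (\<Union>(\<D> - \<T>)) \<ge> gain V (\<Union>\<D>) - int (card \<T>) + int (card B)"
        using V S' D B small by (intro gain_remove_components) (auto simp: \<T>_def A_def)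
      then have more: "gain V (\<Union>(\<D> - \<T>)) > gain V S" using BT D(1) by simp
      have sub: "\<Union>(\<D> - \<T>) \<subseteq> S" using D(1) by auto
      show False
      \<comment> \<open>The empty set does not belong to \<open>F\<close>; it is excluded because
        its gain is 0 and \<open>gain0\<close> holds.\<close>
      proof (cases "\<Union>(\<D> - \<T>) = {}")
        case True
        moreover have "gain V {} = 0" by (simp add: gain_def nbrs_def)
        ultimately have "gain V (\<Union>(\<D> - \<T>)) = 0" by metis
        then show False using more gain0 by simp
      next
        case False
        then have "\<Union>(\<D> - \<T>) \<in> F" using sub S' by (auto simp: F_def)
        then show False using best more by fastforce
      qed
    qed
    then obtain m where "inj_on m A" "\<And>a. a \<in> A \<Longrightarrow> m a \<in> \<D> \<and> (\<exists>c\<in>m a. adj c a)"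
      using hall_components[OF finD finA] by blast
    then have "rho (\<Union>\<D> \<union> A) \<le> rho (\<Union>\<D>)"
      using D finC critC finA by (intro rho_absorb) auto
    then show False using not_absorbed[OF V S'] D(1) by (simp add: A_def)
  qed
qed

section \<open>Faces with at most two vertices and perfect matchings\<close>

definition face2 :: "'a set \<Rightarrow> bool" where
  "face2 X \<longleftrightarrow> finite X \<and> card X \<le> 2 \<and> face X"

definition matched :: "'a set \<Rightarrow> bool" where
  "matched X \<longleftrightarrow> (\<exists>m. \<forall>x\<in>X. m x \<in> X \<and> m (m x) = x \<and> adj x (m x))"

lemma face_complex_face2: "face_complex face2"
proof
  show "face2 Y" if "face2 X" "Y \<subseteq> X" for X Y
    using that card_mono[of X Y] finite_subset[of Y X] face_mono[of X Y] unfolding face2_def by linarith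
  show "face2 {x}" for x by (simp add: face2_def face_singleton)
qed

lemma adj_face2: "face_complex.adj face2 = adj"
  by (auto simp: fun_eq_iff face_complex.adj_def[OF face_complex_face2] adj_def face2_def
      intro: order_trans[OF card_insert_le_m1])

lemma apart_face2: "face_complex.apart face2 = apart"
  by (simp add: fun_eq_iff face_complex.apart_def[OF face_complex_face2] apart_def adj_face2)

lemma conn_face2: "face_complex.conn face2 = conn"
  by (simp add: fun_eq_iff face_complex.conn_def[OF face_complex_face2] conn_def apart_face2)

lemma nbrs_face2: "face_complex.nbrs face2 = nbrs"
  by (simp add: fun_eq_iff face_complex.nbrs_def[OF face_complex_face2] nbrs_def adj_face2)

lemma separated_face2: "face_complex.separated face2 = separated"
  by (simp add: fun_eq_iff face_complex.separated_def[OF face_complex_face2] separated_def apart_face2)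

lemma covered_face2: "face_complex.covered face2 m X \<Longrightarrow> covered m X"
  unfolding face_complex.covered_def[OF face_complex_face2] covered_def face2_def by blast

lemma rho_le_rho_face2:
  assumes "finite X" shows "rho X \<le> face_complex.rho face2 X"
proof -
  interpret P: face_complex face2 by (rule face_complex_face2)
  show ?thesis using P.covered_rho[OF assms] covered_face2 covered_iff[OF assms] by blast
qed

text \<open>Counting: \<open>l\<close> faces of order at most 2 cover \<open>2 * l\<close> vertices
  only if all of them are full and disjoint.\<close>

lemma matched_if_covered:
  assumes cov: "face_complex.covered face2 l X" and X: "finite X" "card X = 2 * l"
  shows "matched X"
proof -
  interpret P: face_complex face2 by (rule face_complex_face2)
  obtain \<C>0 where C0: "finite \<C>0" "card \<C>0 \<le> l" "\<forall>C\<in>\<C>0. face2 C" "X \<subseteq> \<Union>\<C>0"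
    using cov unfolding P.covered_def by blast
  define \<C> where "\<C> = (\<lambda>C. C \<inter> X) ` \<C>0"
  have finC: "finite \<C>" "card \<C> \<le> l"
    using C0 card_image_le[of \<C>0 "\<lambda>C. C \<inter> X"] by (auto simp: \<C>_def)
  have f2: "face2 C" if "C \<in> \<C>" for C
    using that C0(3) P.face_mono by (auto simp: \<C>_def)
  have UC: "\<Union>\<C> = X" using C0(4) by (auto simp: \<C>_def)
  \<comment> \<open>The other faces cover at most \<open>2 * (l - 1)\<close> vertices, so two are
    left to \<open>C\<close> alone.\<close>
  have priv: "card (C - \<Union>(\<C> - {C})) \<ge> 2" if C: "C \<in> \<C>" for C
  proof -
    have "l \<ge> 1" using finC C by (metis card_gt_0_iff empty_iff le_trans less_one not_le)
    have "X = \<Union>(\<C> - {C}) \<union> (C - \<Union>(\<C> - {C}))" using UC C by blast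
    then have "card X \<le> card (\<Union>(\<C> - {C})) + card (C - \<Union>(\<C> - {C}))" by (metis card_Un_le)
    also have "card (\<Union>(\<C> - {C})) \<le> sum card (\<C> - {C})" using finC by (intro card_Union_le_sum_card)
    also have "\<dots> \<le> of_nat (card (\<C> - {C})) * 2" using f2 by (intro sum_bounded_above) (auto simp: face2_def)
    also have "\<dots> \<le> 2 * (l - 1)" using finC C by simp
    finally show ?thesis using X(2) \<open>l \<ge> 1\<close> by linarith
  qed
  have pair: "card C = 2" "C \<inter> \<Union>(\<C> - {C}) = {}" if C: "C \<in> \<C>" for C
  proof -
    have fC: "finite C" "card C \<le> 2" using f2[OF C] by (auto simp: face2_def)
    have le: "card (C - \<Union>(\<C> - {C})) \<le> card C" using fC by (intro card_mono) auto
    then show "card C = 2" using priv[OF C] fC by simp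
    then have "card C \<le> card (C - \<Union>(\<C> - {C}))" using priv[OF C] by simp
    then have "C - \<Union>(\<C> - {C}) = C" using fC by (intro card_seteq) auto
    then show "C \<inter> \<Union>(\<C> - {C}) = {}" by blast
  qed
  have ex1: "\<exists>!y. y \<noteq> x \<and> {x, y} \<in> \<C>" if x: "x \<in> X" for x
  proof -
    obtain C where C: "C \<in> \<C>" "x \<in> C" using x UC by blast
    from pair(1)[OF C(1)] C(2) obtain y where y: "C = {x, y}" "y \<noteq> x"
      by (metis card_2_iff doubleton_eq_iff insertE singletonD)
    show ?thesis
    proof (rule ex1I[of _ y])
      show "y \<noteq> x \<and> {x, y} \<in> \<C>" using C y by simp
    next
      fix z assume z: "z \<noteq> x \<and> {x, z} \<in> \<C>"
      then have "{x, z} = C" using pair(2)[OF C(1)] C(2) by blast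
      then show "z = y" using y z by (simp add: doubleton_eq_iff)
    qed
  qed
  define m where "m x = (THE y. y \<noteq> x \<and> {x, y} \<in> \<C>)" for x
  have m: "m x \<noteq> x" "{x, m x} \<in> \<C>" if "x \<in> X" for x
    using theI'[OF ex1[OF that]] by (simp_all add: m_def)
  have "m x \<in> X \<and> m (m x) = x \<and> adj x (m x)" if x: "x \<in> X" for x
  proof (intro conjI)
    show mX: "m x \<in> X" using m(2)[OF x] UC by blast
    have "m x \<noteq> x" "{m x, x} \<in> \<C>" using m[OF x] by (auto simp: insert_commute)
    then show "m (m x) = x" using ex1[OF mX] m[OF mX] by metis
    show "adj x (m x)" using m[OF x] f2 by (auto simp: adj_def face2_def)
  qed
  then show ?thesis unfolding matched_def by blast
qed

lemma covered_remove_one: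
  assumes cov: "covered (Suc b) X" and X: "finite X" "card X < 2 * Suc b"
  shows "\<exists>y. covered b (X - {y})"
proof -
  obtain \<C> where C: "finite \<C>" "card \<C> \<le> Suc b" "\<forall>C\<in>\<C>. face C" "X \<subseteq> \<Union>\<C>"
    using cov unfolding covered_def by blast
  show ?thesis
  proof (cases "card \<C> \<le> b")
    case True
    \<comment> \<open>Here no vertex need be removed, so \<open>undefined\<close> serves as
      \<open>y\<close>.\<close>
    then have "covered b X" using C unfolding covered_def by blast
    then show ?thesis using covered_mono[of b X "X - {undefined}" b] by blast
  next
    case False
    then have cardC: "card \<C> = Suc b" using C by simp
    have "\<forall>x\<in>X. \<exists>C\<in>\<C>. x \<in> C" using C(4) by auto
    then obtain \<phi> where \<phi>: "\<forall>x\<in>X. \<phi> x \<in> \<C> \<and> x \<in> \<phi> x" by metis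
    have "\<exists>C\<in>\<C>. card {x\<in>X. \<phi> x = C} \<le> 1"
    proof (rule ccontr)
      assume "\<not> ?thesis"
      then have ge: "\<And>C. C \<in> \<C> \<Longrightarrow> 2 \<le> card {x\<in>X. \<phi> x = C}" by force
      have "of_nat (card \<C>) * 2 \<le> (\<Sum>C\<in>\<C>. card {x\<in>X. \<phi> x = C})" using ge by (intro sum_bounded_below)
      also have "\<dots> = (\<Sum>C\<in>\<C>. \<Sum>x\<in>{x\<in>X. \<phi> x = C}. 1)" by simp
      also have "\<dots> = (\<Sum>x\<in>X. 1)" using \<phi> C X by (intro sum.group) auto
      finally show False using X(2) cardC by simp
    qed
    then obtain C where D: "C \<in> \<C>" "card {x\<in>X. \<phi> x = C} \<le> 1" by blast
    have "finite {x\<in>X. \<phi> x = C}" using X by simp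
    then have "\<forall>x\<in>{x\<in>X. \<phi> x = C}. \<forall>y\<in>{x\<in>X. \<phi> x = C}. x = y"
      using D(2) card_le_Suc0_iff_eq[of "{x\<in>X. \<phi> x = C}"] by simp
    then obtain y where y: "{x\<in>X. \<phi> x = C} \<subseteq> {y}" by blast
    have "X - {y} \<subseteq> \<Union>(\<C> - {C})"
    proof
      fix x assume x: "x \<in> X - {y}"
      then have "\<phi> x \<noteq> C" using y by blast
      then show "x \<in> \<Union>(\<C> - {C})" using \<phi> x by blast
    qed
    moreover have "card (\<C> - {C}) \<le> b" using D C cardC by simp
    moreover have "\<forall>C\<in>\<C> - {C}. face C" using C(3) by simp
    ultimately have "covered b (X - {y})" unfolding covered_def using C(1)
      by (intro exI[of _ "\<C> - {C}"]) simp
    then show ?thesis by blast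
  qed
qed

theorem crit_conn_factor_critical:
  assumes V: "finite V" "conn V" "crit V" and card: "card V + 1 = 2 * rho V" and z: "z \<in> V"
  shows "matched (V - {z})"
proof -
  interpret P: face_complex face2 by (rule face_complex_face2)
  note [simp] = adj_face2 apart_face2 conn_face2 nbrs_face2 separated_face2
  define k where "k = rho V"
  \<comment> \<open>Take an optimal cover whose part by pairs and singletons, on \<open>U\<close>, is as large as possible.  A
    vertex of \<open>U\<close> that can be made a singleton has no neighbour outside \<open>U\<close>, as otherwise that
    neighbour could be moved into \<open>U\<close>.\<close>
  define config where "config U \<longleftrightarrow> U \<subseteq> V \<and> (\<exists>b. covered b (V - U) \<and> b + P.rho U \<le> k)" for U
  have "config {}" unfolding config_def k_def using covered_rho[OF V(1)] by auto
  moreover have "\<forall>U. config U \<longrightarrow> card U < card V + 1"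
    unfolding config_def using V(1) by (auto simp: less_Suc_eq_le intro: card_mono)
  ultimately obtain U where U: "config U" and maxU: "\<And>U'. config U' \<Longrightarrow> card U' \<le> card U"
    using ex_has_greatest_nat[of config "{}" card "card V + 1"] by blast
  have UV: "U \<subseteq> V" using U by (simp add: config_def)
  have finU: "finite U" using UV V(1) finite_subset by auto
  have finVU: "finite (V - U)" using V(1) by simp
  obtain b where b: "covered b (V - U)" "b + P.rho U \<le> k" using U by (auto simp: config_def)
  have k_le: "k \<le> c + P.rho U" if "covered c (V - U)" for c
  proof -
    have "rho ((V - U) \<union> U) \<le> rho (V - U) + rho U" using finU finVU by (intro rho_Un)
    moreover have "(V - U) \<union> U = V" using UV by auto
    ultimately show ?thesis
      using rho_le_rho_face2[OF finU] covered_iff[OF finVU] that by (simp add: k_def)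
  qed
  have kb: "k = b + P.rho U" using k_le b by force
  have no_larger: False if "w \<in> V - U" "covered c (V - insert w U)" "c + P.rho (insert w U) \<le> k" for w c
  proof -
    have "config (insert w U)" using that UV by (auto simp: config_def)
    then have "card (insert w U) \<le> card U" by (rule maxU)
    then show False using that finU by simp
  qed
  \<comment> \<open>Otherwise the order of \<open>V\<close> leaves fewer than \<open>2 * b\<close>
    vertices to the \<open>b\<close> large faces; one of these could be dropped and its single
    vertex moved to \<open>U\<close> as a singleton.\<close>
  have f2U: "card U + 1 \<le> 2 * P.rho U"
  proof (rule ccontr)
    assume neg: "\<not> ?thesis"
    have "card (V - U) + card U = card V" using UV V(1) by (metis card_Diff_subset card_mono finU le_add_diff_inverse2)
    then have "card (V - U) < 2 * b" using neg card kb k_def by linarith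
    then obtain c where c: "b = Suc c" by (cases b) auto
    with \<open>card (V - U) < 2 * b\<close> obtain y where y: "covered c (V - U - {y})"
      using covered_remove_one[of c "V - U"] b(1) finVU by auto
    show False
    proof (cases "y \<in> V - U")
      case True
      have "V - insert y U = V - U - {y}" by auto
      moreover have "P.rho (insert y U) \<le> P.rho (insert y U - {y}) + 1" using finU by (intro P.rho_remove) simp
      moreover have "insert y U - {y} = U" using True by auto
      ultimately show False using no_larger[of y c] True y kb c by simp
    next
      case False
      then have "V - U - {y} = V - U" by auto
      then show False using k_le[of c] y kb c by simp
    qed
  qed
  have "\<exists>S\<in>Pow U. \<forall>T\<in>Pow U. P.gain U T < P.gain U S \<or> P.gain U T = P.gain U S \<and> card S \<le> card T"
    using finU by (intro ex_best) auto
  then obtain S where S: "S \<subseteq> U"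
    and best: "\<And>T. T \<subseteq> U \<Longrightarrow> P.gain U T < P.gain U S \<or> P.gain U T = P.gain U S \<and> card S \<le> card T"
    by (metis PowD PowI)
  have "P.gain U U = 2 * int (P.rho U) - int (card U)" by (simp add: P.gain_def nbrs_def)
  then have gain1: "P.gain U S \<ge> 1" using best[of U] f2U by auto
  \<comment> \<open>The set \<open>U\<close> itself competes for the maximum and has positive gain
    by \<open>f2U\<close>.\<close>
  have Sne: "S \<noteq> {}"
  proof
    assume "S = {}"
    then have "P.gain U S = 0" by (simp add: P.gain_def nbrs_def)
    then show False using gain1 by simp
  qed
  have finS: "finite S" using S finU finite_subset by auto
  then obtain \<D> where D: "\<Union>\<D> = S" "separated \<D>" "{} \<notin> \<D>" "\<forall>C\<in>\<D>. conn C"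
    using ex_conn_decomposition by blast
  have finD: "finite \<D>" using D(2) by (simp add: separated_def)
  have finC: "finite C" if "C \<in> \<D>" for C using that D(1) finS by (meson Union_upper finite_subset)
  have critC: "P.crit C" if "C \<in> \<D>" for C
  proof (rule P.best_component_crit[of U \<D>])
    fix x assume x: "x \<in> \<Union>\<D>" "\<Union>\<D> - {x} \<noteq> {}"
    moreover have "card (S - {x}) < card S" using x(1) D(1) finS by (metis card_Diff1_less)
    ultimately show "P.gain U (\<Union>\<D> - {x}) < P.gain U (\<Union>\<D>)"
      using best[of "S - {x}"] D(1) S by auto
  qed (use that D S finU in auto)
  have small: "2 * P.rho C \<le> card C + 1" if "C \<in> \<D>" for C
    using that finC critC D by (intro P.crit_conn_bound) auto
  define A where "A = nbrs U S"
  define R where "R = U - S - A"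
  have finA: "finite A" using finU by (simp add: A_def nbrs_def)
  have finR: "finite R" using finU by (simp add: R_def)
  \<comment> \<open>Hall's condition holds with surplus: under equality, splitting off the
    components touched by \<open>B\<close> would keep the gain and shrink \<open>S\<close>.\<close>
  have surplus: "card B < card {C\<in>\<D>. \<exists>a\<in>B. \<exists>c\<in>C. adj c a}" if B: "B \<subseteq> A" "B \<noteq> {}" for B
  proof (rule ccontr)
    define \<T> where "\<T> = {C\<in>\<D>. \<exists>a\<in>B. \<exists>c\<in>C. adj c a}"
    assume "\<not> ?thesis"
    then have BT: "card \<T> \<le> card B" by (simp add: \<T>_def)
    have "P.gain U (\<Union>(\<D> - \<T>)) \<ge> P.gain U (\<Union>\<D>) - int (card \<T>) + int (card B)"
      using finU S D B(1) small by (intro P.gain_remove_components) (auto simp: \<T>_def A_def)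
    then have "P.gain U (\<Union>(\<D> - \<T>)) \<ge> P.gain U S" using BT D(1) by simp
    moreover have sub: "\<Union>(\<D> - \<T>) \<subseteq> S" using D(1) by auto
    ultimately have "card S \<le> card (\<Union>(\<D> - \<T>))" using best[of "\<Union>(\<D> - \<T>)"] S by auto
    then have eq: "\<Union>(\<D> - \<T>) = S" using sub finS by (intro card_seteq)
    obtain a where a: "a \<in> B" using B by blast
    then obtain c where c: "c \<in> S" "adj c a" using B by (auto simp: A_def nbrs_def)
    then obtain C C' where C: "C \<in> \<D>" "c \<in> C" "C' \<in> \<D> - \<T>" "c \<in> C'" using D(1) eq by blast
    have "C \<in> \<T>" using C a c by (auto simp: \<T>_def)
    then have "C \<noteq> C'" using C by auto
    then have "C \<inter> C' = {}" using D(2) C by (simp add: separated_def)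
    then show False using C by blast
  qed
  \<comment> \<open>Thanks to the surplus, the components other than a given \<open>C\<close>
    already absorb all of \<open>A\<close>.\<close>
  have split: "P.rho S = P.rho C + P.rho (\<Union>(\<D> - {C}))"
    and absorb: "P.rho (\<Union>(\<D> - {C}) \<union> A) \<le> P.rho (\<Union>(\<D> - {C}))" if C: "C \<in> \<D>" for C
  proof -
    have "S = C \<union> \<Union>(\<D> - {C})" using C D(1) by auto
    moreover have ins: "separated (insert C (\<D> - {C}))" using C D(2) by (simp add: insert_absorb)
    moreover have "finite (\<Union>(\<D> - {C}))" using finD finC by auto
    ultimately show "P.rho S = P.rho C + P.rho (\<Union>(\<D> - {C}))"
      using separated_insertD[OF ins] finC[OF C] P.rho_Un_apart[of C "\<Union>(\<D> - {C})"] by simp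
    have hall: "card B \<le> card {C'\<in>\<D> - {C}. \<exists>a\<in>B. \<exists>c\<in>C'. adj c a}" if B: "B \<subseteq> A" for B
    proof (cases "B = {}")
      case False
      have eq: "{C'\<in>\<D> - {C}. \<exists>a\<in>B. \<exists>c\<in>C'. adj c a} = {C'\<in>\<D>. \<exists>a\<in>B. \<exists>c\<in>C'. adj c a} - {C}" by auto
      have "card {C'\<in>\<D>. \<exists>a\<in>B. \<exists>c\<in>C'. adj c a} - 1 \<le> card ({C'\<in>\<D>. \<exists>a\<in>B. \<exists>c\<in>C'. adj c a} - {C})"
        using diff_card_le_card_Diff[of "{C}"] by simp
      then show ?thesis unfolding eq using surplus[OF B False] by linarith
    qed simp
    obtain m where m: "inj_on m A" "\<And>a. a \<in> A \<Longrightarrow> m a \<in> \<D> - {C} \<and> (\<exists>c\<in>m a. adj c a)"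
      by (rule hall_components[of "\<D> - {C}" A]) (use finD finA hall in simp_all)
    have "separated (\<D> - {C})" by (rule separated_subset[OF D(2)]) auto
    then show "P.rho (\<Union>(\<D> - {C}) \<union> A) \<le> P.rho (\<Union>(\<D> - {C}))"
      using finC critC finA m by (intro P.rho_absorb[of _ _ m]) (simp_all add: adj_face2)
  qed
  have rest: "P.rho S + P.rho R \<le> P.rho U"
  proof -
    have "P.rho (S \<union> R) = P.rho S + P.rho R"
      using finS finR apart_outside_nbrs[of S U] by (intro P.rho_Un_apart) (auto simp: R_def A_def)
    moreover have "S \<union> R \<subseteq> U" using S by (auto simp: R_def)
    ultimately show ?thesis using P.rho_mono[OF finU, of "S \<union> R"] by simp
  qed
  have missable: "P.rho (U - {c}) < P.rho U" if c: "c \<in> S" for c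
  proof -
    obtain C where C: "C \<in> \<D>" "c \<in> C" using c D(1) by blast
    have fin3: "finite (C - {c})" "finite (\<Union>(\<D> - {C}) \<union> A)" using finC C finD finA by auto
    have "U - {c} \<subseteq> (C - {c}) \<union> (\<Union>(\<D> - {C}) \<union> A) \<union> R"
      using D(1) by (auto simp: R_def)
    then have "P.rho (U - {c}) \<le> P.rho ((C - {c}) \<union> (\<Union>(\<D> - {C}) \<union> A) \<union> R)"
      using fin3 finR by (intro P.rho_mono) auto
    also have "\<dots> \<le> P.rho ((C - {c}) \<union> (\<Union>(\<D> - {C}) \<union> A)) + P.rho R"
      using fin3 finR by (intro P.rho_Un) auto
    also have "P.rho ((C - {c}) \<union> (\<Union>(\<D> - {C}) \<union> A)) \<le> P.rho (C - {c}) + P.rho (\<Union>(\<D> - {C}) \<union> A)"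
      using fin3 by (intro P.rho_Un) auto
    also have "P.rho (C - {c}) < P.rho C" using critC C by (simp add: P.crit_def)
    finally show ?thesis using absorb[OF C(1)] split[OF C(1)] rest by linarith
  qed
  have nbrsS: "nbrs V S = A"
  proof -
    have "w \<in> U" if w: "w \<in> V" "c \<in> S" "adj c w" for w c
    proof (rule ccontr)
      assume "w \<notin> U"
      have "insert w U = (U - {c}) \<union> {c, w}" using w S by auto
      then have "P.rho (insert w U) \<le> P.rho (U - {c}) + P.rho {c, w}"
        using P.rho_Un[of "U - {c}" "{c, w}"] finU by simp
      moreover have "P.rho {c, w} \<le> 1"
        using w(3) adj_face2 P.rho_face[of "{c, w}"] P.adj_def[of c w] by simp
      ultimately have "P.rho (insert w U) \<le> P.rho U" using missable[OF w(2)] by linarith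
      moreover have "covered b (V - insert w U)" by (rule covered_mono[OF b(1)]) auto
      ultimately show False using no_larger[of w b] w \<open>w \<notin> U\<close> kb by simp
    qed
    then show ?thesis using UV by (auto simp: A_def nbrs_def)
  qed
  \<comment> \<open>Larger faces do not help on \<open>C\<close>: a cover of it by fewer faces,
    completed by the \<open>b\<close> faces and by pairs and singletons elsewhere, would beat
    \<open>k\<close>.\<close>
  have big: "P.rho C \<le> rho C" if C: "C \<in> \<D>" for C
  proof -
    have fin3: "finite C" "finite (\<Union>(\<D> - {C}) \<union> A)" using finC C finD finA by auto
    have "V \<subseteq> (V - U) \<union> C \<union> (\<Union>(\<D> - {C}) \<union> A) \<union> R" using D(1) by (auto simp: R_def)
    then have "rho V \<le> rho ((V - U) \<union> C \<union> (\<Union>(\<D> - {C}) \<union> A) \<union> R)"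
      using fin3 finR finVU by (intro rho_mono) auto
    also have "\<dots> \<le> rho ((V - U) \<union> C \<union> (\<Union>(\<D> - {C}) \<union> A)) + rho R"
      using fin3 finR finVU by (intro rho_Un) auto
    also have "rho ((V - U) \<union> C \<union> (\<Union>(\<D> - {C}) \<union> A)) \<le> rho ((V - U) \<union> C) + rho (\<Union>(\<D> - {C}) \<union> A)"
      using fin3 finR finVU by (intro rho_Un) auto
    also have "rho ((V - U) \<union> C) \<le> rho (V - U) + rho C"
      using fin3 finR finVU by (intro rho_Un) auto
    also have "rho (V - U) \<le> b" using b covered_iff finVU by blast
    also have "rho (\<Union>(\<D> - {C}) \<union> A) \<le> P.rho (\<Union>(\<D> - {C}) \<union> A)" using fin3 by (intro rho_le_rho_face2)
    also have "rho R \<le> P.rho R" using finR by (intro rho_le_rho_face2)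
    finally show ?thesis using absorb[OF C] split[OF C] rest kb k_def by linarith
  qed
  have "rho S = (\<Sum>C\<in>\<D>. rho C)" using rho_separated[OF D(2) finC] D(1) by simp
  moreover have "P.rho S = (\<Sum>C\<in>\<D>. P.rho C)" using P.rho_separated[of \<D>] D(1,2) finC by simp
  ultimately have rhoS: "P.rho S \<le> rho S" using big by (simp add: sum_mono)
  \<comment> \<open>On \<open>S\<close> the two values of \<open>rho\<close> agree, so otherwise
    \<open>A\<close> would be absorbed by \<open>S\<close> for free, against
    \<open>not_absorbed\<close>.\<close>
  have "S = V"
  proof (rule ccontr)
    assume "S \<noteq> V"
    then have less: "rho S < rho (S \<union> A)" using not_absorbed[OF V _ Sne] S UV nbrsS by auto
    obtain C where C: "C \<in> \<D>" using Sne D(1) by blast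
    have "S \<union> A = C \<union> (\<Union>(\<D> - {C}) \<union> A)" using C D(1) by auto
    then have "P.rho (S \<union> A) \<le> P.rho C + P.rho (\<Union>(\<D> - {C}) \<union> A)"
      using P.rho_Un[of C "\<Union>(\<D> - {C}) \<union> A"] finC[OF C] finS finA D(1)
      by (metis Un_upper2 finite_Un \<open>S \<union> A = _\<close>)
    then have "P.rho (S \<union> A) \<le> P.rho S" using absorb[OF C] split[OF C] by linarith
    moreover have "rho (S \<union> A) \<le> P.rho (S \<union> A)" using finS finA by (intro rho_le_rho_face2) simp
    ultimately show False using less rhoS by linarith
  qed
  then have "U = V" using S UV by auto
  then have "P.rho (V - {z}) < k" using missable[of z] z kb \<open>S = V\<close> by simp
  then have "P.covered (k - 1) (V - {z})" using P.covered_iff[of "V - {z}"] V(1) by simp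
  moreover have "card (V - {z}) = 2 * (k - 1)" using z V(1) card by (simp add: k_def)
  ultimately show ?thesis using V(1) by (intro matched_if_covered) auto
qed

end

section \<open>Weights of missing arcs\<close>

locale loopfree_arcs =
  fixes E :: "('a \<times> 'a) set"
  assumes no_loop: "(x, x) \<notin> E"
begin

definition acyc :: "'a set \<Rightarrow> bool" where
  "acyc X \<longleftrightarrow> acyclic (E \<inter> X \<times> X)"

sublocale face_complex acyc
proof
  show "acyc Y" if "acyc X" "Y \<subseteq> X" for X Y
    using that unfolding acyc_def by (auto elim!: acyclic_subset)
  have "E \<inter> {x} \<times> {x} = {}" for x using no_loop by auto
  then show "acyc {x}" for x by (simp add: acyc_def acyclic_def)
qed

text \<open>The value 0 off the diagonal means a digon, that is, no adjacency; the diagonal is 0 so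
  that sums may run over all of \<open>X\<close>.\<close>

definition w :: "'a \<Rightarrow> 'a \<Rightarrow> nat" where
  "w x y = (if x = y then 0 else (if (x, y) \<in> E then 0 else 1) + (if (y, x) \<in> E then 0 else 1))"

definition wt :: "'a \<Rightarrow> 'a set \<Rightarrow> nat" where
  "wt x X = (\<Sum>y\<in>X. w x y)"

text \<open>\<open>W X\<close> runs over ordered pairs, so it is twice the number of missing arcs inside \<open>X\<close>.\<close>

definition W :: "'a set \<Rightarrow> nat" where
  "W X = (\<Sum>x\<in>X. wt x X)"

lemma w_sym: "w x y = w y x"
  by (simp add: w_def)

lemma w_self [simp]: "w x x = 0"
  by (simp add: w_def)

lemma w_le2: "w x y \<le> 2"
  by (simp add: w_def)

lemma acyc_rank:
  assumes "\<And>x y. x \<in> X \<Longrightarrow> y \<in> X \<Longrightarrow> (x, y) \<in> E \<Longrightarrow> (f x :: nat) < f y"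
  shows "acyc X"
  unfolding acyc_def
proof (rule acyclic_subset)
  show "acyclic (measure f)" by (intro wf_acyclic) simp
next
  show "E \<inter> X \<times> X \<subseteq> measure f" using assms by auto
qed

lemma acyc_order2:
  assumes "(y, x) \<notin> E"
  shows "acyc {x, y}"
  by (rule acyc_rank[of _ "\<lambda>z. if z = x then 0 else 1"]) (use assms no_loop in \<open>auto\<close>)

lemma acyc_order3:
  assumes "(y, x) \<notin> E" "(z, x) \<notin> E" "(z, y) \<notin> E" "x \<noteq> y" "x \<noteq> z" "y \<noteq> z"
  shows "acyc {x, y, z}"
  by (rule acyc_rank[of _ "\<lambda>v. if v = x then 0 else if v = y then 1 else 2"]) (use assms no_loop in \<open>auto\<close>)

lemma adj_iff: "adj x y \<longleftrightarrow> x \<noteq> y \<and> \<not> ((x, y) \<in> E \<and> (y, x) \<in> E)"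
proof -
  have "\<not> acyc {x, y}" if "(x, y) \<in> E" "(y, x) \<in> E"
  proof -
    have "(x, y) \<in> E \<inter> {x, y} \<times> {x, y}" "(y, x) \<in> E \<inter> {x, y} \<times> {x, y}" using that by auto
    then have "(x, x) \<in> (E \<inter> {x, y} \<times> {x, y})\<^sup>+" by (rule trancl.trancl_into_trancl[OF r_into_trancl])
    then show ?thesis by (auto simp: acyc_def acyclic_def)
  qed
  moreover have "acyc {x, y}" if "\<not> ((x, y) \<in> E \<and> (y, x) \<in> E)"
    using that acyc_order2[of x y] acyc_order2[of y x] by (auto simp: insert_commute)
  ultimately show ?thesis by (auto simp: adj_def)
qed

lemma adj_w: "adj x y \<longleftrightarrow> 0 < w x y"
  by (auto simp: adj_iff w_def)

text \<open>Each of the six linear orders must be violated by an arc; as no pair is a digon, only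
  the two cyclic orientations remain.\<close>

lemma nonface_triple:
  assumes "\<not> acyc {a, b, c}" "adj a b" "adj a c" "adj b c"
  shows "((a, b) \<in> E \<and> (b, c) \<in> E \<and> (c, a) \<in> E \<and> (b, a) \<notin> E \<and> (c, b) \<notin> E \<and> (a, c) \<notin> E) \<or>
         ((b, a) \<in> E \<and> (c, b) \<in> E \<and> (a, c) \<in> E \<and> (a, b) \<notin> E \<and> (b, c) \<notin> E \<and> (c, a) \<notin> E)"
proof -
  have d: "a \<noteq> b" "a \<noteq> c" "b \<noteq> c" using assms by (auto simp: adj_iff)
  have perm: "{a, c, b} = {a, b, c}" "{b, a, c} = {a, b, c}" "{b, c, a} = {a, b, c}"
    "{c, a, b} = {a, b, c}" "{c, b, a} = {a, b, c}" by auto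
  have "\<not> ((b, a) \<notin> E \<and> (c, a) \<notin> E \<and> (c, b) \<notin> E)" "\<not> ((c, a) \<notin> E \<and> (b, a) \<notin> E \<and> (b, c) \<notin> E)"
    "\<not> ((a, b) \<notin> E \<and> (c, b) \<notin> E \<and> (c, a) \<notin> E)" "\<not> ((c, b) \<notin> E \<and> (a, b) \<notin> E \<and> (a, c) \<notin> E)"
    "\<not> ((a, c) \<notin> E \<and> (b, c) \<notin> E \<and> (b, a) \<notin> E)" "\<not> ((b, c) \<notin> E \<and> (a, c) \<notin> E \<and> (a, b) \<notin> E)"
    using acyc_order3[of b a c] acyc_order3[of c a b] acyc_order3[of a b c]
      acyc_order3[of a c b] acyc_order3[of b c a] acyc_order3[of c b a] d d[symmetric] assms(1) perm by metis+
  then show ?thesis using assms(2-4) unfolding adj_iff by argo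
qed

text \<open>Either \<open>y\<close> is not adjacent to one of the two, or the triple is a directed
  triangle with both weights 1.\<close>

lemma nonface_w:
  assumes "\<not> acyc {y, a, b}" "adj a b"
  shows "w y a + w y b \<le> 2"
proof (cases "adj y a \<and> adj y b")
  case True
  then show ?thesis using nonface_triple[of y a b] assms by (auto simp: w_def)
next
  case False
  then have "w y a = 0 \<or> w y b = 0" by (auto simp: adj_w)
  then show ?thesis using w_le2[of y a] w_le2[of y b] by auto
qed

lemma wt_Un: "finite X \<Longrightarrow> finite Y \<Longrightarrow> X \<inter> Y = {} \<Longrightarrow> wt x (X \<union> Y) = wt x X + wt x Y"
  by (simp add: wt_def sum.union_disjoint)

lemma wt_swap: "(\<Sum>x\<in>X. wt x Y) = (\<Sum>y\<in>Y. wt y X)"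
  unfolding wt_def by (subst sum.swap) (simp add: w_sym)

lemma W_Un:
  assumes "finite X" "finite Y" "X \<inter> Y = {}"
  shows "W (X \<union> Y) = W X + 2 * (\<Sum>y\<in>Y. wt y X) + W Y"
proof -
  have "W (X \<union> Y) = (\<Sum>x\<in>X. wt x (X \<union> Y)) + (\<Sum>y\<in>Y. wt y (X \<union> Y))"
    unfolding W_def using assms by (intro sum.union_disjoint)
  also have "\<dots> = (\<Sum>x\<in>X. wt x X + wt x Y) + (\<Sum>y\<in>Y. wt y X + wt y Y)"
    using assms by (simp add: wt_Un)
  also have "\<dots> = W X + 2 * (\<Sum>y\<in>Y. wt y X) + W Y"
    by (simp add: sum.distrib W_def wt_swap[of X Y])
  finally show ?thesis .
qed

end

section \<open>Perfect matchings given by involutions\<close>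

context face_complex
begin

definition mates :: "('a \<Rightarrow> 'a) \<Rightarrow> 'a set \<Rightarrow> bool" where
  "mates m X \<longleftrightarrow> (\<forall>x\<in>X. m x \<in> X \<and> m (m x) = x \<and> adj x (m x))"

lemma matched_iff: "matched X \<longleftrightarrow> (\<exists>m. mates m X)"
  by (simp add: matched_def mates_def)

lemma matesD:
  assumes "mates m X" "x \<in> X"
  shows "m x \<in> X" "m (m x) = x" "adj x (m x)" "m x \<noteq> x"
  using assms by (auto simp: mates_def adj_def)

lemma mates_subset: "mates m X \<Longrightarrow> Y \<subseteq> X \<Longrightarrow> m ` Y \<subseteq> Y \<Longrightarrow> mates m Y"
  unfolding mates_def by blast

lemma mates_Diff: "mates m X \<Longrightarrow> Y \<subseteq> X \<Longrightarrow> m ` Y \<subseteq> Y \<Longrightarrow> mates m (X - Y)"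
  unfolding mates_def by (metis DiffD1 DiffD2 DiffI image_subset_iff)

lemma matched_empty [simp]: "matched {}"
  by (simp add: matched_def)

lemma matched_pair: assumes "adj a b" shows "matched {a, b}"
proof -
  have "mates (\<lambda>x. if x = a then b else a) {a, b}"
    using assms adj_sym[of a b] by (auto simp: mates_def adj_def)
  then show ?thesis by (auto simp: matched_iff)
qed

lemma matched_Un:
  assumes "matched X" "matched Y" "X \<inter> Y = {}"
  shows "matched (X \<union> Y)"
proof -
  obtain m l where "mates m X" "mates l Y" using assms by (auto simp: matched_iff)
  then have "mates (\<lambda>x. if x \<in> X then m x else l x) (X \<union> Y)"
    using assms(3) unfolding mates_def by (auto split: if_splits)
  then show ?thesis by (auto simp: matched_iff)
qed

lemma bij_betw_mates: "mates m X \<Longrightarrow> bij_betw m X X"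
  by (rule bij_betw_byWitness[of _ m]) (auto simp: mates_def)

lemma matched_covered:
  assumes "finite X" "matched X"
  shows "\<exists>l. card X = 2 * l \<and> covered l X"
proof -
  obtain m where m: "mates m X" using assms by (auto simp: matched_iff)
  define \<C> where "\<C> = (\<lambda>x. {x, m x}) ` X"
  have UC: "\<Union>\<C> = X" using m by (auto simp: \<C>_def mates_def)
  have "2 * card \<C> = card (\<Union>\<C>)"
  proof (rule card_partition)
    show "finite \<C>" "finite (\<Union>\<C>)" using assms UC by (auto simp: \<C>_def)
    show "card c = 2" if c: "c \<in> \<C>" for c
    proof -
      obtain x where "x \<in> X" "c = {x, m x}" using c by (auto simp: \<C>_def)
      then show ?thesis using matesD(4)[OF m, of x] by (metis card_2_iff)
    qed
    show "c1 \<inter> c2 = {}" if c: "c1 \<in> \<C>" "c2 \<in> \<C>" "c1 \<noteq> c2" for c1 c2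
    proof -
      obtain x y where xy: "x \<in> X" "y \<in> X" "c1 = {x, m x}" "c2 = {y, m y}" using c by (auto simp: \<C>_def)
      have mm: "m (m x) = x" "m (m y) = y" using matesD(2)[OF m] xy(1,2) by auto
      show ?thesis
      proof (rule ccontr)
        assume "c1 \<inter> c2 \<noteq> {}"
        then have "x = y \<or> x = m y \<or> m x = y \<or> m x = m y" using xy(3,4) by blast
        then have "c1 = c2" using mm xy(3,4) by (metis insert_commute)
        then show False using c(3) by blast
      qed
    qed
  qed
  moreover have "covered (card \<C>) X" unfolding covered_def
    using assms UC matesD(3)[OF m] by (intro exI[of _ \<C>]) (auto simp: \<C>_def adj_def)
  ultimately show ?thesis using UC by metis
qed

lemma matched_even: "finite X \<Longrightarrow> matched X \<Longrightarrow> even (card X)"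
  using matched_covered by (metis dvd_triv_left)

lemma mates_card_le:
  assumes m: "mates m X" and fin: "finite X" and P: "P \<subseteq> X"
    and indep: "\<And>x. x \<in> P \<Longrightarrow> m x \<notin> P"
  shows "card P \<le> card (X - P)"
proof -
  have "inj_on m P" using bij_betw_mates[OF m] P by (meson bij_betw_imp_inj_on inj_on_subset)
  moreover have "m ` P \<subseteq> X - P" using indep P matesD(1)[OF m] by auto
  ultimately show ?thesis using fin by (intro card_inj_on_le[of m]) auto
qed

end

context loopfree_arcs
begin

text \<open>By \<open>nonface_w\<close> a matched pair has weight at most 2, hence 1 per vertex;
  summing over \<open>x\<close> and \<open>m x\<close> counts every pair twice.\<close>

lemma wt_mates:
  assumes m: "mates m X" and fin: "finite X" and nf: "\<And>x. x \<in> X \<Longrightarrow> \<not> acyc {y, x, m x}"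
  shows "wt y X \<le> card X"
proof -
  have "wt y X = (\<Sum>x\<in>X. w y (m x))"
    unfolding wt_def using sum.reindex_bij_betw[OF bij_betw_mates[OF m], of "w y"] by simp
  then have "2 * wt y X = (\<Sum>x\<in>X. w y x + w y (m x))" by (simp add: sum.distrib wt_def)
  also have "\<dots> \<le> (\<Sum>x\<in>X. 2)" using nf matesD(3)[OF m] by (intro sum_mono nonface_w) auto
  finally show ?thesis by simp
qed

lemma sum_le_two_pair:
  fixes h :: "'a \<Rightarrow> nat"
  assumes "finite F" "f \<in> F" "f' \<in> F" "f \<noteq> f'" "\<And>x. x \<in> F \<Longrightarrow> h x \<le> 2"
  shows "sum h F + 4 \<le> h f + h f' + 2 * card F"
proof -
  have "sum h F = h f + (h f' + sum h (F - {f} - {f'}))"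
    using assms by (simp add: sum.remove[of F f] sum.remove[of "F - {f}" f'])
  moreover have "sum h (F - {f} - {f'}) \<le> of_nat (card (F - {f} - {f'})) * 2"
    using assms(5) by (intro sum_bounded_above) auto
  moreover have "card (F - {f} - {f'}) + 2 = card F"
  proof -
    have "card {f, f'} \<le> card F" using assms by (intro card_mono) auto
    then show ?thesis using assms by (simp add: card_Diff_singleton_if)
  qed
  ultimately show ?thesis by simp
qed

text \<open>Every other vertex of \<open>F\<close> contributes at most 2, so \<open>f\<close>,
  \<open>f'\<close> and the pair \<open>a\<close>, \<open>b\<close> carry more than 4 together. If
  \<open>a\<close>, \<open>f\<close>, \<open>f'\<close> formed a directed triangle, \<open>a\<close>
  would have weight 1 to both. For \<open>w a b = 2\<close> the vertex \<open>b\<close> is then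
  adjacent to neither and the total is only 4. For \<open>w a b = 1\<close> both \<open>a\<close>,
  \<open>b\<close>, \<open>f\<close> and \<open>a\<close>, \<open>b\<close>, \<open>f'\<close> are
  directed triangles, so \<open>f\<close> and \<open>f'\<close> are oriented alike at
  \<open>a\<close>, which the triangle forbids.\<close>

lemma heavy_pair:
  assumes fin: "finite F" and ff: "f \<in> F" "f' \<in> F" "adj f f'"
    and ab: "adj a b" and nf: "\<And>x. x \<in> F \<Longrightarrow> \<not> acyc {a, b, x}"
    and heavy: "2 * card F < (\<Sum>x\<in>F. w a x + w b x) + w a b"
    and adj: "adj a f" "adj a f'"
  shows "acyc {a, f, f'}"
proof (rule ccontr)
  assume nft: "\<not> acyc {a, f, f'}"
  have le2: "w a x + w b x \<le> 2" if "x \<in> F" for x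
    using nonface_w[of x a b] nf[OF that] ab by (simp add: w_sym insert_commute)
  have dist: "f \<noteq> f'" using ff by (auto simp: adj_iff)
  have tri: "((a, f) \<in> E \<and> (f, f') \<in> E \<and> (f', a) \<in> E \<and> (f, a) \<notin> E \<and> (f', f) \<notin> E \<and> (a, f') \<notin> E) \<or>
         ((f, a) \<in> E \<and> (f', f) \<in> E \<and> (a, f') \<in> E \<and> (a, f) \<notin> E \<and> (f, f') \<notin> E \<and> (f', a) \<notin> E)"
    using nonface_triple[OF nft adj ff(3)] .
  then have w1: "w a f = 1" "w a f' = 1" using adj by (auto simp: w_def adj_iff)
  have "4 < (w a f + w b f) + (w a f' + w b f') + w a b"
    using sum_le_two_pair[OF fin ff(1,2) dist, of "\<lambda>x. w a x + w b x"] le2 heavy by simp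
  moreover have "w b f = 0 \<and> w b f' = 0" if "w a b = 2"
  proof -
    have "\<not> adj b x" if "x \<in> F" "adj a x" for x
    proof
      assume "adj b x"
      from nonface_triple[OF nf[OF that(1)] ab that(2) this] show False
        using \<open>w a b = 2\<close> by (auto simp: w_def split: if_splits)
    qed
    then show ?thesis using ff adj by (auto simp: adj_w)
  qed
  ultimately have "w a b \<noteq> 2" and gt: "4 < (w a f + w b f) + (w a f' + w b f') + w a b"
    using w1 by auto
  then have "w a b = 1" "w b f = 1" "w b f' = 1"
    using w1 w_le2[of a b] le2[OF ff(1)] le2[OF ff(2)] by linarith+
  then have "adj b f" "adj b f'" by (simp_all add: adj_w)
  then have "(a, f) \<in> E \<longleftrightarrow> (a, f') \<in> E"
    using nonface_triple[OF nf[OF ff(1)] ab adj(1)] nonface_triple[OF nf[OF ff(2)] ab adj(2)] by argo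
  then show False using tri by argo
qed

text \<open>
  If the bound fails, then \<open>P\<close> and \<open>Q\<close>, the neighbourhoods of \<open>a\<close> and \<open>b\<close> in \<open>F\<close>, cover \<open>F\<close>, and for
  \<open>g \<in> Q\<close> no pair of the perfect matching of \<open>F - {g}\<close> lies inside \<open>P\<close>; the same holds with the
  roles of \<open>a\<close> and \<open>b\<close> exchanged.  Counting matched pairs makes each of \<open>P\<close> and \<open>Q\<close> too small.
\<close>

lemma pair_saving:
  assumes fin: "finite F" and card3: "3 \<le> card F"
    and crit: "\<And>f. f \<in> F \<Longrightarrow> mates (m f) (F - {f})"
    and ab: "adj a b" and nf: "\<And>x. x \<in> F \<Longrightarrow> \<not> acyc {a, b, x}"
    and ex: "\<exists>x\<in>F. adj a x" "\<exists>x\<in>F. adj b x"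
    and nfa: "\<And>g f. g \<in> F \<Longrightarrow> adj b g \<Longrightarrow> f \<in> F - {g} \<Longrightarrow> \<not> acyc {a, f, m g f}"
    and nfb: "\<And>g f. g \<in> F \<Longrightarrow> adj a g \<Longrightarrow> f \<in> F - {g} \<Longrightarrow> \<not> acyc {b, f, m g f}"
  shows "wt a F + wt b F + w a b \<le> 2 * card F"
proof (rule ccontr)
  assume "\<not> ?thesis"
  then have heavy: "2 * card F < (\<Sum>x\<in>F. w a x + w b x) + w a b"
    by (simp add: wt_def sum.distrib)
  then have heavy': "2 * card F < (\<Sum>x\<in>F. w b x + w a x) + w b a"
    by (simp add: w_sym add.commute)
  have le2: "w a x + w b x \<le> 2" if "x \<in> F" for x
    using nonface_w[of x a b] nf[OF that] ab by (simp add: w_sym insert_commute)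
  define P where "P = {x\<in>F. adj a x}"
  define Q where "Q = {x\<in>F. adj b x}"
  \<comment> \<open>A vertex adjacent to neither \<open>a\<close> nor \<open>b\<close> lowers the
    sum by 2, all that \<open>w a b\<close> can make up for.\<close>
  have PQ: "P \<union> Q = F"
  proof -
    have "x \<in> P \<union> Q" if x: "x \<in> F" for x
    proof (rule ccontr)
      assume "x \<notin> P \<union> Q"
      then have "w a x + w b x = 0" using x by (auto simp: P_def Q_def adj_w)
      then have "(\<Sum>x\<in>F. w a x + w b x) = (\<Sum>x\<in>F - {x}. w a x + w b x)"
        using sum.remove[OF fin x, of "\<lambda>x. w a x + w b x"] by simp
      also have "\<dots> \<le> of_nat (card (F - {x})) * 2" using le2 by (intro sum_bounded_above) auto
      also have "\<dots> = 2 * card F - 2" using fin x by simp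
      finally show False using heavy w_le2[of a b] card3 by linarith
    qed
    then show ?thesis by (auto simp: P_def Q_def)
  qed
  have A: "card (P - {g}) \<le> card (Q - P - {g})" if g: "g \<in> Q" for g
  proof -
    have gF: "g \<in> F" "adj b g" using g by (auto simp: Q_def)
    have "card (P - {g}) \<le> card (F - {g} - (P - {g}))"
    proof (rule mates_card_le[OF crit[OF gF(1)]])
      fix f assume f: "f \<in> P - {g}"
      show "m g f \<notin> P - {g}"
      proof
        assume f': "m g f \<in> P - {g}"
        have fF: "f \<in> F - {g}" using f by (auto simp: P_def)
        have "acyc {a, f, m g f}"
          using f f' matesD(3)[OF crit[OF gF(1)] fF] by (intro heavy_pair[OF fin _ _ _ ab nf heavy]) (auto simp: P_def)
        then show False using nfa gF fF by blast
      qed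
    qed (use fin in \<open>auto simp: P_def\<close>)
    also have "F - {g} - (P - {g}) = Q - P - {g}" using PQ by auto
    finally show ?thesis .
  qed
  have B: "card (Q - {g}) \<le> card (P - Q - {g})" if g: "g \<in> P" for g
  proof -
    have gF: "g \<in> F" "adj a g" using g by (auto simp: P_def)
    have nf': "\<And>x. x \<in> F \<Longrightarrow> \<not> acyc {b, a, x}" using nf by (simp add: insert_commute)
    have "card (Q - {g}) \<le> card (F - {g} - (Q - {g}))"
    proof (rule mates_card_le[OF crit[OF gF(1)]])
      fix f assume f: "f \<in> Q - {g}"
      show "m g f \<notin> Q - {g}"
      proof
        assume f': "m g f \<in> Q - {g}"
        have fF: "f \<in> F - {g}" using f by (auto simp: Q_def)
        have "acyc {b, f, m g f}"
          using f f' matesD(3)[OF crit[OF gF(1)] fF] ab adj_sym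
          by (intro heavy_pair[OF fin _ _ _ _ nf' heavy']) (auto simp: Q_def)
        then show False using nfb gF fF by blast
      qed
    qed (use fin in \<open>auto simp: Q_def\<close>)
    also have "F - {g} - (Q - {g}) = P - Q - {g}" using PQ by auto
    finally show ?thesis .
  qed
  have finPQ: "finite P" "finite Q" using fin by (auto simp: P_def Q_def)
  define N1 N2 N3 where "N1 = P - Q" and "N2 = Q - P" and "N3 = P \<inter> Q"
  have finN: "finite N1" "finite N2" "finite N3" using finPQ by (auto simp: N1_def N2_def N3_def)
  have "P = N1 \<union> N3" "N1 \<inter> N3 = {}" "Q = N2 \<union> N3" "N2 \<inter> N3 = {}"
    by (auto simp: N1_def N2_def N3_def)
  then have cP: "card P = card N1 + card N3" and cQ: "card Q = card N2 + card N3"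
    using finN by (metis card_Un_disjoint)+
  have cF: "card F = card N1 + card N2 + card N3"
  proof -
    have "F = P \<union> N2" "P \<inter> N2 = {}" using PQ by (auto simp: N2_def)
    then show ?thesis using cP finPQ finN by (simp add: card_Un_disjoint)
  qed
  have A2: "card P + 1 \<le> card N2" if g: "g \<in> N2" for g
  proof -
    have "P - {g} = P" using g by (auto simp: N2_def)
    moreover have "Q - P - {g} = N2 - {g}" by (auto simp: N2_def)
    moreover have "card (N2 - {g}) + 1 = card N2" using g finN by (metis Suc_eq_plus1 card_Suc_Diff1)
    ultimately show ?thesis using A[of g] g by (simp add: N2_def)
  qed
  have B1: "card Q + 1 \<le> card N1" if g: "g \<in> N1" for g
  proof -
    have "Q - {g} = Q" using g by (auto simp: N1_def)
    moreover have "P - Q - {g} = N1 - {g}" by (auto simp: N1_def)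
    moreover have "card (N1 - {g}) + 1 = card N1" using g finN by (metis Suc_eq_plus1 card_Suc_Diff1)
    ultimately show ?thesis using B[of g] g by (simp add: N1_def)
  qed
  have A3: "card P \<le> card N2 + 1" and B3: "card Q \<le> card N1 + 1" if g: "g \<in> N3" for g
  proof -
    have "card (P - {g}) + 1 = card P" "card (Q - {g}) + 1 = card Q"
      using g finPQ by (metis IntE N3_def Suc_eq_plus1 card_Suc_Diff1)+
    moreover have "Q - P - {g} = N2" "P - Q - {g} = N1" using g by (auto simp: N1_def N2_def N3_def)
    ultimately show "card P \<le> card N2 + 1" "card Q \<le> card N1 + 1" using A[of g] B[of g] g by (auto simp: N3_def)
  qed
  have pos: "X \<noteq> {} \<longleftrightarrow> 0 < card X" if "finite X" for X :: "'a set" using that by (simp add: card_gt_0_iff)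
  \<comment> \<open>Without common neighbours each of \<open>N1\<close>, \<open>N2\<close> would
    have to be larger than the other. A common neighbour forces \<open>card N3 = 1\<close> and
    \<open>card N1 = card N2\<close>; as \<open>3 \<le> card F\<close>, some \<open>h\<close> lies
    in \<open>N1\<close>, and \<open>B1\<close> fails for it.\<close>
  show False
  proof (cases "N3 = {}")
    case True
    have "P \<noteq> {}" "Q \<noteq> {}" using ex by (auto simp: P_def Q_def)
    then have "N1 \<noteq> {}" "N2 \<noteq> {}" using True by (auto simp: N1_def N2_def N3_def)
    then obtain g h where "g \<in> N1" "h \<in> N2" by blast
    then show False using A2[of h] B1[of g] cP cQ by simp
  next
    case False
    then obtain g where g: "g \<in> N3" by blast
    have "0 < card N3" using False pos finN by blast
    then have "card N3 = 1" "card N1 = card N2" using A3[OF g] B3[OF g] cP cQ by linarith+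
    then have "0 < card N1" using cF card3 by linarith
    then obtain h where "h \<in> N1" by fastforce
    then show False using B1[of h] cQ \<open>card N1 = card N2\<close> by linarith
  qed
qed

end

section \<open>Ears\<close>

context face_complex
begin

text \<open>Factor-criticality; singletons qualify, so that ears may start from a single
  vertex.\<close>

definition fcrit :: "'a set \<Rightarrow> bool" where
  "fcrit F \<longleftrightarrow> (\<forall>f\<in>F. matched (F - {f}))"

text \<open>An odd ear, given by its inner vertices through its effect on matchings: deleting
  \<open>y\<close> cuts the path into an even piece, matched by itself, and an odd piece, matched
  together with its end \<open>v\<close> in \<open>F\<close>.\<close>

definition ear :: "'a set \<Rightarrow> 'a set \<Rightarrow> bool" where
  "ear F Y \<longleftrightarrow> (\<forall>y\<in>Y. \<exists>v\<in>F. matched (insert v (Y - {y})))"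

text \<open>
  A state of the alternating walk that starts with the edge \<open>u z\<close> leaving \<open>F\<close> and then follows the
  matchings \<open>M\<close> (of \<open>X\<close>) and \<open>N\<close> (missing \<open>z\<close>) in turn: \<open>Y\<close> is the set of vertices passed, and \<open>x\<close> is
  the current vertex.  Working with the set \<open>Y\<close> instead of the sequence avoids all indexing; the walk
  has closed up to an ear once \<open>x \<in> F\<close>.
\<close>

definition ear_state ::
  "'a set \<Rightarrow> 'a set \<Rightarrow> ('a \<Rightarrow> 'a) \<Rightarrow> ('a \<Rightarrow> 'a) \<Rightarrow> 'a \<Rightarrow> 'a \<Rightarrow> 'a \<Rightarrow> 'a set \<Rightarrow> bool" where
  "ear_state F X M N z u x Y \<longleftrightarrow>
     Y \<subseteq> X \<and> M ` Y \<subseteq> Y \<and> x \<notin> Y \<and> x \<in> F \<union> X \<and> z \<in> insert x Y \<and>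
     N ` (insert x Y - {z}) \<subseteq> insert x Y - {z} \<and>
     (x \<notin> F \<longrightarrow> matched (insert u (insert x Y))) \<and>
     (\<forall>y\<in>Y. matched (insert x (Y - {y})) \<or> matched (insert u (Y - {y})))"

lemma matched_extend:
  assumes "matched X" "adj a b" "a \<notin> X" "b \<notin> X" "Z = X \<union> {a, b}"
  shows "matched Z"
  using matched_Un[OF assms(1) matched_pair[OF assms(2)]] assms(3-5) by simp

lemma ear_state_start:
  assumes "F \<inter> X = {}" "u \<in> F" "z \<in> X" "adj u z"
  shows "ear_state F X M N z u z {}"
  using assms matched_pair[of u z] by (simp add: ear_state_def)

text \<open>The walk proceeds along the pair of \<open>M\<close> at \<open>x\<close> and then along
  a pair of \<open>N\<close>. It cannot run into itself because the passed set is a union of pairs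
  of \<open>M\<close> and, up to \<open>x\<close> and \<open>z\<close>, of pairs of
  \<open>N\<close>.\<close>

lemma ear_state_step:
  assumes FX: "F \<inter> X = {}" "u \<in> F" and M: "mates M X" and N: "mates N (F \<union> X - {z})"
    and st: "ear_state F X M N z u x Y" and xF: "x \<notin> F"
  shows "ear_state F X M N z u (N (M x)) (insert x (insert (M x) Y))"
    and "x \<notin> Y" "M x \<notin> insert x Y"
proof -
  have Y: "Y \<subseteq> X" "M ` Y \<subseteq> Y" "x \<notin> Y" "x \<in> F \<union> X" "z \<in> insert x Y"
    and NY: "N ` (insert x Y - {z}) \<subseteq> insert x Y - {z}"
    and ux: "matched (insert u (insert x Y))"
    and alt: "\<And>y. y \<in> Y \<Longrightarrow> matched (insert x (Y - {y})) \<or> matched (insert u (Y - {y}))"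
    using st xF by (simp_all add: ear_state_def)
  have xX: "x \<in> X" using Y(4) xF by simp
  define x1 where "x1 = M x"
  have x1: "x1 \<in> X" "M x1 = x" "adj x x1" "x1 \<noteq> x" using matesD[OF M xX] by (simp_all add: x1_def)
  have x1Y: "x1 \<notin> Y"
  proof
    assume "x1 \<in> Y"
    then have "M x1 \<in> Y" using Y(2) by blast
    then show False using x1(2) Y(3) by simp
  qed
  have x1z: "x1 \<noteq> z" using x1Y x1(4) Y(5) by auto
  define x2 where "x2 = N x1"
  have "x1 \<in> F \<union> X - {z}" using x1(1) x1z by simp
  then have x2: "x2 \<in> F \<union> X - {z}" "N x2 = x1" "adj x1 x2" "x2 \<noteq> x1"
    using matesD[OF N, of x1] unfolding x2_def by blast+
  \<comment> \<open>Away from \<open>z\<close> the set \<open>insert x Y\<close> is closed under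
    \<open>N\<close>, so \<open>N\<close> cannot lead into it from the new vertex
    \<open>x1\<close>.\<close>
  have x2Y: "x2 \<notin> insert x Y"
  proof
    assume "x2 \<in> insert x Y"
    then have "x2 \<in> insert x Y - {z}" using x2(1) by blast
    then have "N x2 \<in> insert x Y - {z}" using NY by blast
    then show False using x2(2) x1(4) x1Y by simp
  qed
  have ux1: "u \<noteq> x1" "u \<noteq> x" "u \<notin> Y" using FX x1(1) xX Y(1) by auto
  define Y' where "Y' = insert x (insert x1 Y)"
  have matY: "matched Y" using mates_subset[OF M Y(1,2)] by (auto simp: matched_iff)
  have "ear_state F X M N z u x2 Y'"
    unfolding ear_state_def
  proof (intro conjI)
    show "Y' \<subseteq> X" using Y(1) xX x1(1) by (simp add: Y'_def)
    show "M ` Y' \<subseteq> Y'" using Y(2) x1(2) unfolding Y'_def x1_def by auto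
    show "x2 \<notin> Y'" using x2Y x2(4) by (simp add: Y'_def)
    show "x2 \<in> F \<union> X" using x2(1) by blast
    show "z \<in> insert x2 Y'" using Y(5) by (auto simp: Y'_def)
    show "N ` (insert x2 Y' - {z}) \<subseteq> insert x2 Y' - {z}"
    proof
      fix v assume "v \<in> N ` (insert x2 Y' - {z})"
      then obtain t where t: "v = N t" "t \<in> insert x2 Y'" "t \<noteq> z" by blast
      then consider "t = x2" | "t = x1" | "t \<in> insert x Y - {z}" by (auto simp: Y'_def)
      then show "v \<in> insert x2 Y' - {z}"
      proof cases
        case 1
        then show ?thesis using t(1) x2(2) x1z by (simp add: Y'_def)
      next
        case 2
        then have "v = x2" using t(1) by (simp add: x2_def)
        then show ?thesis using x2(1) by simp
      next
        case 3
        then have "v \<in> insert x Y - {z}" using NY t(1) by blast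
        then show ?thesis by (auto simp: Y'_def)
      qed
    qed
    show "x2 \<notin> F \<longrightarrow> matched (insert u (insert x2 Y'))"
    proof
      assume "x2 \<notin> F"
      then have "x2 \<noteq> u" using FX by auto
      then show "matched (insert u (insert x2 Y'))"
        using x2Y x1Y x1(4) ux1 by (intro matched_extend[OF ux x2(3)]) (auto simp: Y'_def)
    qed
    \<comment> \<open>Deleting \<open>x\<close> leaves the matched \<open>Y\<close> and the pair
      \<open>{x1, x2}\<close>; deleting \<open>x1\<close> leaves the matching from \<open>u\<close>
      up to \<open>x\<close>. For an earlier vertex the old matching grows by
      \<open>{x1, x2}\<close> if it ended in \<open>x\<close>, and by \<open>{x, x1}\<close> if it
      used \<open>u\<close>.\<close>
    show "\<forall>y\<in>Y'. matched (insert x2 (Y' - {y})) \<or> matched (insert u (Y' - {y}))"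
    proof
      fix y assume "y \<in> Y'"
      then consider "y = x" | "y = x1" | "y \<in> Y" by (auto simp: Y'_def)
      then show "matched (insert x2 (Y' - {y})) \<or> matched (insert u (Y' - {y}))"
      proof cases
        case 1
        have "insert x2 (Y' - {y}) = Y \<union> {x1, x2}" using 1 Y(3) x1(4) by (auto simp: Y'_def)
        then have "matched (insert x2 (Y' - {y}))"
          using x1Y x2Y by (intro matched_extend[OF matY x2(3)]) auto
        then show ?thesis ..
      next
        case 2
        have "insert u (Y' - {y}) = insert u (insert x Y)" using 2 x1Y x1(4) by (auto simp: Y'_def)
        then show ?thesis using ux by simp
      next
        case 3
        have yx: "y \<noteq> x" "y \<noteq> x1" using 3 Y(3) x1Y by auto
        from alt[OF 3] show ?thesis
        proof
          assume m: "matched (insert x (Y - {y}))"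
          have "insert x2 (Y' - {y}) = insert x (Y - {y}) \<union> {x1, x2}" using yx by (auto simp: Y'_def)
          then have "matched (insert x2 (Y' - {y}))"
            using x1Y x2Y x1(4) by (intro matched_extend[OF m x2(3)]) auto
          then show ?thesis ..
        next
          assume m: "matched (insert u (Y - {y}))"
          have "insert u (Y' - {y}) = insert u (Y - {y}) \<union> {x, x1}" using yx by (auto simp: Y'_def)
          then have "matched (insert u (Y' - {y}))"
            using x1Y ux1 Y(3) by (intro matched_extend[OF m x1(3)]) auto
          then show ?thesis ..
        qed
      qed
    qed
  qed
  then show "ear_state F X M N z u (N (M x)) (insert x (insert (M x) Y))"
    by (simp add: x1_def x2_def Y'_def)
  show "x \<notin> Y" by fact
  show "M x \<notin> insert x Y" using x1Y x1(4) by (simp add: x1_def)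
qed

lemma ex_max_state:
  assumes "finite X" "P x0 Y0" "\<And>x Y. P x Y \<Longrightarrow> Y \<subseteq> X"
  shows "\<exists>x Y. P x Y \<and> (\<forall>x' Y'. P x' Y' \<longrightarrow> card Y' \<le> card (Y :: 'a set))"
proof -
  define Q where "Q n \<longleftrightarrow> (\<exists>x Y. P x Y \<and> card Y = n)" for n
  have "Q (card Y0)" using assms(2) by (auto simp: Q_def)
  moreover have "n < card X + 1" if Qn: "Q n" for n
  proof -
    obtain x Y where "P x Y" "card Y = n" using Qn by (auto simp: Q_def)
    then show ?thesis using card_mono[OF assms(1) assms(3)] by fastforce
  qed
  ultimately obtain n where n: "Q n" "\<forall>l. Q l \<longrightarrow> l \<le> n"
    using ex_has_greatest_nat[of Q "card Y0" "\<lambda>n. n" "card X + 1"] by auto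
  obtain x Y where "P x Y" "card Y = n" using n(1) unfolding Q_def by blast
  moreover have "card Y' \<le> n" if "P x' Y'" for x' Y' using n(2) that by (auto simp: Q_def)
  ultimately show ?thesis by auto
qed

text \<open>A state with largest \<open>Y\<close> must have its current vertex in \<open>F\<close>,
  as otherwise another step is possible.\<close>

lemma ex_ear:
  assumes FX: "F \<inter> X = {}" "finite X" and uz: "u \<in> F" "z \<in> X" "adj u z"
    and M: "mates M X" and N: "mates N (F \<union> X - {z})"
  shows "\<exists>Y. Y \<subseteq> X \<and> Y \<noteq> {} \<and> M ` Y \<subseteq> Y \<and> ear F Y"
proof -
  let ?P = "ear_state F X M N z u"
  have "?P z {}" using ear_state_start[OF FX(1) uz] .
  moreover have "Y \<subseteq> X" if "?P x Y" for x Y using that by (simp add: ear_state_def)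
  ultimately have "\<exists>x Y. ?P x Y \<and> (\<forall>x' Y'. ?P x' Y' \<longrightarrow> card Y' \<le> card Y)"
    by (rule ex_max_state[OF FX(2), of ?P])
  then obtain x Y where st: "?P x Y" and max: "\<And>x' Y'. ?P x' Y' \<Longrightarrow> card Y' \<le> card Y"
    by metis
  have YX: "Y \<subseteq> X" using st by (simp add: ear_state_def)
  then have finY: "finite Y" using FX(2) finite_subset by auto
  have xF: "x \<in> F"
  proof (rule ccontr)
    assume "x \<notin> F"
    note step = ear_state_step[OF FX(1) uz(1) M N st this]
    have "card (insert x (insert (M x) Y)) \<le> card Y" using max[OF step(1)] .
    then show False using step(2,3) finY by auto
  qed
  have Y: "z \<in> insert x Y" "M ` Y \<subseteq> Y"
    and alt: "\<forall>y\<in>Y. matched (insert x (Y - {y})) \<or> matched (insert u (Y - {y}))"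
    using st by (simp_all add: ear_state_def)
  have "x \<noteq> z" using xF FX(1) uz(2) by auto
  then have "Y \<noteq> {}" using Y(1) by auto
  moreover have "ear F Y" unfolding ear_def
  proof
    fix y assume "y \<in> Y"
    then have "matched (insert x (Y - {y})) \<or> matched (insert u (Y - {y}))" using alt by simp
    then show "\<exists>v\<in>F. matched (insert v (Y - {y}))" using xF uz(1) by auto
  qed
  ultimately show ?thesis using YX Y(2) by (intro exI[of _ Y]) simp
qed

text \<open>When an inner vertex of the ear is deleted, the rest of the ear uses up one
  \<open>v\<close> in \<open>F\<close>, and \<open>F - {v}\<close> is matched.\<close>

lemma fcrit_ear:
  assumes "fcrit F" "F \<inter> Y = {}" "matched Y" "ear F Y"
  shows "fcrit (F \<union> Y)"
  unfolding fcrit_def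
proof
  fix f assume "f \<in> F \<union> Y"
  then show "matched (F \<union> Y - {f})"
  proof
    assume f: "f \<in> F"
    have "F \<union> Y - {f} = (F - {f}) \<union> Y" using f assms(2) by auto
    moreover have "matched (F - {f})" using assms(1) f by (simp add: fcrit_def)
    ultimately show ?thesis using matched_Un[of "F - {f}" Y] assms(2,3) by auto
  next
    assume y: "f \<in> Y"
    then obtain v where v: "v \<in> F" "matched (insert v (Y - {f}))" using assms(4) by (auto simp: ear_def)
    have "F \<union> Y - {f} = (F - {v}) \<union> insert v (Y - {f})" using v y assms(2) by auto
    moreover have "matched (F - {v})" using assms(1) v by (simp add: fcrit_def)
    moreover have "(F - {v}) \<inter> insert v (Y - {f}) = {}" using assms(2) by auto
    ultimately show ?thesis using matched_Un v(2) by metis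
  qed
qed

text \<open>Such a minimal set is spanned by a chordless odd cycle, but only its degrees are needed.\<close>

lemma min_fcrit_degree:
  assumes F: "finite F" "fcrit F"
    and min: "\<And>G. G \<subseteq> F \<Longrightarrow> fcrit G \<Longrightarrow> matched (F - G) \<Longrightarrow> 3 \<le> card G \<Longrightarrow> G = F"
    and u: "u \<in> F"
  shows "card {y\<in>F. adj u y} \<le> 2"
proof (cases "{y\<in>F. adj u y} = {}")
  case True
  show ?thesis unfolding True by simp
next
  case False
  then obtain z where z: "z \<in> F" "adj u z" by auto
  define X where "X = F - {u}"
  have zX: "z \<in> X" using z by (auto simp: X_def adj_def)
  have FX: "{u} \<inter> X = {}" "finite X" "F = {u} \<union> X" "{u} \<union> X - {z} = F - {z}"
    using F(1) u by (auto simp: X_def)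
  obtain M where M: "mates M X" using F(2) u by (auto simp: fcrit_def matched_iff X_def)
  obtain N where N: "mates N ({u} \<union> X - {z})" using F(2) z FX(4) by (auto simp: fcrit_def matched_iff)
  have fu: "fcrit {u}" by (simp add: fcrit_def)
  \<comment> \<open>An ear attached to \<open>{u}\<close> yields an admissible subset of order at
    least 3, so minimality makes it exhaust \<open>F\<close>.\<close>
  have closed: "insert u Y = F" if Y: "Y \<subseteq> X" "Y \<noteq> {}" "M ` Y \<subseteq> Y" "ear {u} Y" for Y
  proof (rule min)
    have finY: "finite Y" using Y(1) FX(2) finite_subset by auto
    have mY: "matched Y" using mates_subset[OF M Y(1,3)] by (auto simp: matched_iff)
    show "insert u Y \<subseteq> F" using Y(1) FX(3) by auto
    show "fcrit (insert u Y)" using fcrit_ear[OF fu _ mY Y(4)] Y(1) FX(1) by auto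
    have "F - insert u Y = X - Y" by (auto simp: X_def)
    then show "matched (F - insert u Y)" using mates_Diff[OF M Y(1,3)] by (auto simp: matched_iff)
    have "even (card Y)" "card Y \<noteq> 0" using matched_even[OF finY mY] Y(2) finY by auto
    then have "2 \<le> card Y" by presburger
    moreover have "u \<notin> Y" using Y(1) FX(1) by auto
    ultimately show "3 \<le> card (insert u Y)" using finY by simp
  qed
  \<comment> \<open>The walk is followed only while it has passed no neighbour of \<open>u\<close>
    other than \<open>z\<close>.\<close>
  let ?P = "\<lambda>x Y. ear_state {u} X M N z u x Y \<and> (\<forall>y\<in>Y. adj u y \<longrightarrow> y = z)"
  have "?P z {}" using ear_state_start[OF FX(1) _ zX z(2)] by simp
  moreover have "Y \<subseteq> X" if "?P x Y" for x Y using that by (simp add: ear_state_def)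
  ultimately have "\<exists>x Y. ?P x Y \<and> (\<forall>x' Y'. ?P x' Y' \<longrightarrow> card Y' \<le> card Y)"
    by (rule ex_max_state[OF FX(2), of ?P])
  then obtain x Y where st: "?P x Y" and max: "\<And>x' Y'. ?P x' Y' \<Longrightarrow> card Y' \<le> card Y"
    by metis
  have Y: "Y \<subseteq> X" "M ` Y \<subseteq> Y" "x \<notin> Y" "x \<in> {u} \<union> X" "z \<in> insert x Y"
    and NY: "N ` (insert x Y - {z}) \<subseteq> insert x Y - {z}"
    and ux: "x \<noteq> u \<Longrightarrow> matched (insert u (insert x Y))"
    and alt: "\<And>y. y \<in> Y \<Longrightarrow> matched (insert x (Y - {y})) \<or> matched (insert u (Y - {y}))"
    and nb: "\<And>y. y \<in> Y \<Longrightarrow> adj u y \<Longrightarrow> y = z"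
    using st by (auto simp: ear_state_def)
  have finY: "finite Y" using Y(1) FX(2) finite_subset by auto
  have mY: "matched Y" using mates_subset[OF M Y(1,2)] by (auto simp: matched_iff)
  have uu: "\<not> adj u u" by (simp add: adj_def)
  show ?thesis
  proof (cases "x = u")
    case True
    have "Y \<noteq> {}" using Y(5) True zX FX(1) by auto
    moreover have "ear {u} Y" using alt True by (auto simp: ear_def)
    ultimately have "insert u Y = F" using closed Y by blast
    then have "{y\<in>F. adj u y} \<subseteq> {z}" using nb uu by auto
    then have "card {y\<in>F. adj u y} \<le> card {z}" by (intro card_mono) auto
    then show ?thesis by simp
  next
    case xu: False
    then have xX: "x \<in> X" using Y(4) by simp
    \<comment> \<open>A second neighbour \<open>x\<close> of \<open>u\<close> could start a new walk
      on \<open>X - Y\<close>, since \<open>N\<close> restricted there misses just \<open>x\<close>;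
      the resulting ear avoids \<open>z\<close>, against \<open>closed\<close>.\<close>
    have nbx: "x = z" if ax: "adj u x"
    proof (rule ccontr)
      assume xz: "x \<noteq> z"
      have "mates M (X - Y)" using mates_Diff[OF M Y(1,2)] .
      moreover have "mates N ({u} \<union> (X - Y) - {x})"
      proof -
        have "insert x Y - {z} \<subseteq> {u} \<union> X - {z}" using Y(1,4) by auto
        then have "mates N ({u} \<union> X - {z} - (insert x Y - {z}))" using mates_Diff[OF N _ NY] by blast
        moreover have "{u} \<union> X - {z} - (insert x Y - {z}) = {u} \<union> (X - Y) - {x}"
          using Y(1,3,5) FX(1) xz xu by auto
        ultimately show ?thesis by simp
      qed
      ultimately obtain Y1 where Y1: "Y1 \<subseteq> X - Y" "Y1 \<noteq> {}" "M ` Y1 \<subseteq> Y1" "ear {u} Y1"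
        using ex_ear[of "{u}" "X - Y" u x M N] FX(1,2) xX Y(3) ax by auto
      then have "insert u Y1 = F" using closed[of Y1] by blast
      moreover have "z \<in> Y" using Y(5) xz by simp
      ultimately show False using Y1(1) Y(1) FX(1,3) by auto
    qed
    define x1 where "x1 = M x"
    have x1: "x1 \<in> X" "M x1 = x" "adj x x1" "x1 \<noteq> x" using matesD[OF M xX] by (simp_all add: x1_def)
    have step: "ear_state {u} X M N z u (N x1) (insert x (insert x1 Y))" "x1 \<notin> insert x Y"
      using ear_state_step[OF FX(1) _ M N, of u x Y] st xu by (simp_all add: x1_def)
    have u1: "u \<noteq> x1" "u \<notin> Y" "u \<noteq> x" using x1(1) Y(1) xu FX(1) by auto
    define Y' where "Y' = insert x (insert x1 Y)"
    \<comment> \<open>Otherwise the walk could go on within \<open>?P\<close>. The edge from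
      \<open>x1\<close> to \<open>u\<close> then closes it to an ear, which is all of
      \<open>F - {u}\<close>, and only \<open>z\<close> and \<open>x1\<close> are neighbours of
      \<open>u\<close>.\<close>
    have adj1: "adj u x1"
    proof (rule ccontr)
      assume no: "\<not> adj u x1"
      then have "?P (N x1) Y'" using step(1) nb nbx by (auto simp: Y'_def)
      then have "card Y' \<le> card Y" by (rule max)
      then show False using step(2) Y(3) finY by (auto simp: Y'_def)
    qed
    have "ear {u} Y'" unfolding ear_def
    proof
      fix y assume "y \<in> Y'"
      then consider "y = x" | "y = x1" | "y \<in> Y" by (auto simp: Y'_def)
      then have "matched (insert u (Y' - {y}))"
      proof cases
        case 1
        then have "insert u (Y' - {y}) = Y \<union> {u, x1}" using Y(3) x1(4) by (auto simp: Y'_def)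
        then show ?thesis using u1 step(2) by (intro matched_extend[OF mY adj1]) auto
      next
        case 2
        then have "insert u (Y' - {y}) = insert u (insert x Y)" using step(2) by (auto simp: Y'_def)
        then show ?thesis using ux[OF xu] by simp
      next
        case 3
        have yx: "y \<noteq> x" "y \<noteq> x1" using 3 Y(3) step(2) by auto
        from alt[OF 3] show ?thesis
        proof
          assume m: "matched (insert x (Y - {y}))"
          have "insert u (Y' - {y}) = insert x (Y - {y}) \<union> {u, x1}" using yx by (auto simp: Y'_def)
          then show ?thesis using u1 step(2) by (intro matched_extend[OF m adj1]) auto
        next
          assume m: "matched (insert u (Y - {y}))"
          have "insert u (Y' - {y}) = insert u (Y - {y}) \<union> {x, x1}" using yx by (auto simp: Y'_def)
          then show ?thesis using u1 step(2) Y(3) by (intro matched_extend[OF m x1(3)]) auto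
        qed
      qed
      then show "\<exists>v\<in>{u}. matched (insert v (Y' - {y}))" by simp
    qed
    moreover have "Y' \<subseteq> X" "Y' \<noteq> {}" "M ` Y' \<subseteq> Y'" using Y(1,2) xX x1(1,2) unfolding Y'_def x1_def by auto
    ultimately have "insert u Y' = F" using closed by blast
    then have "{y\<in>F. adj u y} \<subseteq> {z, x1}" using nb nbx uu by (auto simp: Y'_def)
    then have "card {y\<in>F. adj u y} \<le> card {z, x1}" by (intro card_mono) auto
    also have "\<dots> \<le> 2" by (simp add: card_insert_if)
    finally show ?thesis .
  qed
qed

lemma fcrit_odd:
  assumes "finite F" "fcrit F" "F \<noteq> {}" shows "odd (card F)"
proof -
  obtain f where f: "f \<in> F" using assms by blast
  then have "even (card (F - {f}))" using assms by (intro matched_even) (auto simp: fcrit_def)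
  moreover have "card F = Suc (card (F - {f}))" using f assms(1) by (metis card_Suc_Diff1)
  ultimately show ?thesis by simp
qed

lemma mates_remove_pair:
  assumes "mates m X" "x \<in> X"
  shows "matched (X - {x, m x})"
proof -
  have "mates m (X - {x, m x})" using assms matesD[OF assms] by (intro mates_Diff) auto
  then show ?thesis by (auto simp: matched_iff)
qed

end

section \<open>The number of missing arcs\<close>

text \<open>Here \<open>c\<close> and \<open>d\<close> are the orders of the old set and of the ear,
  \<open>e\<close> the weight between them. The right-hand square grows by
  \<open>d * (c - 1) + d * (c + d - 1)\<close>, so the claim is \<open>e \<le> d * (c - 1)\<close>;
  \<open>c \<ge> 3\<close> makes half of \<open>c + 1\<close> at most \<open>c - 1\<close>.\<close>

lemma square_growth:
  fixes c d e :: nat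
  assumes "3 \<le> c" "2 * e \<le> d * (c + 1)"
  shows "(c - 1)^2 + 4 + e + d * (c + d - 1) \<le> (c + d - 1)^2 + 4"
proof -
  obtain b where b: "c = b + 3" using assms(1) by (metis add.commute le_Suc_ex)
  have "c + 1 = b + 4" using b by simp
  then have "2 * e \<le> d * (b + 4)" using assms(2) by metis
  also have "\<dots> \<le> 2 * (d * (b + 2))" by (simp add: algebra_simps)
  finally have "e \<le> d * (b + 2)" by simp
  moreover have "(b + 2 + d)^2 = (b + 2)^2 + d * (b + 2) + d * (b + 2 + d)"
    by (simp add: power2_eq_square algebra_simps)
  moreover have "c - 1 = b + 2" "c + d - 1 = b + 2 + d" using b by simp_all
  ultimately show ?thesis by simp
qed

context loopfree_arcs
begin

context
  fixes V :: "'a set"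
  assumes V: "finite V" "conn V" "crit V" and cardV: "card V + 1 = 2 * rho V"
begin

lemma fcrit_V: "fcrit V"
  using crit_conn_factor_critical[OF V cardV] by (simp add: fcrit_def)

lemma no_face3:
  assumes T: "T \<subseteq> V" "card T = 3" "matched (V - T)"
  shows "\<not> acyc T"
proof
  assume face: "acyc T"
  obtain l where l: "card (V - T) = 2 * l" "covered l (V - T)" using matched_covered[OF _ T(3)] V(1) by auto
  have "covered (l + 1) ((V - T) \<union> T)" using l(2) covered_face[OF face] by (rule covered_Un)
  moreover have "(V - T) \<union> T = V" using T(1) by auto
  ultimately have "rho V \<le> l + 1" using covered_iff V(1) by simp
  moreover have "card (V - T) + 3 = card V"
    using T V(1) card_mono[OF V(1) T(1)] by (simp add: card_Diff_subset finite_subset)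
  ultimately show False using l(1) cardV by linarith
qed

text \<open>The stages of an ear decomposition of \<open>V\<close>. Keeping \<open>V - F\<close>
  matched extends matchings inside \<open>F\<close> to all of \<open>V\<close>, as
  \<open>no_face3\<close> requires.\<close>

definition good :: "'a set \<Rightarrow> bool" where
  "good F \<longleftrightarrow> F \<subseteq> V \<and> fcrit F \<and> matched (V - F)"

lemma goodD:
  assumes "good F"
  shows "F \<subseteq> V" "fcrit F" "matched (V - F)" "finite F"
  using assms V(1) finite_subset[of F V] by (auto simp: good_def)

text \<open>Removing one pair from \<open>Z\<close> leaves it matched, so together with the matching
  outside, \<open>no_face3\<close> applies to the triple.\<close>

lemma nonface_mates:
  assumes Z: "Z \<subseteq> V" "matched (V - insert y Z)" and y: "y \<in> V" "y \<notin> Z" and m: "mates m Z" and x: "x \<in> Z"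
  shows "\<not> acyc {y, x, m x}"
proof (rule no_face3)
  have mx: "m x \<in> Z" "m x \<noteq> x" using matesD[OF m x] by auto
  show "{y, x, m x} \<subseteq> V" using Z x mx y by auto
  have "y \<noteq> x" "y \<noteq> m x" "x \<noteq> m x" using y x mx by auto
  then show "card {y, x, m x} = 3" by simp
  have "V - {y, x, m x} = (V - insert y Z) \<union> (Z - {x, m x})" using Z(1) y x mx by auto
  moreover have "matched ((V - insert y Z) \<union> (Z - {x, m x}))"
    using Z(2) mates_remove_pair[OF m x] by (rule matched_Un) auto
  ultimately show "matched (V - {y, x, m x})" by simp
qed

lemma wt_outside:
  assumes Z: "Z \<subseteq> V" "matched Z" "matched (V - insert y Z)" and y: "y \<in> V" "y \<notin> Z"
  shows "wt y Z \<le> card Z"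
proof -
  obtain m where m: "mates m Z" using Z(2) by (auto simp: matched_iff)
  have "finite Z" using Z(1) V(1) finite_subset by auto
  with m show ?thesis using nonface_mates[OF Z(1,3) y m] by (rule wt_mates)
qed

lemma wt_remove: "finite F \<Longrightarrow> y \<in> F \<Longrightarrow> wt x F = w x y + wt x (F - {y})"
  unfolding wt_def by (rule sum.remove)

text \<open>From \<open>y\<close> the rest of \<open>F\<close> is perfectly matched, and no pair of
  it spans a face with \<open>y\<close>: weight 1 per vertex on average.\<close>

lemma wt_good:
  assumes F: "good F" and y: "y \<in> F"
  shows "wt y F \<le> card F - 1"
proof -
  have "wt y F = wt y (F - {y})" using wt_remove[of F y y] goodD(4)[OF F] y by simp
  also have "\<dots> \<le> card (F - {y})"
  proof (rule wt_outside)
    show "matched (F - {y})" using goodD(2)[OF F] y by (simp add: fcrit_def)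
    have "insert y (F - {y}) = F" using y by auto
    then show "matched (V - insert y (F - {y}))" using goodD(3)[OF F] by simp
  qed (use goodD(1)[OF F] y in auto)
  also have "\<dots> = card F - 1" using y goodD(4)[OF F] by simp
  finally show ?thesis .
qed

lemma W_good: "good F \<Longrightarrow> W F \<le> card F * (card F - 1)"
  unfolding W_def using sum_bounded_above[of F "\<lambda>y. wt y F" "card F - 1"] wt_good by simp

lemma good_base:
  assumes "3 \<le> card V"
  shows "\<exists>F. good F \<and> 3 \<le> card F \<and> W F \<le> (card F - 1)^2 + 4"
proof -
  have "good V" using fcrit_V by (simp add: good_def)
  then obtain F where F: "good F" "3 \<le> card F"
    and min: "\<And>G. good G \<Longrightarrow> 3 \<le> card G \<Longrightarrow> card F \<le> card G"
    using ex_has_least_nat[of "\<lambda>G. good G \<and> 3 \<le> card G" V card] assms by auto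
  note gF = goodD[OF F(1)]
  have min': "G = F" if G: "G \<subseteq> F" "fcrit G" "matched (F - G)" "3 \<le> card G" for G
  proof -
    have "V - G = (V - F) \<union> (F - G)" using G(1) gF(1) by auto
    moreover have "matched ((V - F) \<union> (F - G))" using gF(3) G(3) by (rule matched_Un) auto
    ultimately have "good G" using G gF(1) by (simp add: good_def)
    then have "card F \<le> card G" using min G(4) by simp
    then show ?thesis using card_seteq[OF gF(4) G(1)] by simp
  qed
  have "F \<noteq> {}" using F(2) by auto
  then have "odd (card F)" using fcrit_odd gF by simp
  then have "card F = 3 \<or> 5 \<le> card F" using F(2) by presburger
  then consider "card F = 3" | "5 \<le> card F" by blast
  \<comment> \<open>Order 3 gives 6 against 8. From order 5 on, degrees at most 2 give
    \<open>4 * card F\<close>, which suffices because (c - 1)(c - 5) \<ge> 0 for c =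
    \<open>card F\<close>; at 5 both sides agree.\<close>
  then have "W F \<le> (card F - 1)^2 + 4"
  proof cases
    case 1
    then show ?thesis using W_good[OF F(1)] by simp
  next
    case 2
    have "wt y F \<le> 4" if y: "y \<in> F" for y
    proof -
      have "wt y F = (\<Sum>x\<in>{x\<in>F. adj y x}. w y x)"
        unfolding wt_def using gF(4) by (intro sum.mono_neutral_right) (auto simp: adj_w)
      also have "\<dots> \<le> of_nat (card {x\<in>F. adj y x}) * 2" by (intro sum_bounded_above w_le2)
      also have "\<dots> \<le> 4" using min_fcrit_degree[OF gF(4,2) min' y] by simp
      finally show ?thesis .
    qed
    then have "W F \<le> card F * 4" unfolding W_def using sum_bounded_above[of F "\<lambda>y. wt y F" 4] by simp
    moreover obtain b where "card F = b + 5" using 2 by (metis add.commute le_Suc_ex)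
    ultimately show ?thesis by (simp add: power2_eq_square algebra_simps)
  qed
  then show ?thesis using F by blast
qed

lemma good_ear:
  assumes F: "good F" and M: "mates M (V - F)" and Y: "Y \<subseteq> V - F" "M ` Y \<subseteq> Y" "ear F Y"
  shows "good (F \<union> Y)"
proof -
  have "matched Y" using mates_subset[OF M Y(1,2)] by (auto simp: matched_iff)
  then have "fcrit (F \<union> Y)" using goodD(2)[OF F] Y(1,3) by (intro fcrit_ear) auto
  moreover have "V - (F \<union> Y) = V - F - Y" by auto
  moreover have "matched (V - F - Y)" using mates_Diff[OF M Y(1,2)] by (auto simp: matched_iff)
  ultimately show ?thesis using goodD(1)[OF F] Y(1) by (auto simp: good_def)
qed

text \<open>With c = \<open>card F\<close> the allowed increase is (c + 1)^2 - (c - 1)^2 = 4c.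
  Applying \<open>wt_good\<close> to \<open>a\<close> and \<open>M a\<close> separately gives only
  4c + 2 if \<open>w a (M a) = 1\<close>; \<open>pair_saving\<close> closes the gap.\<close>

lemma grow_pair:
  assumes F: "good F" "3 \<le> card F" and M: "mates M (V - F)"
    and a: "a \<in> V - F" "\<exists>f\<in>F. adj a f" "\<exists>f\<in>F. adj (M a) f"
  shows "good (F \<union> {a, M a})" "card (F \<union> {a, M a}) = card F + 2"
    "W (F \<union> {a, M a}) \<le> W F + 4 * card F"
proof -
  note gF = goodD[OF F(1)]
  define b where "b = M a"
  have b: "b \<in> V - F" "M b = a" "adj a b" "b \<noteq> a" using matesD[OF M a(1)] by (simp_all add: b_def)
  have "ear F {a, b}" unfolding ear_def
  proof
    fix y assume "y \<in> {a, b}"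
    then have "(y = a \<and> {a, b} - {y} = {b}) \<or> (y = b \<and> {a, b} - {y} = {a})" using b(4) by auto
    then show "\<exists>v\<in>F. matched (insert v ({a, b} - {y}))"
      using a(2,3) adj_sym matched_pair unfolding b_def by metis
  qed
  then have good': "good (F \<union> {a, b})" using a(1) b by (intro good_ear[OF F(1) M]) (auto simp: b_def)
  then show "good (F \<union> {a, M a})" by (simp add: b_def)
  have disj: "F \<inter> {a, b} = {}" using a(1) b(1) by auto
  have c2: "card {a, b} = 2" using b(4) by simp
  have "card (F \<union> {a, b}) = card F + 2" using card_Un_disjoint[OF gF(4) _ disj] c2 by simp
  then show "card (F \<union> {a, M a}) = card F + 2" by (simp add: b_def)
  have out: "matched (V - (F \<union> {a, b}))" using goodD(3)[OF good'] .
  have "\<exists>m. \<forall>f\<in>F. mates (m f) (F - {f})"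
    using gF(2) unfolding fcrit_def matched_iff by metis
  then obtain m where m: "\<And>f. f \<in> F \<Longrightarrow> mates (m f) (F - {f})" by blast
  have nf: "\<not> acyc {a, b, x}" if x: "x \<in> F" for x
  proof (rule no_face3)
    show "{a, b, x} \<subseteq> V" using a b gF(1) x by auto
    have "a \<noteq> b" "a \<noteq> x" "b \<noteq> x" using b(4) disj x by auto
    then show "card {a, b, x} = 3" by simp
    have "V - {a, b, x} = (V - (F \<union> {a, b})) \<union> (F - {x})" using gF(1) x disj by auto
    moreover have "matched (F - {x})" using m[OF x] by (auto simp: matched_iff)
    ultimately show "matched (V - {a, b, x})" using matched_Un[OF out, of "F - {x}"] by auto
  qed
  \<comment> \<open>Matching \<open>d\<close> with \<open>g\<close> leaves \<open>c\<close> facing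
    the matched set \<open>F - {g}\<close>. The variables \<open>c\<close>, \<open>d\<close> stand
    for \<open>a\<close>, \<open>b\<close> in either order.\<close>
  have nfa: "\<not> acyc {c, f, m g f}" if cd: "{c, d} = {a, b}" "c \<noteq> d" "g \<in> F" "adj d g" "f \<in> F - {g}" for c d g f
  proof (rule nonface_mates[of "F - {g}" c])
    show "mates (m g) (F - {g})" using m cd(3) by blast
    show "f \<in> F - {g}" by fact
    have cd': "c \<in> V - F" "d \<in> V - F" using cd(1) a(1) b(1) by (auto simp: doubleton_eq_iff)
    then show "c \<in> V" "c \<notin> F - {g}" "F - {g} \<subseteq> V" using gF(1) by auto
    have "V - insert c (F - {g}) = (V - (F \<union> {a, b})) \<union> {d, g}"
      using cd' cd gF(1) unfolding cd(1)[symmetric] by auto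
    moreover have "matched ((V - (F \<union> {a, b})) \<union> {d, g})"
      using cd by (intro matched_Un[OF out] matched_pair) auto
    ultimately show "matched (V - insert c (F - {g}))" by simp
  qed
  have "wt a F + wt b F + w a b \<le> 2 * card F"
  proof (rule pair_saving[OF gF(4) F(2) m b(3) nf a(2)])
    show "\<exists>x\<in>F. adj b x" using a(3) by (simp add: b_def)
    show "\<not> acyc {a, f, m g f}" if "g \<in> F" "adj b g" "f \<in> F - {g}" for g f
      using nfa[of a b g f] that b(4) by auto
    show "\<not> acyc {b, f, m g f}" if "g \<in> F" "adj a g" "f \<in> F - {g}" for g f
      using nfa[of b a g f] that b(4) by auto
  qed
  moreover have "W (F \<union> {a, b}) = W F + 2 * (wt a F + wt b F) + 2 * w a b"
  proof -
    have "W {a, b} = 2 * w a b" using b(4) by (simp add: W_def wt_def w_sym)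
    moreover have "(\<Sum>y\<in>{a, b}. wt y F) = wt a F + wt b F" using b(4) by simp
    ultimately show ?thesis using W_Un[OF gF(4) _ disj] by simp
  qed
  ultimately show "W (F \<union> {a, M a}) \<le> W F + 4 * card F" by (simp add: b_def)
qed

text \<open>By \<open>nopair\<close> one vertex of every pair of \<open>M\<close> has weight 0 to
  \<open>F\<close>, which halves the estimate of the weight between \<open>Y\<close> and
  \<open>F\<close>.\<close>

lemma grow_ear:
  assumes F: "good F" "3 \<le> card F" "W F \<le> (card F - 1)^2 + 4" and M: "mates M (V - F)"
    and nopair: "\<And>a. a \<in> V - F \<Longrightarrow> (\<exists>f\<in>F. adj a f) \<Longrightarrow> \<not> (\<exists>f\<in>F. adj (M a) f)"
    and Y: "Y \<subseteq> V - F" "M ` Y \<subseteq> Y" "ear F Y"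
  shows "W (F \<union> Y) \<le> (card (F \<union> Y) - 1)^2 + 4"
proof -
  note gF = goodD[OF F(1)]
  have good': "good (F \<union> Y)" using good_ear[OF F(1) M Y] .
  have mY: "mates M Y" using mates_subset[OF M Y(1,2)] .
  have disj: "F \<inter> Y = {}" using Y(1) by auto
  have finY: "finite Y" using Y(1) V(1) finite_subset[of Y V] by auto
  define e where "e = (\<Sum>y\<in>Y. wt y F)"
  \<comment> \<open>The rest of the ear is matched with \<open>v\<close>, so \<open>F - {v}\<close>
    contributes at most \<open>card F - 1\<close>, and \<open>v\<close> itself at most 2.\<close>
  have bound: "wt y F \<le> card F + 1" if y: "y \<in> Y" for y
  proof -
    obtain v where v: "v \<in> F" "matched (insert v (Y - {y}))" using Y(3) y by (auto simp: ear_def)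
    have "wt y (F - {v}) \<le> card (F - {v})"
    proof (rule wt_outside)
      show "matched (F - {v})" using gF(2) v(1) by (simp add: fcrit_def)
      show "F - {v} \<subseteq> V" "y \<in> V" "y \<notin> F - {v}" using gF(1) y Y(1) by auto
      have "V - insert y (F - {v}) = (V - (F \<union> Y)) \<union> insert v (Y - {y})"
        using y v(1) Y(1) gF(1) by auto
      moreover have "matched ((V - (F \<union> Y)) \<union> insert v (Y - {y}))"
        using goodD(3)[OF good'] v by (intro matched_Un) auto
      ultimately show "matched (V - insert y (F - {v}))" by simp
    qed
    moreover have "card (F - {v}) + 1 = card F" using v(1) gF(4) F(2) by simp
    ultimately show ?thesis using wt_remove[OF gF(4) v(1), of y] w_le2[of y v] by linarith
  qed
  have e2: "2 * e \<le> card Y * (card F + 1)"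
  proof -
    have "e = (\<Sum>y\<in>Y. wt (M y) F)"
      unfolding e_def using sum.reindex_bij_betw[OF bij_betw_mates[OF mY], of "\<lambda>y. wt y F"] by simp
    then have "2 * e = (\<Sum>y\<in>Y. wt y F + wt (M y) F)" by (simp add: sum.distrib e_def)
    also have "\<dots> \<le> of_nat (card Y) * (card F + 1)"
    proof (rule sum_bounded_above)
      fix y assume y: "y \<in> Y"
      have My: "M y \<in> Y" using Y(2) y by blast
      have zero: "wt x F = 0" if "\<not> (\<exists>f\<in>F. adj x f)" for x
        using that unfolding wt_def by (auto simp: adj_w)
      show "wt y F + wt (M y) F \<le> card F + 1"
      proof (cases "\<exists>f\<in>F. adj y f")
        case True
        then have "wt (M y) F = 0" using nopair[of y] zero y Y(1) by blast
        then show ?thesis using bound[OF y] by simp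
      next
        case False
        then have "wt y F = 0" by (rule zero)
        then show ?thesis using bound[OF My] by simp
      qed
    qed
    finally show ?thesis by simp
  qed
  have cFY: "card (F \<union> Y) = card F + card Y" using gF(4) finY disj by (rule card_Un_disjoint)
  \<comment> \<open>One of the two copies of \<open>e\<close> is combined with \<open>W Y\<close>
    into the weights of \<open>Y\<close> in the good set \<open>F \<union> Y\<close>, where
    \<open>wt_good\<close> applies.\<close>
  have "e + W Y = (\<Sum>y\<in>Y. wt y (F \<union> Y))"
    using gF(4) finY disj by (simp add: wt_Un sum.distrib e_def W_def)
  also have "\<dots> \<le> of_nat (card Y) * (card F + card Y - 1)"
    using wt_good[OF good'] cFY by (intro sum_bounded_above) auto
  finally have "e + W Y \<le> card Y * (card F + card Y - 1)" by simp
  moreover have "W (F \<union> Y) = W F + 2 * e + W Y" using W_Un[OF gF(4) finY disj] by (simp add: e_def)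
  ultimately have "W (F \<union> Y) \<le> (card F - 1)^2 + 4 + e + card Y * (card F + card Y - 1)"
    using F(3) by linarith
  also have "\<dots> \<le> (card F + card Y - 1)^2 + 4" using F(2) e2 by (rule square_growth)
  finally show ?thesis by (simp add: cFY)
qed

text \<open>A largest good set that obeys the bound is \<open>V\<close>: connectivity gives an edge
  leaving any other one, and then either a pair or a longer walk yields an ear along which the bound
  persists.\<close>

theorem W_bound_tight: "W V \<le> (card V - 1)^2 + 4"
proof (cases "3 \<le> card V")
  case False
  have "V \<noteq> {} \<Longrightarrow> odd (card V)" using fcrit_odd[OF V(1) fcrit_V] .
  then have "card V \<le> 1" using False by (cases "V = {}") (auto simp: numeral_3_eq_3 le_Suc_eq not_le less_Suc_eq)
  then have "W V \<le> 0" using W_good[of V] fcrit_V by (simp add: good_def)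
  then show ?thesis by simp
next
  case True
  define inv where "inv F \<longleftrightarrow> good F \<and> 3 \<le> card F \<and> W F \<le> (card F - 1)^2 + 4" for F
  obtain F0 where "inv F0" using good_base[OF True] by (auto simp: inv_def)
  moreover have "\<forall>F. inv F \<longrightarrow> card F < card V + 1"
    using goodD(1) V(1) card_mono by (fastforce simp: inv_def less_Suc_eq_le)
  ultimately obtain F where F: "inv F" and max: "\<And>G. inv G \<Longrightarrow> card G \<le> card F"
    using ex_has_greatest_nat[of inv F0 card "card V + 1"] by auto
  have iF: "good F" "3 \<le> card F" "W F \<le> (card F - 1)^2 + 4" using F by (simp_all add: inv_def)
  note gF = goodD[OF iF(1)]
  have "F = V"
  proof (rule ccontr)
    assume "F \<noteq> V"
    moreover have "F \<noteq> {}" using iF(2) by auto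
    ultimately have "\<not> apart F (V - F)" using V(2) gF(1) by (simp add: conn_def)
    then obtain u z where uz: "u \<in> F" "z \<in> V - F" "adj u z" by (auto simp: apart_def)
    obtain M where M: "mates M (V - F)" using gF(3) by (auto simp: matched_iff)
    show False
    proof (cases "\<exists>a\<in>V - F. (\<exists>f\<in>F. adj a f) \<and> (\<exists>f\<in>F. adj (M a) f)")
      case True
      then obtain a where a: "a \<in> V - F" "\<exists>f\<in>F. adj a f" "\<exists>f\<in>F. adj (M a) f" by blast
      note g = grow_pair[OF iF(1,2) M a]
      obtain b where b: "card F = b + 1" using iF(2) by (metis add.commute le_Suc_ex le_trans one_le_numeral)
      have "(b + 2)^2 = b^2 + 4 * (b + 1)" by (simp add: power2_eq_square algebra_simps)
      then have "W (F \<union> {a, M a}) \<le> (card (F \<union> {a, M a}) - 1)^2 + 4"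
        using g(2,3) iF(3) b by simp
      then have "inv (F \<union> {a, M a})" using g(1,2) iF(2) by (simp add: inv_def)
      then show False using max[of "F \<union> {a, M a}"] g(2) by simp
    next
      case False
      obtain N where N: "mates N (V - {z})" using fcrit_V uz(2) by (auto simp: fcrit_def matched_iff)
      have "F \<union> (V - F) - {z} = V - {z}" using gF(1) by auto
      then have N': "mates N (F \<union> (V - F) - {z})" using N by simp
      have "finite (V - F)" using V(1) by simp
      then obtain Y where Y: "Y \<subseteq> V - F" "Y \<noteq> {}" "M ` Y \<subseteq> Y" "ear F Y"
        using ex_ear[OF _ _ uz M N'] by auto
      have "W (F \<union> Y) \<le> (card (F \<union> Y) - 1)^2 + 4"
        using False by (intro grow_ear[OF iF M _ Y(1,3,4)]) blast
      moreover have "good (F \<union> Y)" using good_ear[OF iF(1) M Y(1,3,4)] .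
      moreover have "card F < card (F \<union> Y)"
        using Y(1,2) goodD(4)[OF \<open>good (F \<union> Y)\<close>] by (intro psubset_card_mono) auto
      ultimately have "inv (F \<union> Y)" using iF(2) by (simp add: inv_def)
      then show False using max \<open>card F < card (F \<union> Y)\<close> by fastforce
    qed
  qed
  then show ?thesis using iF(3) by simp
qed

end

end

section \<open>Semidegrees and the bound for arbitrary critical sets\<close>

lemma acyclic_insert_sink:
  assumes ac: "acyclic (r \<inter> C \<times> C)" and sink: "\<And>y. y \<in> insert x C \<Longrightarrow> (x, y) \<notin> r"
  shows "acyclic (r \<inter> insert x C \<times> insert x C)"
proof -
  let ?s = "r \<inter> insert x C \<times> insert x C" and ?t = "r \<inter> C \<times> C"
  have step: "a \<noteq> x \<and> (b \<noteq> x \<longrightarrow> (a, b) \<in> ?t)" if "(a, b) \<in> ?s" for a b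
    using that sink by blast
  have "a \<noteq> x \<and> (b \<noteq> x \<longrightarrow> (a, b) \<in> ?t\<^sup>+)" if "(a, b) \<in> ?s\<^sup>+" for a b
    using that
  proof (induction rule: trancl_induct)
    case (base b)
    then show ?case using step[of a b] by blast
  next
    case (step b c)
    then show ?case using \<open>\<And>a b. (a, b) \<in> ?s \<Longrightarrow> a \<noteq> x \<and> (b \<noteq> x \<longrightarrow> (a, b) \<in> ?t)\<close>[of b c]
      by (meson trancl.trancl_into_trancl)
  qed
  then show ?thesis using ac unfolding acyclic_def by blast
qed

text \<open>The cross term \<open>8 * p * q\<close> pays for the second 4.\<close>

lemma double_square_add:
  fixes p q :: nat
  assumes "0 < p" "0 < q"
  shows "(4 * p^2 + 4) + (4 * q^2 + 4) \<le> 4 * (p + q)^2 + 4"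
proof -
  have "1 \<le> p * q" using assms by simp
  then show ?thesis by (simp add: power2_eq_square algebra_simps)
qed

context face_complex
begin

lemma crit_apart:
  assumes fin: "finite (X \<union> Y)" and XY: "X \<inter> Y = {}" "apart X Y" and crit: "crit (X \<union> Y)"
  shows "crit X"
  unfolding crit_def
proof
  fix x assume x: "x \<in> X"
  have "X \<union> Y - {x} = (X - {x}) \<union> Y" using x XY(1) by auto
  moreover have "apart (X - {x}) Y" using XY(2) by (simp add: apart_def)
  ultimately have "rho (X \<union> Y - {x}) = rho (X - {x}) + rho Y"
    using rho_Un_apart[of "X - {x}" Y] fin XY(1) by auto
  moreover have "rho (X \<union> Y - {x}) < rho (X \<union> Y)" using crit x by (simp add: crit_def)
  moreover have "rho (X \<union> Y) = rho X + rho Y" using rho_Un_apart[of X Y] fin XY by auto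
  ultimately show "rho (X - {x}) < rho X" by simp
qed

end

context loopfree_arcs
begin

lemma acyc_insert_sink:
  assumes "acyc C" "\<And>y. y \<in> C \<Longrightarrow> (x, y) \<notin> E"
  shows "acyc (insert x C)"
  using assms no_loop acyclic_insert_sink[of E C x] by (auto simp: acyc_def)

lemma acyc_insert_source:
  assumes "acyc C" "\<And>y. y \<in> C \<Longrightarrow> (y, x) \<notin> E"
  shows "acyc (insert x C)"
proof -
  have conv: "(E \<inter> X \<times> X)\<inverse> = E\<inverse> \<inter> X \<times> X" for X by auto
  have "acyclic (E\<inverse> \<inter> C \<times> C)" using assms(1) acyclic_converse[of "E \<inter> C \<times> C"] conv[of C] by (simp add: acyc_def)
  then have "acyclic (E\<inverse> \<inter> insert x C \<times> insert x C)"
    using assms(2) no_loop by (intro acyclic_insert_sink) auto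
  then have "acyclic ((E \<inter> insert x C \<times> insert x C)\<inverse>)" by (simp only: conv)
  then show ?thesis by (simp only: acyclic_converse acyc_def)
qed

text \<open>In an optimal cover of \<open>V - {x}\<close> the vertex \<open>x\<close> needs an
  out-neighbour and an in-neighbour in every class; otherwise it could join that class as a sink or
  a source.\<close>

lemma crit_degree:
  assumes V: "finite V" "crit V" and x: "x \<in> V"
  shows "rho V \<le> card {y\<in>V. (x, y) \<in> E} + 1" "rho V \<le> card {y\<in>V. (y, x) \<in> E} + 1"
proof -
  have less: "rho (V - {x}) < rho V" using V(2) x by (simp add: crit_def)
  obtain \<C> where C: "finite \<C>" "card \<C> \<le> rho (V - {x})" "\<forall>C\<in>\<C>. acyc C" "V - {x} \<subseteq> \<Union>\<C>"
    using covered_rho[of "V - {x}"] V(1) unfolding covered_def by auto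
  have "\<forall>y\<in>V - {x}. \<exists>C\<in>\<C>. y \<in> C" using C(4) by auto
  then obtain \<phi> where \<phi>: "\<forall>y\<in>V - {x}. \<phi> y \<in> \<C> \<and> y \<in> \<phi> y" by metis
  define K where "K C = {y\<in>V - {x}. \<phi> y = C}" for C
  have K: "acyc (K C)" if "C \<in> \<C>" for C
  proof -
    have "K C \<subseteq> C" using \<phi> by (auto simp: K_def)
    then show ?thesis using C(3) that face_mono by blast
  qed
  have nof: "\<not> acyc (insert x (K C))" if D: "C \<in> \<C>" for C
  proof
    assume a: "acyc (insert x (K C))"
    define \<E> where "\<E> = insert (insert x (K C)) (K ` (\<C> - {C}))"
    have "finite \<E>" using C(1) by (simp add: \<E>_def)
    moreover have "card \<E> \<le> card \<C>"
    proof -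
      have "card \<E> \<le> card (K ` (\<C> - {C})) + 1" by (simp add: \<E>_def card_insert_if C(1))
      also have "card (K ` (\<C> - {C})) \<le> card (\<C> - {C})" using C(1) by (intro card_image_le) simp
      also have "card (\<C> - {C}) + 1 = card \<C>" using C(1) D by (metis Suc_eq_plus1 card_Suc_Diff1)
      finally show ?thesis by simp
    qed
    moreover have "\<forall>F\<in>\<E>. acyc F" using a K by (auto simp: \<E>_def)
    moreover have "V \<subseteq> \<Union>\<E>"
    proof
      fix y assume y: "y \<in> V"
      show "y \<in> \<Union>\<E>"
      proof (cases "y = x \<or> \<phi> y = C")
        case True
        then have "y \<in> insert x (K C)" using y by (auto simp: K_def)
        then show ?thesis unfolding \<E>_def by blast
      next
        case False
        then have "y \<in> K (\<phi> y)" "\<phi> y \<in> \<C> - {C}" using y \<phi> by (auto simp: K_def)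
        then show ?thesis by (auto simp: \<E>_def)
      qed
    qed
    ultimately have "covered (card \<C>) V" unfolding covered_def by blast
    then have "rho V \<le> card \<C>" using covered_iff V(1) by blast
    then show False using C(2) less by simp
  qed
  have card: "rho V \<le> card \<C> + 1"
  proof -
    have "covered (card \<C>) (V - {x})" unfolding covered_def using C by blast
    then have "rho (V - {x}) \<le> card \<C>" using covered_iff V(1) by simp
    then show ?thesis using rho_remove[OF V(1), of x] by simp
  qed
  \<comment> \<open>The classes \<open>K C\<close> are disjoint, so one representative from each
    injects \<open>\<C>\<close>, with inverse \<open>\<phi>\<close>.\<close>
  have main: "card \<C> \<le> card {y\<in>V. P y}" if ex: "\<And>C. C \<in> \<C> \<Longrightarrow> \<exists>y\<in>K C. P y" for P
  proof -
    have "\<forall>C\<in>\<C>. \<exists>y. y \<in> K C \<and> P y" using ex by blast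
    then obtain s where s: "\<forall>C\<in>\<C>. s C \<in> K C \<and> P (s C)" by metis
    then have inv: "\<phi> (s C) = C" if "C \<in> \<C>" for C using that by (simp add: K_def)
    show ?thesis
    proof (rule card_inj_on_le)
      show "inj_on s \<C>" by (rule inj_on_inverseI[of _ \<phi>]) (rule inv)
      show "s ` \<C> \<subseteq> {y\<in>V. P y}" using s by (auto simp: K_def)
    qed (use V(1) in simp)
  qed
  have "\<exists>y\<in>K C. (x, y) \<in> E" if "C \<in> \<C>" for C using nof K acyc_insert_sink that by blast
  from main[OF this] card show "rho V \<le> card {y\<in>V. (x, y) \<in> E} + 1" by simp
  have "\<exists>y\<in>K C. (y, x) \<in> E" if "C \<in> \<C>" for C using nof K acyc_insert_source that by blast
  from main[OF this] card show "rho V \<le> card {y\<in>V. (y, x) \<in> E} + 1" by simp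
qed

lemma wt_plus_degrees:
  assumes "finite V" "x \<in> V"
  shows "wt x V + card {y\<in>V. (x, y) \<in> E} + card {y\<in>V. (y, x) \<in> E} = 2 * (card V - 1)"
proof -
  have "card {y\<in>V. P y} = (\<Sum>y\<in>V. if P y then 1 else 0)" for P
    using assms(1) by (simp add: sum.If_cases Int_def)
  then have "wt x V + card {y\<in>V. (x, y) \<in> E} + card {y\<in>V. (y, x) \<in> E} =
      (\<Sum>y\<in>V. w x y + (if (x, y) \<in> E then 1 else 0) + (if (y, x) \<in> E then 1 else 0))"
    by (simp add: wt_def sum.distrib)
  also have "\<dots> = (\<Sum>y\<in>V. if y = x then 0 else 2)" using no_loop by (intro sum.cong) (auto simp: w_def)
  also have "\<dots> = (\<Sum>y\<in>V - {x}. 2)" using assms by (subst sum.remove[of V x]) auto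
  also have "\<dots> = 2 * (card V - 1)" using assms by simp
  finally show ?thesis .
qed

lemma wt_crit:
  assumes "finite V" "crit V" "x \<in> V"
  shows "wt x V + 2 * rho V \<le> 2 * card V"
proof -
  have "0 < card V" using assms by (auto simp: card_gt_0_iff)
  then show ?thesis using crit_degree[OF assms] wt_plus_degrees[OF assms(1,3)] by linarith
qed

theorem W_bound:
  assumes "finite V" "crit V"
  shows "W V \<le> (if card V = rho V then 0 else 4 * (card V - rho V)^2 + 4)"
  using assms
proof (induction "card V" arbitrary: V rule: less_induct)
  case less
  note V = less.prems
  have le: "rho X \<le> card X" if "finite X" for X using that by (rule rho_le_card)
  show ?case
  proof (cases "conn V")
    case True
    obtain p where p: "card V = rho V + p" using le[OF V(1)] by (metis le_Suc_ex)
    have sum: "W V \<le> card V * (2 * p)"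
    proof -
      have "wt x V \<le> 2 * p" if "x \<in> V" for x using wt_crit[OF V that] p by simp
      then show ?thesis unfolding W_def using sum_bounded_above[of V "\<lambda>x. wt x V" "2 * p"] by simp
    qed
    show ?thesis
    proof (cases "p = 0")
      case True
      then show ?thesis using sum p by simp
    next
      case p0: False
      have bound: "2 * rho V \<le> card V + 1" using crit_conn_bound[OF V(1) True V(2)] .
      \<comment> \<open>The bound says \<open>rho V \<le> p + 1\<close>. Equality is the tight case
        with \<open>card V - 1 = 2 * p\<close>; otherwise \<open>card V \<le> 2 * p\<close>, and the
        semidegrees already give \<open>4 * p^2\<close>.\<close>
      have "W V \<le> 4 * p^2 + 4"
      proof (cases "card V + 1 = 2 * rho V")
        case eq: True
        then have "card V - 1 = 2 * p" using p by simp
        then have "(card V - 1)^2 = 4 * p^2" by (simp add: power2_eq_square)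
        then show ?thesis using W_bound_tight[OF V(1) True V(2) eq] by simp
      next
        case False
        then have "card V \<le> 2 * p" using bound p by simp
        then have "card V * (2 * p) \<le> 2 * p * (2 * p)" by (intro mult_right_mono) auto
        with sum have "W V \<le> 2 * p * (2 * p)" by (rule le_trans)
        then show ?thesis by (simp add: power2_eq_square)
      qed
      then show ?thesis using p p0 by simp
    qed
  next
    case False
    then obtain X where X: "X \<subseteq> V" "X \<noteq> {}" "X \<noteq> V" "apart X (V - X)" by (auto simp: conn_def)
    define Y where "Y = V - X"
    have XY: "X \<union> Y = V" "X \<inter> Y = {}" "apart X Y" "apart Y X" using X apart_sym by (auto simp: Y_def)
    have fin: "finite X" "finite Y" using V(1) X(1) finite_subset by (auto simp: Y_def)
    have crit: "crit X" "crit Y" using crit_apart[of X Y] crit_apart[of Y X] V XY by (auto simp: Un_commute Int_commute)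
    have "card X < card V" "card Y < card V" using X V(1) by (auto simp: Y_def intro!: psubset_card_mono)
    then have IH: "W X \<le> (if card X = rho X then 0 else 4 * (card X - rho X)^2 + 4)"
      "W Y \<le> (if card Y = rho Y then 0 else 4 * (card Y - rho Y)^2 + 4)"
      using less.hyps fin crit by blast+
    have "wt y X = 0" if "y \<in> Y" for y
      using XY(4) that by (simp add: wt_def apart_def adj_w)
    then have W: "W V = W X + W Y" using W_Un[OF fin XY(2)] XY(1) by simp
    have rho: "rho V = rho X + rho Y" using rho_Un_apart[OF fin XY(2,3)] XY(1) by simp
    have card: "card V = card X + card Y" using card_Un_disjoint[OF fin XY(2)] XY(1) by simp
    obtain p q where pq: "card X = rho X + p" "card Y = rho Y + q"
      using le fin by (metis le_Suc_ex)
    have pq': "card V - rho V = p + q" "card V = rho V \<longleftrightarrow> p + q = 0" using pq rho card by simp_all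
    have IH': "W X \<le> (if p = 0 then 0 else 4 * p^2 + 4)" "W Y \<le> (if q = 0 then 0 else 4 * q^2 + 4)"
    proof -
      have "card X - rho X = p" "card Y - rho Y = q" "card X = rho X \<longleftrightarrow> p = 0" "card Y = rho Y \<longleftrightarrow> q = 0"
        using pq by simp_all
      with IH show "W X \<le> (if p = 0 then 0 else 4 * p^2 + 4)" "W Y \<le> (if q = 0 then 0 else 4 * q^2 + 4)"
        by metis+
    qed
    show ?thesis
    \<comment> \<open>A part with value 0 misses no arcs, so the constant 4 is charged only to parts
      whose square can help to pay for it.\<close>
    proof (cases "p = 0 \<or> q = 0")
      case True
      then show ?thesis using IH' W unfolding pq' by auto
    next
      case False
      then have "W V \<le> (4 * p^2 + 4) + (4 * q^2 + 4)" using IH' W by simp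
      also have "\<dots> \<le> 4 * (p + q)^2 + 4" using False by (intro double_square_add) auto
      finally show ?thesis using False unfolding pq' by simp
    qed
  qed
qed

lemma W_plus_arcs:
  assumes V: "finite V" and E: "E \<subseteq> V \<times> V"
  shows "W V + 2 * card E = 2 * (card V * (card V - 1))"
proof -
  have finE: "finite E" using E V finite_subset by blast
  have out: "(\<Sum>x\<in>V. card {y\<in>V. (x, y) \<in> E}) = card E"
  proof -
    have "E = (SIGMA x:V. {y\<in>V. (x, y) \<in> E})" using E by auto
    then show ?thesis using card_SigmaI[of V "\<lambda>x. {y\<in>V. (x, y) \<in> E}"] V by auto
  qed
  have inn: "(\<Sum>x\<in>V. card {y\<in>V. (y, x) \<in> E}) = card E"
  proof -
    have "E\<inverse> = (SIGMA x:V. {y\<in>V. (y, x) \<in> E})" using E by auto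
    then show ?thesis using card_SigmaI[of V "\<lambda>x. {y\<in>V. (y, x) \<in> E}"] V card_inverse[of E] by auto
  qed
  have "W V + card E + card E = (\<Sum>x\<in>V. wt x V + card {y\<in>V. (x, y) \<in> E} + card {y\<in>V. (y, x) \<in> E})"
    by (simp add: sum.distrib out inn W_def)
  also have "\<dots> = (\<Sum>x\<in>V. 2 * (card V - 1))" using wt_plus_degrees[OF V] by simp
  finally show ?thesis by simp
qed

end

section \<open>Critical digraphs\<close>

text \<open>Every closed walk contains a cycle, and closed walks are the loops of the transitive
  closure.\<close>

lemma acyclic_digraph_induce:
  assumes "pair_wf_digraph D" "X \<subseteq> pverts D"
  shows "acyclic_digraph (with_proj D \<restriction> X) \<longleftrightarrow> acyclic (parcs D \<inter> X \<times> X)"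
proof -
  let ?H = "with_proj D \<restriction> X"
  have "wf_digraph (with_proj D)" using assms(1) by (simp add: wf_digraph_wp_iff)
  then interpret H: wf_digraph ?H using assms(2) by (intro wf_digraph.wellformed_induce_subgraph) auto
  have ends: "arcs_ends ?H = parcs D \<inter> X \<times> X"
    by (force simp: arcs_ends_def arc_to_ends_def)
  have "(\<exists>p. H.cycle p) \<longleftrightarrow> (\<exists>p. H.closed_w p)"
    using H.closed_w_imp_cycle H.cycle_altdef by blast
  also have "\<dots> \<longleftrightarrow> (\<exists>u. u \<rightarrow>\<^sup>+\<^bsub>?H\<^esub> u)"
    unfolding H.closed_w_def H.reachable1_awalk by auto
  also have "\<dots> \<longleftrightarrow> \<not> acyclic (parcs D \<inter> X \<times> X)" by (simp add: acyclic_def ends)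
  finally show ?thesis by (simp add: acyclic_digraph_def)
qed

lemma loopfree_arcs_parcs:
  assumes "pair_digraph D"
  shows "loopfree_arcs (parcs D)"
proof
  interpret pair_digraph D by fact
  show "(x, x) \<notin> parcs D" for x using pair_no_loops[of "(x, x)"] by auto
qed

lemma ex_acyclic_coloring_iff:
  assumes "pair_digraph D"
  shows "(\<exists>\<phi>. acyclic_coloring D k \<phi>) \<longleftrightarrow>
    face_complex.covered (loopfree_arcs.acyc (parcs D)) k (pverts D)"
proof -
  interpret pair_digraph D by fact
  interpret L: loopfree_arcs "parcs D" using assms by (rule loopfree_arcs_parcs)
  let ?V = "pverts D"
  have acyc: "acyclic_digraph (with_proj D \<restriction> {v\<in>?V. \<phi> v = i}) \<longleftrightarrow> L.acyc {v\<in>?V. \<phi> v = i}" for \<phi> :: "'a \<Rightarrow> nat" and i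
    unfolding L.acyc_def by (intro acyclic_digraph_induce) (auto intro: pair_wf_digraph_axioms)
  show ?thesis
  proof
    assume "\<exists>\<phi>. acyclic_coloring D k \<phi>"
    then obtain \<phi> where \<phi>: "\<phi> \<in> ?V \<rightarrow> {1..k}" "\<forall>i\<in>{1..k}. L.acyc {v\<in>?V. \<phi> v = i}"
      unfolding acyclic_coloring_def acyc by blast
    show "L.covered k ?V" unfolding L.covered_def
    proof (intro exI conjI)
      show "finite ((\<lambda>i. {v\<in>?V. \<phi> v = i}) ` {1..k})" by simp
      show "card ((\<lambda>i. {v\<in>?V. \<phi> v = i}) ` {1..k}) \<le> k" using card_image_le[of "{1..k}"] by simp
      show "\<forall>C\<in>(\<lambda>i. {v\<in>?V. \<phi> v = i}) ` {1..k}. L.acyc C" using \<phi>(2) by blast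
      show "?V \<subseteq> \<Union>((\<lambda>i. {v\<in>?V. \<phi> v = i}) ` {1..k})" using \<phi>(1) by blast
    qed
  next
    assume "L.covered k ?V"
    then obtain \<C> where C: "finite \<C>" "card \<C> \<le> k" "\<forall>C\<in>\<C>. L.acyc C" "?V \<subseteq> \<Union>\<C>"
      unfolding L.covered_def by blast
    \<comment> \<open>Numbering the faces and choosing one face per vertex turns an overlapping
      cover into a colouring.\<close>
    from C(1,2) obtain g where g: "inj_on g \<C>" "g ` \<C> \<subseteq> {1..k}"
      using card_le_inj[of \<C> "{1..k}"] by auto
    have "\<forall>v\<in>?V. \<exists>C\<in>\<C>. v \<in> C" using C(4) by auto
    then obtain c where c: "\<forall>v\<in>?V. c v \<in> \<C> \<and> v \<in> c v" by metis
    define \<phi> where "\<phi> v = g (c v)" for v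
    have "L.acyc {v\<in>?V. \<phi> v = i}" for i
    proof (cases "{v\<in>?V. \<phi> v = i} = {}")
      case True
      show ?thesis unfolding True by (simp add: L.acyc_def acyclic_def)
    next
      case False
      then obtain u where u: "u \<in> ?V" "\<phi> u = i" by blast
      have "v \<in> c u" if "v \<in> ?V" "\<phi> v = i" for v
      proof -
        have "g (c v) = g (c u)" using that u by (simp add: \<phi>_def)
        then have "c v = c u" using inj_onD[OF g(1)] c that(1) u(1) by blast
        then show ?thesis using c that(1) by metis
      qed
      then have "{v\<in>?V. \<phi> v = i} \<subseteq> c u" by blast
      moreover have "L.acyc (c u)" using C(3) c u(1) by blast
      ultimately show ?thesis using L.face_mono by blast
    qed
    moreover have "\<phi> \<in> ?V \<rightarrow> {1..k}" using g(2) c by (auto simp: \<phi>_def)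
    ultimately show "\<exists>\<phi>. acyclic_coloring D k \<phi>" unfolding acyclic_coloring_def acyc by blast
  qed
qed

lemma dichromatic_number_eq:
  assumes "pair_digraph D"
  shows "dichromatic_number D = face_complex.rho (loopfree_arcs.acyc (parcs D)) (pverts D)"
proof -
  interpret L: loopfree_arcs "parcs D" using assms by (rule loopfree_arcs_parcs)
  show ?thesis unfolding dichromatic_number_def L.rho_def using ex_acyclic_coloring_iff[OF assms] by simp
qed

lemma dichromatic_number_le_iff:
  assumes "pair_digraph D"
  shows "dichromatic_number D \<le> k \<longleftrightarrow>
    face_complex.covered (loopfree_arcs.acyc (parcs D)) k (pverts D)"
proof -
  interpret L: loopfree_arcs "parcs D" using assms by (rule loopfree_arcs_parcs)
  have "finite (pverts D)" using assms by (simp add: pair_digraph_def pair_fin_digraph.pair_finite_verts)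
  then show ?thesis using dichromatic_number_eq[OF assms] L.covered_iff by simp
qed

lemma critical_crit:
  assumes "critical k D"
  shows "face_complex.crit (loopfree_arcs.acyc (parcs D)) (pverts D)"
proof -
  have D: "pair_digraph D" and k: "dichromatic_number D = k"
    and sub: "\<And>D'. subgraph (with_proj D') (with_proj D) \<Longrightarrow> D' \<noteq> D \<Longrightarrow> dichromatic_number D' < k"
    using assms by (auto simp: critical_def)
  interpret pair_digraph D by fact
  interpret L: loopfree_arcs "parcs D" using D by (rule loopfree_arcs_parcs)
  show ?thesis unfolding L.crit_def
  proof
    fix x assume x: "x \<in> pverts D"
    define U where "U = pverts D - {x}"
    define D' where "D' = \<lparr>pverts = U, parcs = parcs D \<inter> U \<times> U\<rparr>"
    have fin: "finite U" by (simp add: U_def pair_finite_verts)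
    have D': "pair_digraph D'"
      using pair_no_loops pair_finite_arcs fin by unfold_locales (auto simp: D'_def)
    interpret L': loopfree_arcs "parcs D'" using D' by (rule loopfree_arcs_parcs)
    have "subgraph (with_proj D') (with_proj D)"
      using D' D unfolding subgraph_def compatible_def wf_digraph_wp_iff
      by (auto simp: D'_def U_def pair_digraph_def pair_fin_digraph_def)
    moreover have "D' \<noteq> D"
    proof
      assume "D' = D"
      then have "pverts D' = pverts D" by simp
      then show False using x by (auto simp: D'_def U_def)
    qed
    ultimately have "dichromatic_number D' < k" by (rule sub)
    then have less: "L'.rho U < L.rho (pverts D)"
      using dichromatic_number_eq[OF D'] dichromatic_number_eq[OF D] k by (simp add: D'_def)
    obtain \<C> where C: "finite \<C>" "card \<C> \<le> L'.rho U" "\<forall>C\<in>\<C>. L'.acyc C" "U \<subseteq> \<Union>\<C>"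
      using L'.covered_rho[OF fin] unfolding L'.covered_def by blast
    \<comment> \<open>Faces for \<open>D'\<close> may contain vertices outside \<open>U\<close>,
      where \<open>D'\<close> has no arcs; they must be cut down to \<open>U\<close> to be acyclic
      in \<open>D\<close>.\<close>
    have "L.covered (L'.rho U) U" unfolding L.covered_def
    proof (intro exI conjI)
      show "finite ((\<lambda>C. C \<inter> U) ` \<C>)" using C by simp
      show "card ((\<lambda>C. C \<inter> U) ` \<C>) \<le> L'.rho U" using C card_image_le le_trans by blast
      show "U \<subseteq> \<Union>((\<lambda>C. C \<inter> U) ` \<C>)" using C(4) by auto
      have "L.acyc (C \<inter> U)" if "C \<in> \<C>" for C
      proof -
        have "parcs D' \<inter> C \<times> C = parcs D \<inter> (C \<inter> U) \<times> (C \<inter> U)" by (auto simp: D'_def)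
        then show ?thesis using C(3) that unfolding L.acyc_def L'.acyc_def by metis
      qed
      then show "\<forall>C\<in>(\<lambda>C. C \<inter> U) ` \<C>. L.acyc C" by blast
    qed
    then have "L.rho U \<le> L'.rho U" using L.covered_iff fin by blast
    then show "L.rho (pverts D - {x}) < L.rho (pverts D)" using less by (simp add: U_def)
  qed
qed

theorem critical_arcs_ge:
  assumes D: "critical k D" and n: "card (pverts D) = k + p" and p: "0 < p"
  shows "(k + p) * (k + p - 1) \<le> card (parcs D) + 2 * (p^2 + 1)"
proof -
  have pd: "pair_digraph D" and k: "dichromatic_number D = k" using D by (auto simp: critical_def)
  interpret pair_digraph D by fact
  interpret L: loopfree_arcs "parcs D" using pd by (rule loopfree_arcs_parcs)
  have rho: "L.rho (pverts D) = k" using dichromatic_number_eq[OF pd] k by simp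
  have "parcs D \<subseteq> pverts D \<times> pverts D" using in_arcsD1 in_arcsD2 by auto
  from L.W_plus_arcs[OF pair_finite_verts this]
  have "L.W (pverts D) + 2 * card (parcs D) = 2 * ((k + p) * (k + p - 1))" by (simp add: n)
  moreover have "L.W (pverts D) \<le> 4 * p^2 + 4"
    using L.W_bound[OF pair_finite_verts critical_crit[OF D]] n rho p by simp
  ultimately show ?thesis by simp
qed

section \<open>Extremal digraphs\<close>

text \<open>
  The vertices 0 and 1 are Gallai's two special vertices, \<open>B = {2..<p+2}\<close> and \<open>A = {p+2..<2*p+1}\<close> his
  two cliques, where \<open>B\<close> is split into \<open>{2}\<close>, joined to 0, and \<open>{3..<p+2}\<close>, joined to 1.  The remaining
  vertices are joined to everything.  \<open>nonedge\<close> lists each missing edge once, in increasing order.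
\<close>

definition nonedge :: "nat \<Rightarrow> nat \<Rightarrow> nat \<Rightarrow> bool" where
  "nonedge p u v \<longleftrightarrow> u = 0 \<and> v = 1 \<or> u = 0 \<and> v \<in> {3..<p+2} \<or> u = 1 \<and> v = 2 \<or>
     u \<in> {2..<p+2} \<and> v \<in> {p+2..<2*p+1}"

definition extremal :: "nat \<Rightarrow> nat \<Rightarrow> nat pair_pre_digraph" where
  "extremal k p = \<lparr>pverts = {..<k+p},
     parcs = {(u, v). u < k+p \<and> v < k+p \<and> u \<noteq> v \<and> \<not> nonedge p u v \<and> \<not> nonedge p v u}\<rparr>"

lemma nonedge_less: "nonedge p u v \<Longrightarrow> u < v"
  by (auto simp: nonedge_def)

lemma pair_digraph_extremal: "pair_digraph (extremal k p)"
proof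
  show "finite (parcs (extremal k p))"
    by (rule finite_subset[of _ "{..<k+p} \<times> {..<k+p}"]) (auto simp: extremal_def)
qed (auto simp: extremal_def)

lemma card_parcs_extremal:
  assumes p: "2 \<le> p" "p + 1 \<le> k"
  shows "card (parcs (extremal k p)) + 2 * (p^2 + 1) = (k + p) * (k + p - 1)"
proof -
  let ?V = "{..<k+p}"
  define N where "N = {(u, v). nonedge p u v}"
  define B A where "B = {2..<p+2}" and "A = {p+2..<2*p+1}"
  have N: "N = ({0} \<times> insert 1 {3..<p+2}) \<union> {(1, 2)} \<union> (B \<times> A)"
    by (auto simp: N_def nonedge_def B_def A_def)
  have "card (({0} \<times> insert 1 {3..<p+2}) \<union> {(1, 2)} \<union> (B \<times> A)) =
      card ({0::nat} \<times> insert 1 {3..<p+2}) + card {(1::nat, 2::nat)} + card (B \<times> A)"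
    by (subst card_Un_disjoint; (subst card_Un_disjoint)?) (auto simp: B_def A_def)
  \<comment> \<open>Vertex 0 is not joined to 1 and to the \<open>p - 1\<close> vertices of
    \<open>B\<close> other than 2, vertex 1 is not joined to 2, and nothing joins \<open>B\<close>
    to \<open>A\<close>.\<close>
  also have "\<dots> = 1 + (p - 1) + 1 + p * (p - 1)"
    using p by (simp add: card_cartesian_product B_def A_def)
  also have "\<dots> = p^2 + 1" using p by (cases p) (auto simp: power2_eq_square)
  finally have cardN: "card N = p^2 + 1" using N by simp
  have finN: "finite N" unfolding N by (simp add: A_def B_def)
  have NV: "N \<subseteq> ?V \<times> ?V" using p by (auto simp: N A_def B_def)
  have asym: "\<not> (nonedge p u v \<and> nonedge p v u)" for u v
    using nonedge_less[of p u v] nonedge_less[of p v u] by auto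
  have disj: "N \<inter> N\<inverse> = {}" "N \<inter> Id_on ?V = {}" "N\<inverse> \<inter> Id_on ?V = {}"
    using asym unfolding N_def by auto
  have finI: "finite (Id_on ?V)" by (rule finite_subset[of _ "?V \<times> ?V"]) auto
  have cardI: "card (Id_on ?V) = k + p"
  proof -
    have "Id_on ?V = (\<lambda>x. (x, x)) ` ?V" by auto
    then show ?thesis by (simp add: card_image inj_on_def)
  qed
  have parcs: "parcs (extremal k p) = ?V \<times> ?V - (N \<union> N\<inverse> \<union> Id_on ?V)"
    by (auto simp: extremal_def N_def)
  have sub: "N \<union> N\<inverse> \<union> Id_on ?V \<subseteq> ?V \<times> ?V" using NV by auto
  moreover have "card (N \<union> N\<inverse> \<union> Id_on ?V) = 2 * (p^2 + 1) + (k + p)"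
  proof -
    have "card (N \<union> N\<inverse>) = 2 * (p^2 + 1)" using card_Un_disjoint[of N "N\<inverse>"] finN disj(1) cardN by simp
    then show ?thesis using card_Un_disjoint[of "N \<union> N\<inverse>" "Id_on ?V"] finN finI disj cardI by auto
  qed
  moreover have "card (N \<union> N\<inverse> \<union> Id_on ?V) \<le> card (?V \<times> ?V)" using sub by (intro card_mono) auto
  moreover have "card (?V \<times> ?V - (N \<union> N\<inverse> \<union> Id_on ?V)) = card (?V \<times> ?V) - card (N \<union> N\<inverse> \<union> Id_on ?V)"
    using sub finN finI by (intro card_Diff_subset) auto
  moreover have "card (?V \<times> ?V) = (k + p) * (k + p)" by simp
  ultimately have "card (parcs (extremal k p)) + 2 * (p^2 + 1) + (k + p) = (k + p) * (k + p)"
    unfolding parcs by linarith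
  then show ?thesis by (simp add: diff_mult_distrib2)
qed

text \<open>The pair \<open>a\<close>, \<open>b\<close> acts as a deleted edge. The complex is left
  abstract because there are two uses: proper subdigraphs, and the complex that ignores vertex 2 in
  the upper bound on the dichromatic number.\<close>

lemma extremal_covered:
  fixes face :: "nat set \<Rightarrow> bool"
  assumes complex: "face_complex face"
    and ok: "\<And>X. (\<And>x y. x \<in> X \<Longrightarrow> y \<in> X \<Longrightarrow> x < y \<Longrightarrow> nonedge p x y \<or> x = a \<and> y = b) \<Longrightarrow> face X"
    and p: "2 \<le> p" "p + 1 \<le> k" and ab: "a < b" "b < k + p" "\<not> nonedge p a b"
  shows "face_complex.covered face (k - 1) {..<k+p}"
proof -
  interpret face_complex face by fact
  define B A U C where "B = {2..<p+2}" and "A = {p+2..<2*p+1}" and "U = {2*p+1..<k+p}" and "C = {..<2*p+1}"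
  have finAB: "finite A" "finite B" by (simp_all add: A_def B_def)
  have cardAB: "card A = p - 1" "card B = p" by (simp_all add: A_def B_def)
  have C: "C = {0, 1} \<union> A \<union> B" using p by (auto simp: A_def B_def C_def)
  have biclique: "covered (card X) (X \<union> Y)" if XY: "X \<subseteq> A" "Y \<subseteq> B" "card X = card Y" for X Y
  proof -
    have fin: "finite X" "finite Y" using XY finAB finite_subset by auto
    then obtain f where f: "bij_betw f X Y" using XY(3) finite_same_card_bij by blast
    have "face {x, f x}" if "x \<in> X" for x
    proof (rule ok)
      have "x \<in> A" "f x \<in> B" using that XY bij_betwE[OF f] by auto
      then show "nonedge p u v \<or> u = a \<and> v = b" if "u \<in> {x, f x}" "v \<in> {x, f x}" "u < v" for u v
        using that by (auto simp: nonedge_def A_def B_def)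
    qed
    moreover have "X \<union> Y \<subseteq> \<Union>((\<lambda>x. {x, f x}) ` X)" using bij_betw_imp_surj_on[OF f] by auto
    moreover have "card ((\<lambda>x. {x, f x}) ` X) \<le> card X" using fin by (intro card_image_le)
    ultimately show ?thesis unfolding covered_def using fin
      by (intro exI[of _ "(\<lambda>x. {x, f x}) ` X"]) simp
  qed
  have cov1: "covered 1 X"
    if "\<And>x y. x \<in> X \<Longrightarrow> y \<in> X \<Longrightarrow> x < y \<Longrightarrow> nonedge p x y \<or> x = a \<and> y = b" for X
    using that by (intro covered_face ok)
  have f01: "covered 1 {0, 1}" by (intro cov1) (auto simp: nonedge_def)
  have f12: "covered 1 {1, 2}" by (intro cov1) (auto simp: nonedge_def)
  have f03: "covered 1 {0, 3}" using p by (intro cov1) (auto simp: nonedge_def)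
  \<comment> \<open>The non-edges on the core \<open>C\<close> form a factor-critical graph:
    \<open>{0, 1}\<close>, \<open>{1, 2}\<close> and \<open>{0, 3}\<close> take care of 0 and 1, and
    the rest is matched between \<open>A\<close> and \<open>B\<close>.\<close>
  have minus: "covered p (C - {c})" if c: "c \<in> C" for c
  proof -
    consider "c = 0" | "c = 1" | "c \<in> B" | "c \<in> A" using c C by auto
    then show ?thesis
    proof cases
      case 1
      have "covered (card A) (A \<union> (B - {2}))" using p cardAB finAB by (intro biclique) (auto simp: B_def)
      from covered_Un[OF f12 this] show ?thesis
        by (rule covered_mono) (use p cardAB 1 C in auto)
    next
      case 2
      have "covered (card A) (A \<union> (B - {3}))" using p cardAB finAB by (intro biclique) (auto simp: B_def)
      from covered_Un[OF f03 this] show ?thesis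
        by (rule covered_mono) (use p cardAB 2 C in auto)
    next
      case 3
      have "covered (card A) (A \<union> (B - {c}))" using p cardAB finAB 3 by (intro biclique) auto
      from covered_Un[OF f01 this] show ?thesis
        by (rule covered_mono) (use p cardAB 3 C in auto)
    next
      case 4
      have "card (B - {2, 3}) = p - 2" using p by (subst card_Diff_subset) (auto simp: B_def)
      moreover have cA: "card (A - {c}) = p - 2" using 4 finAB cardAB by simp
      ultimately have "covered (card (A - {c})) ((A - {c}) \<union> (B - {2, 3}))" by (intro biclique) auto
      from covered_Un[OF f12 covered_Un[OF f03 this]] show ?thesis
        by (rule covered_mono) (use p cA 4 C in auto)
    qed
  qed
  have fab: "covered 1 {a, b}" using ab(1) by (intro covered_face ok) auto
  have V: "{..<k+p} = C \<union> U" using p by (auto simp: C_def U_def)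
  have cardU: "card U = k - p - 1" "finite U" by (simp_all add: U_def)
  have core: "covered p C" if bC: "b \<in> C"
  proof -
    have two: "card (B - {2, 3}) = p - 2" using p by (subst card_Diff_subset) (auto simp: B_def)
    have "a \<in> C" using bC ab(1) by (simp add: C_def)
    then have "a = 0 \<or> a = 1 \<or> a \<in> A \<or> a \<in> B" "b = 1 \<or> b \<in> A \<or> b \<in> B"
      using bC C ab(1) by auto
    moreover have "\<not> (a = 0 \<and> b = 1)" "\<not> (a = 0 \<and> b \<in> B \<and> b \<noteq> 2)" "\<not> (a = 1 \<and> b = 2)"
        "\<not> (a \<in> B \<and> b \<in> A)" "\<not> (a \<in> A \<and> b \<in> B)" "\<not> (a \<in> A \<and> b = 1)" "\<not> (a \<in> B \<and> b = 1)"
      using ab(1,3) by (auto simp: nonedge_def A_def B_def)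
    \<comment> \<open>These are all the edges of the core. Adding one to the non-edges closes a
      triangle, with third vertex 1, 0, 3, 2, \<open>p + 2\<close>, 4 respectively, whose complement
      in the core is matched: \<open>p\<close> faces for \<open>2 * p + 1\<close> vertices.\<close>
    ultimately have "a = 0 \<and> b = 2 \<or> a = 1 \<and> b \<in> B \<and> b \<noteq> 2 \<or> a = 0 \<and> b \<in> A \<or> a = 1 \<and> b \<in> A \<or>
        a \<in> B \<and> b \<in> B \<or> a \<in> A \<and> b \<in> A"
      using ab(1) by blast
    then consider "a = 0" "b = 2" | "a = 1" "b \<in> B" "b \<noteq> 2" | "a = 0" "b \<in> A" | "a = 1" "b \<in> A"
      | "a \<in> B" "b \<in> B" | "a \<in> A" "b \<in> A" by blast
    then show ?thesis
    proof cases
      case 1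
      have "covered 1 {0, 1, 2}" using 1 by (intro cov1) (auto simp: nonedge_def)
      moreover have "covered (card A) (A \<union> (B - {2}))" using p cardAB finAB by (intro biclique) (auto simp: B_def)
      ultimately have "covered (1 + card A) ({0, 1, 2} \<union> (A \<union> (B - {2})))" by (rule covered_Un)
      then show ?thesis by (rule covered_mono) (use p cardAB C in auto)
    next
      case 2
      have "covered 1 {0, 1, b}" using 2 by (intro cov1) (auto simp: nonedge_def B_def)
      moreover have "covered (card A) (A \<union> (B - {b}))" using p cardAB finAB 2 by (intro biclique) auto
      ultimately have "covered (1 + card A) ({0, 1, b} \<union> (A \<union> (B - {b})))" by (rule covered_Un)
      then show ?thesis by (rule covered_mono) (use p cardAB C in auto)
    next
      case 3
      have cA: "card (A - {b}) = p - 2" using 3 finAB cardAB by simp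
      have "covered 1 {0, 3, b}" using 3 p by (intro cov1) (auto simp: nonedge_def A_def)
      moreover have "covered (card (A - {b})) ((A - {b}) \<union> (B - {2, 3}))" using cA two by (intro biclique) auto
      ultimately have "covered (1 + (1 + card (A - {b}))) ({1, 2} \<union> ({0, 3, b} \<union> ((A - {b}) \<union> (B - {2, 3}))))"
        by (intro covered_Un f12)
      then show ?thesis by (rule covered_mono) (use p cA C in auto)
    next
      case 4
      have cA: "card (A - {b}) = p - 2" using 4 finAB cardAB by simp
      have "covered 1 {1, 2, b}" using 4 p by (intro cov1) (auto simp: nonedge_def A_def)
      moreover have "covered (card (A - {b})) ((A - {b}) \<union> (B - {2, 3}))" using cA two by (intro biclique) auto
      ultimately have "covered (1 + (1 + card (A - {b}))) ({0, 3} \<union> ({1, 2, b} \<union> ((A - {b}) \<union> (B - {2, 3}))))"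
        by (intro covered_Un f03)
      then show ?thesis by (rule covered_mono) (use p cA C in auto)
    next
      case 5
      have cA: "card (A - {p + 2}) = p - 2" using p finAB cardAB by (simp add: A_def)
      have "card (B - {a, b}) = p - 2" using 5 ab(1) cardAB finAB by (subst card_Diff_subset) auto
      then have "covered (card (A - {p + 2})) ((A - {p + 2}) \<union> (B - {a, b}))" using cA by (intro biclique) auto
      moreover have "covered 1 {a, b, p + 2}"
      proof (rule cov1)
        have ne: "nonedge p a (p + 2)" "nonedge p b (p + 2)" using 5 p(1) by (simp_all add: nonedge_def B_def)
        note less = ab(1) nonedge_less[OF ne(1)] nonedge_less[OF ne(2)]
        fix x y assume "x \<in> {a, b, p + 2}" "y \<in> {a, b, p + 2}" "x < y"
        then have "x = a \<and> y = b \<or> x = a \<and> y = p + 2 \<or> x = b \<and> y = p + 2"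
          using less by (metis insertE less_asym less_irrefl singletonD)
        then show "nonedge p x y \<or> x = a \<and> y = b" using ne by blast
      qed
      ultimately have "covered (1 + (1 + card (A - {p + 2}))) ({0, 1} \<union> ({a, b, p + 2} \<union> ((A - {p + 2}) \<union> (B - {a, b}))))"
        by (intro covered_Un f01)
      then show ?thesis by (rule covered_mono) (use p cA C in auto)
    next
      case 6
      \<comment> \<open>Two vertices in \<open>A\<close> force \<open>p \<ge> 3\<close>, and so 4
        lies in \<open>B\<close>; 2 and 3 are reserved for 1 and 0.\<close>
      have "card {a, b} \<le> card A" using 6 finAB by (intro card_mono) auto
      then have p3: "3 \<le> p" using cardAB ab(1) by simp
      have cA: "card (A - {a, b}) = p - 3" using 6 ab(1) cardAB finAB by (subst card_Diff_subset) auto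
      have "card (B - {2, 3, 4}) = p - 3" using p3 by (subst card_Diff_subset) (auto simp: B_def)
      then have "covered (card (A - {a, b})) ((A - {a, b}) \<union> (B - {2, 3, 4}))" using cA by (intro biclique) auto
      moreover have "covered 1 {4, a, b}"
      proof (rule cov1)
        have ne: "nonedge p 4 a" "nonedge p 4 b" using 6 p3 by (simp_all add: nonedge_def A_def)
        note less = ab(1) nonedge_less[OF ne(1)] nonedge_less[OF ne(2)]
        fix x y assume "x \<in> {4, a, b}" "y \<in> {4, a, b}" "x < y"
        then have "x = 4 \<and> y = a \<or> x = 4 \<and> y = b \<or> x = a \<and> y = b"
          using less by (metis insertE less_asym less_irrefl singletonD)
        then show "nonedge p x y \<or> x = a \<and> y = b" using ne by blast
      qed
      ultimately have "covered (1 + (1 + (1 + card (A - {a, b}))))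
          ({0, 3} \<union> ({1, 2} \<union> ({4, a, b} \<union> ((A - {a, b}) \<union> (B - {2, 3, 4})))))"
        by (intro covered_Un f03 f12)
      then show ?thesis by (rule covered_mono) (use p3 cA C in auto)
    qed
  qed
  have "a \<in> C \<union> U" "b \<in> C \<union> U" using ab(1,2) by (simp_all flip: V)
  \<comment> \<open>The \<open>k - p - 1\<close> vertices of \<open>U\<close> take a face each. An
    edge from the core to \<open>U\<close> puts its two ends into one face; an edge inside
    \<open>U\<close> saves a face, which is spent on the singleton 0.\<close>
  then consider "b \<in> C" | "b \<in> U" "a \<in> C" | "b \<in> U" "a \<in> U" by blast
  then show ?thesis
  proof cases
    case 1
    have "covered (p + card U) (C \<union> U)" using core[OF 1] covered_card[OF cardU(2)] by (rule covered_Un)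
    then show ?thesis by (rule covered_mono) (use V cardU p in auto)
  next
    case 2
    have "card {b} \<le> card U" using 2(1) cardU(2) by (intro card_mono) auto
    then have cU: "card (U - {b}) = k - p - 2" "1 \<le> card U" using 2(1) cardU by simp_all
    have "covered (1 + (p + card (U - {b}))) ({a, b} \<union> ((C - {a}) \<union> (U - {b})))"
      using fab minus[OF 2(2)] covered_card[of "U - {b}"] cardU(2) by (intro covered_Un) auto
    then show ?thesis by (rule covered_mono) (use V cU cardU p in auto)
  next
    case 3
    have "card {a, b} \<le> card U" using 3 cardU(2) by (intro card_mono) auto
    then have U2: "2 \<le> card U" using ab(1) by simp
    have cU: "card (U - {a, b}) = card U - 2" using 3 ab(1) cardU(2) by (subst card_Diff_subset) auto
    have "0 \<in> C" by (simp add: C_def)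
    have "covered (1 + (1 + (p + card (U - {a, b})))) ({a, b} \<union> ({0} \<union> ((C - {0}) \<union> (U - {a, b}))))"
      using fab minus[OF \<open>0 \<in> C\<close>] covered_card[of "U - {a, b}"] cardU(2) covered_face[OF face_singleton[of 0]]
      by (intro covered_Un) auto
    then show ?thesis by (rule covered_mono) (use V cU U2 cardU p in auto)
  qed
qed

text \<open>A complete set of order \<open>k - 1\<close> meets every class exactly once. Comparing
  the sets that consist of 0 or 1 together with \<open>R\<close> shows that 0 and 1 share a class;
  the set \<open>B \<union> U\<close> then has a vertex in this class, but none is non-adjacent to
  both 0 and 1.\<close>

lemma extremal_not_covered:
  assumes p: "2 \<le> p" "p + 1 \<le> k"
  shows "\<not> face_complex.covered (loopfree_arcs.acyc (parcs (extremal k p))) (k - 1) {..<k+p}"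
proof
  interpret L: loopfree_arcs "parcs (extremal k p)"
    using pair_digraph_extremal by (rule loopfree_arcs_parcs)
  assume "L.covered (k - 1) {..<k+p}"
  then obtain \<C> where C: "finite \<C>" "card \<C> \<le> k - 1" "\<forall>C\<in>\<C>. L.acyc C" "{..<k+p} \<subseteq> \<Union>\<C>"
    unfolding L.covered_def by blast
  have "\<forall>x\<in>{..<k+p}. \<exists>C\<in>\<C>. x \<in> C" using C(4) by auto
  then obtain c where c: "\<forall>x\<in>{..<k+p}. c x \<in> \<C> \<and> x \<in> c x" by metis
  have edge: "nonedge p x y \<or> nonedge p y x" if "x < k+p" "y < k+p" "x \<noteq> y" "c x = c y" for x y
  proof -
    have "x \<in> c x" "y \<in> c x" "c x \<in> \<C>" using c that by auto
    then have "L.acyc {x, y}" using C(3) L.face_mono[of "c x" "{x, y}"] by auto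
    then have "\<not> ((x, y) \<in> parcs (extremal k p) \<and> (y, x) \<in> parcs (extremal k p))"
      using that(3) L.adj_def L.adj_iff by blast
    then show ?thesis using that(1-3) by (auto simp: extremal_def)
  qed
  have clique: "inj_on c Q \<and> c ` Q = \<C>"
    if Q: "Q \<subseteq> {..<k+p}" "card Q = k - 1" "\<And>x y. x \<in> Q \<Longrightarrow> y \<in> Q \<Longrightarrow> \<not> nonedge p x y" for Q
  proof -
    have inj: "inj_on c Q" using edge Q(1,3) by (intro inj_onI) blast
    have "c ` Q \<subseteq> \<C>" using c Q(1) by auto
    moreover have "card \<C> \<le> card (c ` Q)" using C(2) Q(2) card_image[OF inj] by simp
    ultimately have "c ` Q = \<C>" using C(1) by (intro card_seteq)
    with inj show ?thesis by blast
  qed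
  \<comment> \<open>The union of the clique \<open>A\<close> and the vertices joined to everything,
    of order \<open>k - 2\<close>.\<close>
  define R where "R = {p+2..<k+p}"
  have "card (insert v R) = k - 1" if "v < 2" for v
    using that p by (simp add: R_def)
  then have K0: "inj_on c (insert 0 R) \<and> c ` insert 0 R = \<C>" and K1: "inj_on c (insert 1 R) \<and> c ` insert 1 R = \<C>"
    using p by (intro clique; auto simp: R_def nonedge_def)+
  have K2: "inj_on c ({2..<p+2} \<union> {2*p+1..<k+p}) \<and> c ` ({2..<p+2} \<union> {2*p+1..<k+p}) = \<C>"
    using p by (intro clique) (auto simp: nonedge_def card_Un_disjoint)
  have "c 1 \<in> c ` insert 0 R" using K0 K1 by blast
  then obtain r where r: "r \<in> insert 0 R" "c 1 = c r" by blast
  have "r \<notin> R"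
  proof
    assume "r \<in> R"
    then have "1 = r" using K1 r(2) by (metis inj_onD insertCI)
    then show False using \<open>r \<in> R\<close> by (simp add: R_def)
  qed
  then have c01: "c 1 = c 0" using r by auto
  have "c 0 \<in> c ` ({2..<p+2} \<union> {2*p+1..<k+p})" using K0 K2 by blast
  then obtain b where b: "b \<in> {2..<p+2} \<union> {2*p+1..<k+p}" "c 0 = c b" by blast
  have bV: "b < k + p" "b \<noteq> 0" "b \<noteq> 1" using b(1) p by auto
  have "nonedge p 0 b \<or> nonedge p b 0" using edge[of 0 b] b(2) bV p by simp
  moreover have "nonedge p 1 b \<or> nonedge p b 1" using edge[of 1 b] b(2) c01 bV p by simp
  ultimately show False using bV(2,3) by (auto simp: nonedge_def)
qed

text \<open>No vertex is isolated, so a subdigraph that lacks a vertex also lacks an arc.\<close>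

lemma extremal_degree:
  assumes p: "2 \<le> p" "p + 1 \<le> k" and x: "x < k + p"
  shows "\<exists>y. (x, y) \<in> parcs (extremal k p)"
proof -
  consider "x < 2" | "x = 2" | "3 \<le> x" "x < p + 2" | "p + 2 \<le> x" by linarith
  then show ?thesis
  proof cases
    case 1
    then show ?thesis using p by (intro exI[of _ "p + 2"]) (auto simp: extremal_def nonedge_def)
  next
    case 2
    then show ?thesis using p by (intro exI[of _ 3]) (auto simp: extremal_def nonedge_def)
  next
    case 3
    then show ?thesis using p by (intro exI[of _ 2]) (auto simp: extremal_def nonedge_def)
  next
    case 4
    then show ?thesis using p x by (intro exI[of _ 0]) (auto simp: extremal_def nonedge_def)
  qed
qed

lemma critical_extremal:
  assumes p: "2 \<le> p" "p + 1 \<le> k"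
  shows "critical k (extremal k p)"
  unfolding critical_def
proof (intro conjI allI impI)
  let ?D = "extremal k p" and ?V = "{..<k+p}"
  have V: "pverts ?D = ?V" by (simp add: extremal_def)
  show pd: "pair_digraph ?D" by (rule pair_digraph_extremal)
  have sub_less: "dichromatic_number D' < k" if D': "subgraph (with_proj D') (with_proj ?D)" "D' \<noteq> ?D" for D'
  proof -
    have sub: "pverts D' \<subseteq> ?V" "parcs D' \<subseteq> parcs ?D" and wf: "pair_wf_digraph D'"
      using D'(1) V by (auto simp: subgraph_def wf_digraph_wp_iff)
    interpret D: pair_digraph ?D by fact
    interpret W: pair_wf_digraph D' by fact
    have "finite (pverts D')" "finite (parcs D')"
      using finite_subset[OF sub(1)] finite_subset[OF sub(2) D.pair_finite_arcs] by auto
    then have pd': "pair_digraph D'" using sub(2) D.pair_no_loops by unfold_locales auto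
    have "\<exists>u v. (u, v) \<in> parcs ?D - parcs D'"
    proof (cases "pverts D' = ?V")
      case True
      then have "parcs D' \<noteq> parcs ?D" using D'(2) V by auto
      then show ?thesis using sub(2) by auto
    next
      case False
      then obtain x where x: "x \<in> ?V" "x \<notin> pverts D'" using sub(1) by blast
      then obtain y where "(x, y) \<in> parcs ?D" using extremal_degree[OF p] by blast
      moreover have "(x, y) \<notin> parcs D'" using W.in_arcsD1 x(2) by blast
      ultimately show ?thesis by blast
    qed
    then obtain u v where uv: "(u, v) \<in> parcs ?D" "(u, v) \<notin> parcs D'" by blast
    interpret L: loopfree_arcs "parcs D'" using pd' by (rule loopfree_arcs_parcs)
    \<comment> \<open>All of \<open>?V\<close> is covered, with vertices absent from
      \<open>D'\<close> treated as isolated; restricting to \<open>pverts D'\<close> comes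
      afterwards.\<close>
    have "L.covered (k - 1) ?V"
    proof (rule extremal_covered[OF L.face_complex_axioms _ p, of "min u v" "max u v"])
      show "min u v < max u v" "max u v < k + p" "\<not> nonedge p (min u v) (max u v)"
        using uv(1) by (auto simp: extremal_def min_def max_def)
      fix X assume ok: "\<And>x y. x \<in> X \<Longrightarrow> y \<in> X \<Longrightarrow> x < y \<Longrightarrow> nonedge p x y \<or> x = min u v \<and> y = max u v"
      \<comment> \<open>Of the arcs between \<open>u\<close> and \<open>v\<close> only
        \<open>(v, u)\<close> can survive in \<open>D'\<close>, so placing \<open>v\<close> first
        orders \<open>X\<close> acyclically.\<close>
      have "x = v \<and> y = u" if xy: "x \<in> X" "y \<in> X" "(x, y) \<in> parcs D'" for x y
      proof -
        have D: "(x, y) \<in> parcs ?D" using xy(3) sub(2) by blast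
        then have "x \<noteq> y" "\<not> nonedge p x y" "\<not> nonedge p y x" by (auto simp: extremal_def)
        then have "(x = min u v \<and> y = max u v) \<or> (y = min u v \<and> x = max u v)"
          using ok[of x y] ok[of y x] xy(1,2) by (meson linorder_neqE_nat)
        then have "(x = u \<and> y = v) \<or> (x = v \<and> y = u)" by (auto simp: min_def max_def split: if_splits)
        then show ?thesis using xy(3) uv(2) by auto
      qed
      moreover have "u \<noteq> v" using uv(1) by (auto simp: extremal_def)
      ultimately show "L.acyc X" by (intro L.acyc_rank[of X "\<lambda>x. if x = v then 0 else 1"]) auto
    qed
    then have "L.covered (k - 1) (pverts D')" using sub(1) by (rule L.covered_mono) simp
    then have "dichromatic_number D' \<le> k - 1" using dichromatic_number_le_iff[OF pd'] by simp
    then show ?thesis using p by simp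
  qed
  show "dichromatic_number D' < k" if "subgraph (with_proj D') (with_proj ?D) \<and> D' \<noteq> ?D" for D'
    using that by (elim conjE) (rule sub_less)
  interpret L: loopfree_arcs "parcs ?D" using pd by (rule loopfree_arcs_parcs)
  have "\<not> dichromatic_number ?D \<le> k - 1"
    using extremal_not_covered[OF p] dichromatic_number_le_iff[OF pd] V by simp
  moreover have "dichromatic_number ?D \<le> k"
  proof -
    \<comment> \<open>When vertex 2 is ignored, its edge to 0 may be treated as deleted:
      \<open>k - 1\<close> faces cover all other vertices, and 2 receives a colour of its
      own.\<close>
    let ?F = "\<lambda>X. L.acyc (X - {2})"
    have F: "face_complex ?F"
    proof
      show "?F Y" if "?F X" "Y \<subseteq> X" for X Y
        by (rule L.face_mono[of "X - {2}"]) (use that in auto)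
      show "?F {x}" for x by (rule L.face_mono[OF L.face_singleton[of x]]) auto
    qed
    have "face_complex.covered ?F (k - 1) ?V"
    proof (rule extremal_covered[OF F _ p, of 0 2])
      fix X assume ok: "\<And>x y. x \<in> X \<Longrightarrow> y \<in> X \<Longrightarrow> x < y \<Longrightarrow> nonedge p x y \<or> x = 0 \<and> y = 2"
      have "(x, y) \<notin> parcs ?D" if "x \<in> X - {2}" "y \<in> X - {2}" for x y
        using ok[of x y] ok[of y x] that by (cases x y rule: linorder_cases) (auto simp: extremal_def)
      then show "?F X" by (intro L.acyc_rank[of _ "\<lambda>_. 0"]) auto
    qed (use p in \<open>auto simp: nonedge_def\<close>)
    then obtain \<C> where C: "finite \<C>" "card \<C> \<le> k - 1" "\<forall>C\<in>\<C>. ?F C" "?V \<subseteq> \<Union>\<C>"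
      unfolding face_complex.covered_def[OF F] by blast
    have "L.covered (k - 1) (?V - {2})" unfolding L.covered_def
    proof (intro exI conjI)
      show "finite ((\<lambda>C. C - {2}) ` \<C>)" using C(1) by simp
      show "card ((\<lambda>C. C - {2}) ` \<C>) \<le> k - 1" using card_image_le[OF C(1)] C(2) by (rule le_trans)
      show "\<forall>C\<in>(\<lambda>C. C - {2}) ` \<C>. L.acyc C" using C(3) by blast
      show "?V - {2} \<subseteq> \<Union>((\<lambda>C. C - {2}) ` \<C>)" using C(4) by blast
    qed
    then have "L.covered (k - 1 + 1) (?V - {2} \<union> {2})"
      using L.covered_face[OF L.face_singleton] by (rule L.covered_Un)
    then have "L.covered k ?V" by (rule L.covered_mono) (use p in auto)
    then show ?thesis using dichromatic_number_le_iff[OF pd] V by simp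
  qed
  ultimately show "dichromatic_number ?D = k" by simp
qed

theorem mainTheorem1:
  fixes n k p :: nat
  assumes "n = k + p" and "2 \<le> p" and "p \<le> k - 1"
  shows "int (ext k n) = 2 * (int (n choose 2) - ((int p)\<^sup>2 + 1))"
proof -
  have p: "2 \<le> p" "p + 1 \<le> k" using assms(2,3) by auto
  have mem: "extremal k p \<in> CRI k n"
    using critical_extremal[OF p] assms(1) by (simp add: CRI_def) (simp add: extremal_def)
  have arcs: "card (parcs (extremal k p)) + 2 * (p^2 + 1) = n * (n - 1)"
    using card_parcs_extremal[OF p] assms(1) by simp
  have "card (parcs (extremal k p)) \<le> card (parcs D)" if "D \<in> CRI k n" for D :: "nat pair_pre_digraph"
    using critical_arcs_ge[of k D p] that arcs p assms(1) by (simp add: CRI_def)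
  then have "ext k n = card (parcs (extremal k p))"
    unfolding ext_def using mem by (intro antisym cINF_lower cINF_greatest) auto
  moreover have "2 * (n choose 2) = n * (n - 1)"
  proof -
    have "even (n * (n - 1))" by (cases n) auto
    then show ?thesis by (simp add: choose_two)
  qed
  ultimately have "2 * int (n choose 2) = int (ext k n) + 2 * ((int p)^2 + 1)"
    using arcs by (metis (no_types, opaque_lifting) of_nat_1 of_nat_add of_nat_mult of_nat_numeral of_nat_power)
  then show ?thesis by simp
qed

end
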